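(* (Künneth formula) Let $\Bbbk$ be a field of characteristic zero and let $\mathsf{X}$ and $\mathsf{Y}$ be $\mathsf{E}$-bicomodules such that $\mathsf{X}$ or $\mathsf{Y}$ is locally finite (i.e. has finite-dimensional value on every finite set). Then the map $$-\times-:K^*(\mathsf{X})\otimes K^*(\mathsf{Y})\longrightarrow K^*(\mathsf{X}\cdot\mathsf{Y})$$ is an isomorphism of complexes.
   Context: A (linear) species is a functor from finite sets and bijections to $\Bbbk$-modules; $\mathsf{X}[n]$ is its value on $[n]=\{1,\ldots,n\}$. The Cauchy product is $(\mathsf{X}\cdot\mathsf{Y})[I]=\bigoplus_{(S,T)}\mathsf{X}[S]\otimes\mathsf{Y}[T]$ over ordered pairs of disjoint, possibly empty, $S,T$ with union $I$. The exponential species $\mathsf{E}$, $\mathsf{E}[I]=\Bbbk e_I$, is a bialgebra with product $e_S\otimes e_T\mapsto e_{S\sqcup T}$ and coproduct $e_I\mapsto e_S\otimes e_T$. An $\mathsf{E}$-bicomodule has compatible coactions $\lambda:\mathsf{X}\to\mathsf{E}\cdot\mathsf{X}$ and $\rho:\mathsf{X}\to\mathsf{X}\cdot\mathsf{E}$, written $\lambda(z)=\sum_{(S,T)} e_S\otimes z/\!/T$ and $\rho(z)=\sum_{(S,T)} z\backslash\!\backslash S\otimes e_T$. The product $\mathsf{X}\cdot\mathsf{Y}$ is an $\mathsf{E}$-bicomodule with the diagonal coactions: for $z\otimes w\in\mathsf{X}[S]\otimes\mathsf{Y}[T]$ and $U\subseteq S\sqcup T$, $(z\otimes w)/\!/U=z/\!/(S\cap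 U)\otimes w/\!/(T\cap U)$, and similarly for $\backslash\!\backslash$. The Koszul complex of $\mathsf{X}$ has $K^p(\mathsf{X})=\operatorname{Hom}_{S_p}(\mathsf{X}[p],\operatorname{sgn}_p)$ ($\operatorname{sgn}_p$ is $\Bbbk$ with the sign action) and differential, for $f\in K^p(\mathsf{X})$ and $z\in\mathsf{X}[p+1]$, $$df(z)=\sum_{i=1}^{p+1}(-1)^{i-1}\bigl(f(z\backslash\!\backslash([p+1]\setminus i))-f(z/\!/([p+1]\setminus i))\bigr),$$ where elements of $\mathsf{X}[[p+1]\setminus i]$ are transported to $\mathsf{X}[p]$ along the order-preserving bijection. The tensor product complex has differential $d(f\otimes g)=df\otimes g+(-1)^{p}f\otimes dg$ for $f$ of degree $p$. For $f\in K^p(\mathsf{X})$ and $g\in K^q(\mathsf{Y})$, $f\times g\in K^{p+q}(\mathsf{X}\cdot\mathsf{Y})$ is defined on $z\otimes w\in\mathsf{X}[S]\otimes\mathsf{Y}[T]$, where $(S,T)$ is a decomposition of $[p+q]$ with $\#S=p$, $\#T=q$, by $$(f\times g)(z\otimes w)=(-1)^{\operatorname{sch}(S,T)}f(\lambda_S z)\,g(\lambda_T w),$$ where $\lambda_S:S\to[p]$, $\lambda_T:T\to[q]$ are the order-preserving bijections (acting on $\mathsf{X}$, $\mathsf{Y}$ by functoriality); it is zero on the summands with $\#S\ne p$. Here $\operatorname{sch}(S,T)$ is the number of pairs $(s,t)\in S\times T$ with $s>t$. *)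

theory Defs
  imports "Jordan_Normal_Form.VS_Connect" "HOL-Algebra.AbelCoset" "HOL-Combinatorics.Permutations"
begin

section \<open>Vector space constructions\<close>

text \<open>A vector space over the field \<open>'k\<close> is a structure \<open>V\<close> with
  \<open>vectorspace class_ring V\<close>.  The fields \<^const>\<open>mult\<close> and \<^const>\<open>one\<close>, which the record type of
  modules inherits from rings, carry no meaning.\<close>

definition scalars :: "('k::field, 'k) module" where
  "scalars = \<lparr>carrier = UNIV, mult = (*), one = 1, zero = 0, add = (+), smult = (*)\<rparr>"

abbreviation Lin :: "('k::field, 'a) module \<Rightarrow> ('k, 'b) module \<Rightarrow> ('a \<Rightarrow> 'b) set" where
  "Lin V W \<equiv> LinearCombinations.module_hom class_ring V W"

text \<open>Direct sum of a \<^emph>\<open>finite\<close> family.\<close>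

definition direct_sum_family :: "'i set \<Rightarrow> ('i \<Rightarrow> ('k::field, 'a) module) \<Rightarrow> ('k, 'i \<Rightarrow> 'a) module"
  where
  "direct_sum_family J V =
     \<lparr>carrier = (\<Pi>\<^sub>E j\<in>J. carrier (V j)),
      mult = (\<lambda>_ _. \<lambda>j\<in>J. \<zero>\<^bsub>V j\<^esub>),
      one = (\<lambda>j\<in>J. \<zero>\<^bsub>V j\<^esub>),
      zero = (\<lambda>j\<in>J. \<zero>\<^bsub>V j\<^esub>),
      add = (\<lambda>x y. \<lambda>j\<in>J. x j \<oplus>\<^bsub>V j\<^esub> y j),
      smult = (\<lambda>c x. \<lambda>j\<in>J. c \<odot>\<^bsub>V j\<^esub> x j)\<rparr>"

text \<open>Quotient by a subspace \<open>N\<close>; summing with \<open>N\<close> in the scalar multiplication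
  only matters for the scalar \<open>0\<close>.\<close>

definition quotient_space :: "('k::field, 'a) module \<Rightarrow> 'a set \<Rightarrow> ('k, 'a set) module" where
  "quotient_space V N =
     \<lparr>carrier = a_rcosets\<^bsub>V\<^esub> N,
      mult = (\<lambda>_ _. N),
      one = N,
      zero = N,
      add = (\<lambda>A B. A <+>\<^bsub>V\<^esub> B),
      smult = (\<lambda>c A. N <+>\<^bsub>V\<^esub> ((\<lambda>a. c \<odot>\<^bsub>V\<^esub> a) ` A))\<rparr>"

text \<open>Vector space with basis \<open>B\<close>: finitely supported functions on \<open>B\<close>.\<close>

definition free_space :: "'x set \<Rightarrow> ('k::field, 'x \<Rightarrow> 'k) module" where
  "free_space B = (ring.func_space class_ring B)
     \<lparr>carrier := {F \<in> B \<rightarrow>\<^sub>E UNIV. finite {x \<in> B. F x \<noteq> 0}}\<rparr>"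

definition free_gen :: "'x set \<Rightarrow> 'x \<Rightarrow> 'x \<Rightarrow> 'k::field" where
  "free_gen B x = (\<lambda>y\<in>B. if y = x then 1 else 0)"

text \<open>The tensor product is the free space on pairs modulo the bilinearity relations.\<close>

definition tensor_relators ::
  "('k::field, 'a) module \<Rightarrow> ('k, 'b) module \<Rightarrow> ('a \<times> 'b \<Rightarrow> 'k) set" where
  "tensor_relators V W =
    (let B = carrier V \<times> carrier W; Fr = free_space B; g = (\<lambda>v w. free_gen B (v, w)) in
      {g (v \<oplus>\<^bsub>V\<^esub> v') w \<ominus>\<^bsub>Fr\<^esub> (g v w \<oplus>\<^bsub>Fr\<^esub> g v' w) | v v' w.
         v \<in> carrier V \<and> v' \<in> carrier V \<and> w \<in> carrier W} \<union>
      {g v (w \<oplus>\<^bsub>W\<^esub> w') \<ominus>\<^bsub>Fr\<^esub> (g v w \<oplus>\<^bsub>Fr\<^esub> g v w') | v w w'.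
         v \<in> carrier V \<and> w \<in> carrier W \<and> w' \<in> carrier W} \<union>
      {g (c \<odot>\<^bsub>V\<^esub> v) w \<ominus>\<^bsub>Fr\<^esub> (c \<odot>\<^bsub>Fr\<^esub> g v w) | c v w.
         v \<in> carrier V \<and> w \<in> carrier W} \<union>
      {g v (c \<odot>\<^bsub>W\<^esub> w) \<ominus>\<^bsub>Fr\<^esub> (c \<odot>\<^bsub>Fr\<^esub> g v w) | c v w.
         v \<in> carrier V \<and> w \<in> carrier W})"

definition tensor_relations ::
  "('k::field, 'a) module \<Rightarrow> ('k, 'b) module \<Rightarrow> ('a \<times> 'b \<Rightarrow> 'k) set" where
  "tensor_relations V W = LinearCombinations.module.span class_ring
     (free_space (carrier V \<times> carrier W)) (tensor_relators V W)"

definition tensor ::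
  "('k::field, 'a) module \<Rightarrow> ('k, 'b) module \<Rightarrow> ('k, ('a \<times> 'b \<Rightarrow> 'k) set) module" where
  "tensor V W =
     quotient_space (free_space (carrier V \<times> carrier W)) (tensor_relations V W)"

definition pure_tensor ::
  "('k::field, 'a) module \<Rightarrow> ('k, 'b) module \<Rightarrow> 'a \<Rightarrow> 'b \<Rightarrow> ('a \<times> 'b \<Rightarrow> 'k) set" where
  "pure_tensor V W v w =
     tensor_relations V W +>\<^bsub>free_space (carrier V \<times> carrier W)\<^esub>
       free_gen (carrier V \<times> carrier W) (v, w)"

definition bilinear_maps ::
  "('k::field, 'a) module \<Rightarrow> ('k, 'b) module \<Rightarrow> ('k, 'c) module \<Rightarrow> ('a \<Rightarrow> 'b \<Rightarrow> 'c) set" where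
  "bilinear_maps V W U = {\<beta>. (\<forall>v\<in>carrier V. \<beta> v \<in> Lin W U) \<and>
                             (\<forall>w\<in>carrier W. (\<lambda>v. \<beta> v w) \<in> Lin V U)}"

lemma vectorspace_iff_module:
  "vectorspace (class_ring :: 'k::field ring) V \<longleftrightarrow> Module.module class_ring V"
  using class_field by (auto simp: vectorspace_def)

lemma free_space_vectorspace: "vectorspace class_ring (free_space B :: ('k::field, 'x \<Rightarrow> 'k) module)"
proof -
  let ?F = "ring.func_space class_ring B :: ('k, 'x \<Rightarrow> 'k) module"
  interpret F: Module.module class_ring ?F by (rule class_cring.func_space_is_module)
  have fin: "finite {x \<in> B. F x + G x \<noteq> 0}"
    if "finite {x \<in> B. F x \<noteq> 0}" "finite {x \<in> B. G x \<noteq> 0}" for F G :: "'x \<Rightarrow> 'k"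
    by (rule finite_subset[OF _ finite_UnI[OF that]]) auto
  have "LinearCombinations.submodule class_ring {F \<in> B \<rightarrow>\<^sub>E UNIV. finite {x \<in> B. F x \<noteq> 0}} ?F"
    by (rule submodule.intro[OF F.module_axioms])
      (auto simp: class_ring.func_space_def fin PiE_iff extensional_def cong: conj_cong elim: rev_finite_subset)
  from F.submodule_is_module[OF this] show ?thesis
    by (simp add: vectorspace_iff_module free_space_def)
qed

lemma free_space_simps:
  "carrier (free_space B) = {F \<in> B \<rightarrow>\<^sub>E UNIV. finite {x \<in> B. F x \<noteq> 0}}"
  "\<zero>\<^bsub>free_space B\<^esub> = (\<lambda>x\<in>B. 0)"
  "F \<oplus>\<^bsub>free_space B\<^esub> G = (\<lambda>x\<in>B. F x + G x)"
  "c \<odot>\<^bsub>free_space B\<^esub> F = (\<lambda>x\<in>B. c * F x)"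
  by (simp_all add: free_space_def class_ring.func_space_def)

lemma free_gen_closed: "free_gen B x \<in> carrier (free_space B)"
proof -
  have "{y \<in> B. free_gen B x y \<noteq> 0} \<subseteq> {x}" by (auto simp: free_gen_def)
  then have "finite {y \<in> B. free_gen B x y \<noteq> 0}" by (rule finite_subset) simp
  then show ?thesis by (auto simp: free_space_simps free_gen_def)
qed

context
  fixes V :: "('k::field, 'a) module" and N
  assumes V: "vectorspace class_ring V" and N: "LinearCombinations.submodule class_ring N V"
begin

interpretation V: vectorspace class_ring V by (rule V)
lemma abelian_subgroup_of_submodule: "abelian_subgroup N V"
  using N V.submodule_is_module[OF N]
  by (intro abelian_subgroupI3 additive_subgroup.intro V.M.add.subgroupI)
    (auto simp: LinearCombinations.submodule_def V.abelian_group_axioms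
        simp flip: V.smult_minus_1 simp: class_ring_simps a_inv_def[symmetric])

interpretation N: abelian_subgroup N V by (rule abelian_subgroup_of_submodule)

lemma coset_add:
  "\<lbrakk>v \<in> carrier V; w \<in> carrier V\<rbrakk> \<Longrightarrow>
     (N +>\<^bsub>V\<^esub> v) \<oplus>\<^bsub>quotient_space V N\<^esub> (N +>\<^bsub>V\<^esub> w) = N +>\<^bsub>V\<^esub> (v \<oplus>\<^bsub>V\<^esub> w)"
  by (simp add: quotient_space_def N.a_rcos_sum)

lemma coset_smult:
  assumes v: "v \<in> carrier V"
  shows "c \<odot>\<^bsub>quotient_space V N\<^esub> (N +>\<^bsub>V\<^esub> v) = N +>\<^bsub>V\<^esub> (c \<odot>\<^bsub>V\<^esub> v)"
proof -
  have sub: "N \<subseteq> carrier V" and sm: "\<And>c n. n \<in> N \<Longrightarrow> c \<odot>\<^bsub>V\<^esub> n \<in> N"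
    and ad: "\<And>m n. \<lbrakk>m \<in> N; n \<in> N\<rbrakk> \<Longrightarrow> m \<oplus>\<^bsub>V\<^esub> n \<in> N" and ze: "\<zero>\<^bsub>V\<^esub> \<in> N"
    using N by (auto simp: LinearCombinations.submodule_def)
  have cv: "c \<odot>\<^bsub>V\<^esub> w \<in> carrier V" if "w \<in> carrier V" for w c
    using V.smult_closed that by auto
  have dist: "m \<oplus>\<^bsub>V\<^esub> c \<odot>\<^bsub>V\<^esub> (n \<oplus>\<^bsub>V\<^esub> v) = (m \<oplus>\<^bsub>V\<^esub> c \<odot>\<^bsub>V\<^esub> n) \<oplus>\<^bsub>V\<^esub> c \<odot>\<^bsub>V\<^esub> v"
    if "m \<in> N" "n \<in> N" for m n
    using that sub v cv by (subst V.smult_r_distr) (auto simp: V.M.a_assoc subset_iff)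
  have "m \<oplus>\<^bsub>V\<^esub> c \<odot>\<^bsub>V\<^esub> v \<in> N <+>\<^bsub>V\<^esub> (\<lambda>a. c \<odot>\<^bsub>V\<^esub> a) ` (N +>\<^bsub>V\<^esub> v)" if "m \<in> N" for m
  proof -
    have "\<zero>\<^bsub>V\<^esub> \<oplus>\<^bsub>V\<^esub> v \<in> N +>\<^bsub>V\<^esub> v" using ze by (auto simp: a_r_coset_def')
    then have "v \<in> N +>\<^bsub>V\<^esub> v" using v by simp
    then show ?thesis using that by (auto simp: set_add_def')
  qed
  moreover have "m \<oplus>\<^bsub>V\<^esub> c \<odot>\<^bsub>V\<^esub> (n \<oplus>\<^bsub>V\<^esub> v) \<in> N +>\<^bsub>V\<^esub> (c \<odot>\<^bsub>V\<^esub> v)" if "m \<in> N" "n \<in> N" for m n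
    using dist[OF that] ad[OF that(1) sm[OF that(2), of c]] by (auto simp: a_r_coset_def')
  ultimately have "N <+>\<^bsub>V\<^esub> (\<lambda>a. c \<odot>\<^bsub>V\<^esub> a) ` (N +>\<^bsub>V\<^esub> v) = N +>\<^bsub>V\<^esub> (c \<odot>\<^bsub>V\<^esub> v)"
    unfolding set_add_def' a_r_coset_def' by blast
  then show ?thesis by (simp add: quotient_space_def)
qed

lemma quotient_space_carrier: "carrier (quotient_space V N) = (\<lambda>v. N +>\<^bsub>V\<^esub> v) ` carrier V"
  by (auto simp: quotient_space_def A_RCOSETS_def')

lemma quotient_space_vectorspace: "vectorspace class_ring (quotient_space V N)"
proof -
  have z: "\<zero>\<^bsub>quotient_space V N\<^esub> = N +>\<^bsub>V\<^esub> \<zero>\<^bsub>V\<^esub>"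
    using N by (simp add: quotient_space_def N.a_rcos_const LinearCombinations.submodule_def)
  have cv: "c \<odot>\<^bsub>V\<^esub> w \<in> carrier V" if "w \<in> carrier V" for w c
    using V.smult_closed that by auto
  show ?thesis
    unfolding vectorspace_iff_module
  proof (rule module_criteria, goal_cases)
    case 4
    show ?case
    proof
      fix A assume "A \<in> carrier (quotient_space V N)"
      then obtain v where v: "v \<in> carrier V" "A = N +>\<^bsub>V\<^esub> v"
        by (auto simp: quotient_space_carrier)
      show "\<exists>B\<in>carrier (quotient_space V N). A \<oplus>\<^bsub>quotient_space V N\<^esub> B = \<zero>\<^bsub>quotient_space V N\<^esub>"
        using v by (intro bexI[of _ "N +>\<^bsub>V\<^esub> (\<ominus>\<^bsub>V\<^esub> v)"])
          (simp_all add: quotient_space_carrier coset_add z V.M.r_neg)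
    qed
  qed (auto simp: quotient_space_carrier coset_add coset_smult z cv class_cring.cring_axioms
        V.M.a_ac
        V.smult_r_distr[simplified] V.smult_l_distr[simplified] V.smult_assoc1[simplified] V.smult_one[simplified])
qed

lemma quotient_space_lift:
  assumes U: "vectorspace class_ring U" and f: "f \<in> Lin V U"
    and f0: "\<And>n. n \<in> N \<Longrightarrow> f n = \<zero>\<^bsub>U\<^esub>"
  obtains h where "h \<in> Lin (quotient_space V N) U" "\<And>v. v \<in> carrier V \<Longrightarrow> h (N +>\<^bsub>V\<^esub> v) = f v"
proof
  interpret f: mod_hom class_ring V U f
    using U f V.module_axioms by (auto simp: mod_hom_def mod_hom_axioms_def vectorspace_iff_module)
  define h where "h A = f (SOME a. a \<in> A)" for A
  show h: "h (N +>\<^bsub>V\<^esub> v) = f v" if v: "v \<in> carrier V" for v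
  proof -
    have "(SOME a. a \<in> N +>\<^bsub>V\<^esub> v) \<in> N +>\<^bsub>V\<^esub> v"
      using N.a_rcos_self[OF v] by (rule someI)
    then obtain n where n: "n \<in> N" "(SOME a. a \<in> N +>\<^bsub>V\<^esub> v) = n \<oplus>\<^bsub>V\<^esub> v"
      by (auto simp: a_r_coset_def')
    then show ?thesis
      using v f0 N.a_subset by (auto simp: h_def subset_iff)
  qed
  have cv: "c \<odot>\<^bsub>V\<^esub> w \<in> carrier V" if "w \<in> carrier V" for w c
    using V.smult_closed that by auto
  show "h \<in> Lin (quotient_space V N) U"
    using cv f.f_smult f.f_im f.f_add V.M.a_closed
    by (auto simp: LinearCombinations.module_hom_def quotient_space_carrier coset_add coset_smult h)
qed

end

lemma free_space_lift:
  fixes U :: "('k::field, 'c) module"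
  assumes U: "vectorspace class_ring U" and b: "\<And>x. x \<in> B \<Longrightarrow> b x \<in> carrier U"
  obtains f where "f \<in> Lin (free_space B) U" "\<And>x. x \<in> B \<Longrightarrow> f (free_gen B x) = b x"
proof
  interpret U: vectorspace class_ring U by (rule U)
  have cb: "c \<odot>\<^bsub>U\<^esub> b x \<in> carrier U" if "x \<in> B" for x c
    using U.smult_closed b that by auto
  define f where "f F = finsum U (\<lambda>x. F x \<odot>\<^bsub>U\<^esub> b x) {x \<in> B. F x \<noteq> 0}" for F
  have f: "f F = finsum U (\<lambda>x. F x \<odot>\<^bsub>U\<^esub> b x) A"
    if "finite A" "A \<subseteq> B" "\<And>x. x \<in> B - A \<Longrightarrow> F x = 0" for F A
    unfolding f_def using that b cb U.lmult_0
    by (intro U.M.add.finprod_mono_neutral_cong_left) (auto simp: subset_iff)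
  have closed: "f F \<in> carrier U" for F
    unfolding f_def using cb by (intro U.M.finsum_closed) auto
  show "f (free_gen B x) = b x" if "x \<in> B" for x
    using that f[of "{x}" "free_gen B x"] U.smult_one b by (simp add: free_gen_def)
  show "f \<in> Lin (free_space B) U"
    unfolding LinearCombinations.module_hom_def
  proof (safe, goal_cases)
    case (1 F) show ?case by (rule closed)
  next
    case (2 F G)
    let ?A = "{x \<in> B. F x \<noteq> 0} \<union> {x \<in> B. G x \<noteq> 0}"
    have A: "finite ?A" using 2 by (simp add: free_space_simps)
    have "f (F \<oplus>\<^bsub>free_space B\<^esub> G) = finsum U (\<lambda>x. F x \<odot>\<^bsub>U\<^esub> b x \<oplus>\<^bsub>U\<^esub> G x \<odot>\<^bsub>U\<^esub> b x) ?A"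
      using A cb b U.smult_l_distr
      by (subst f[OF A]) (auto simp: free_space_simps simp del: U.M.finsum_addf intro!: U.M.finsum_cong')
    also have "\<dots> = f F \<oplus>\<^bsub>U\<^esub> f G"
      using A cb by (subst (1 2) f[OF A]) (auto intro!: U.M.finsum_addf)
    finally show ?case .
  next
    case (3 c F)
    let ?A = "{x \<in> B. F x \<noteq> 0}"
    have A: "finite ?A" using 3 by (simp add: free_space_simps)
    have "f (c \<odot>\<^bsub>free_space B\<^esub> F) = finsum U (\<lambda>x. c \<odot>\<^bsub>U\<^esub> (F x \<odot>\<^bsub>U\<^esub> b x)) ?A"
      using A cb b U.smult_assoc1
      by (subst f[OF A]) (auto simp: free_space_simps intro!: U.M.finsum_cong')
    also have "\<dots> = c \<odot>\<^bsub>U\<^esub> f F"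
      using A cb U.finsum_smult[of c "\<lambda>x. F x \<odot>\<^bsub>U\<^esub> b x" ?A] by (subst f[OF A]) auto
    finally show ?case .
  qed
qed

lemma free_space_ext:
  fixes U :: "('k::field, 'c) module"
  assumes U: "vectorspace class_ring U"
    and f: "f \<in> Lin (free_space B) U" and g: "g \<in> Lin (free_space B) U"
    and eq: "\<And>x. x \<in> B \<Longrightarrow> f (free_gen B x) = g (free_gen B x)"
    and F: "F \<in> carrier (free_space B)"
  shows "f F = g F"
proof -
  interpret Fr: vectorspace class_ring "free_space B :: ('k, _) module" by (rule free_space_vectorspace)
  interpret f: mod_hom class_ring "free_space B" U f
    using U f Fr.module_axioms by (auto simp: mod_hom_def mod_hom_axioms_def vectorspace_iff_module)
  interpret g: mod_hom class_ring "free_space B" U g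
    using U g Fr.module_axioms by (auto simp: mod_hom_def mod_hom_axioms_def vectorspace_iff_module)
  have "finite {x \<in> B. F x \<noteq> 0}" using F by (simp add: free_space_simps)
  then show ?thesis using F
  proof (induction "{x \<in> B. F x \<noteq> 0}" arbitrary: F rule: finite_induct)
    case empty
    then have "F = \<zero>\<^bsub>free_space B\<^esub>"
      by (auto simp: free_space_simps fun_eq_iff PiE_iff extensional_def restrict_def)
    then show ?case by simp
  next
    case (insert x A)
    have x: "x \<in> B" using insert.hyps by auto
    define G where "G = (\<lambda>y\<in>B. if y = x then 0 else F y)"
    have A: "A = {y \<in> B. G y \<noteq> 0}" using insert.hyps by (auto simp: G_def)
    have G: "G \<in> carrier (free_space B)"
      using A insert.hyps(1) by (auto simp: free_space_simps G_def)
    have sG: "F x \<odot>\<^bsub>free_space B\<^esub> free_gen B x \<in> carrier (free_space B)"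
      by (simp add: free_gen_closed)
    have "F = G \<oplus>\<^bsub>free_space B\<^esub> (F x \<odot>\<^bsub>free_space B\<^esub> free_gen B x)"
      using insert.prems
      by (auto simp: free_space_simps G_def free_gen_def fun_eq_iff PiE_iff extensional_def restrict_def)
    moreover have "f G = g G" using insert.hyps(3)[OF A G] .
    ultimately show ?case
      using eq[OF x] f.f_add[OF G sG] g.f_add[OF G sG]
        f.f_smult[of "F x", OF _ free_gen_closed] g.f_smult[of "F x", OF _ free_gen_closed] by simp
  qed
qed

lemma tensor_relators_closed:
  fixes V :: "('k::field, 'a) module" and W :: "('k, 'b) module"
  shows "tensor_relators V W \<subseteq> carrier (free_space (carrier V \<times> carrier W))"
proof -
  interpret Fr: vectorspace class_ring "free_space (carrier V \<times> carrier W) :: ('k, _) module"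
    by (rule free_space_vectorspace)
  show ?thesis
    by (auto simp: tensor_relators_def Let_def free_gen_closed)
qed

lemma tensor_relations_submodule:
  fixes V :: "('k::field, 'a) module" and W :: "('k, 'b) module"
  shows "LinearCombinations.submodule class_ring (tensor_relations V W)
     (free_space (carrier V \<times> carrier W))"
proof -
  interpret Fr: vectorspace class_ring "free_space (carrier V \<times> carrier W) :: ('k, _) module"
    by (rule free_space_vectorspace)
  show ?thesis
    unfolding tensor_relations_def
    by (rule Fr.span_is_submodule) (rule tensor_relators_closed)
qed

lemma tensor_vectorspace: "vectorspace class_ring (tensor V W)"
  unfolding tensor_def
  by (rule quotient_space_vectorspace[OF free_space_vectorspace tensor_relations_submodule])

lemma pure_tensor_closed: "pure_tensor V W v w \<in> carrier (tensor V W)"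
  unfolding pure_tensor_def tensor_def
    quotient_space_carrier[OF free_space_vectorspace tensor_relations_submodule]
  by (rule imageI) (rule free_gen_closed)

lemma tensor_coset_eqI:
  fixes V :: "('k::field, 'a) module" and W :: "('k, 'b) module"
  defines "F \<equiv> free_space (carrier V \<times> carrier W) :: ('k, _) module"
  assumes r: "a \<ominus>\<^bsub>F\<^esub> b \<in> tensor_relators V W" and a: "a \<in> carrier F" and b: "b \<in> carrier F"
  shows "tensor_relations V W +>\<^bsub>F\<^esub> a = tensor_relations V W +>\<^bsub>F\<^esub> b"
proof -
  interpret Fr: vectorspace class_ring F unfolding F_def by (rule free_space_vectorspace)
  interpret N: abelian_subgroup "tensor_relations V W" F
    unfolding F_def
    by (rule abelian_subgroup_of_submodule[OF free_space_vectorspace tensor_relations_submodule])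
  have "a \<ominus>\<^bsub>F\<^esub> b \<in> tensor_relations V W"
    using r Fr.in_own_span[OF tensor_relators_closed[of V W, folded F_def]]
    unfolding tensor_relations_def F_def by blast
  then have "a \<in> tensor_relations V W +>\<^bsub>F\<^esub> b"
    using a b by (intro N.a_rcos_module_rev) (auto simp: a_minus_def)
  then show ?thesis
    using b by (intro Fr.M.a_repr_independence[symmetric] N.a_subgroup)
qed

lemma pure_tensor_add:
  fixes V :: "('k::field, 'a) module" and W :: "('k, 'b) module"
  shows "pure_tensor V W v w \<oplus>\<^bsub>tensor V W\<^esub> pure_tensor V W v' w' =
    tensor_relations V W +>\<^bsub>free_space (carrier V \<times> carrier W)\<^esub>
      (free_gen (carrier V \<times> carrier W) (v, w) \<oplus>\<^bsub>free_space (carrier V \<times> carrier W) :: ('k, _) module\<^esub>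
        free_gen (carrier V \<times> carrier W) (v', w'))"
  unfolding pure_tensor_def tensor_def
  by (rule coset_add[OF free_space_vectorspace tensor_relations_submodule free_gen_closed free_gen_closed])

lemma pure_tensor_smult:
  fixes V :: "('k::field, 'a) module" and W :: "('k, 'b) module"
  shows "c \<odot>\<^bsub>tensor V W\<^esub> pure_tensor V W v w =
    tensor_relations V W +>\<^bsub>free_space (carrier V \<times> carrier W)\<^esub>
      (c \<odot>\<^bsub>free_space (carrier V \<times> carrier W) :: ('k, _) module\<^esub> free_gen (carrier V \<times> carrier W) (v, w))"
  unfolding pure_tensor_def tensor_def
  by (rule coset_smult[OF free_space_vectorspace tensor_relations_submodule free_gen_closed])

lemma pure_tensor_linear:
  fixes V :: "('k::field, 'a) module" and W :: "('k, 'b) module"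
  assumes "v \<in> carrier V" "w \<in> carrier W"
  shows "v' \<in> carrier V \<Longrightarrow> pure_tensor V W (v \<oplus>\<^bsub>V\<^esub> v') w =
           pure_tensor V W v w \<oplus>\<^bsub>tensor V W\<^esub> pure_tensor V W v' w"
    and "w' \<in> carrier W \<Longrightarrow> pure_tensor V W v (w \<oplus>\<^bsub>W\<^esub> w') =
           pure_tensor V W v w \<oplus>\<^bsub>tensor V W\<^esub> pure_tensor V W v w'"
    and "pure_tensor V W (c \<odot>\<^bsub>V\<^esub> v) w = c \<odot>\<^bsub>tensor V W\<^esub> pure_tensor V W v w"
    and "pure_tensor V W v (c \<odot>\<^bsub>W\<^esub> w) = c \<odot>\<^bsub>tensor V W\<^esub> pure_tensor V W v w"
proof -
  interpret Fr: vectorspace class_ring "free_space (carrier V \<times> carrier W) :: ('k, _) module"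
    by (rule free_space_vectorspace)
  note cl = Fr.M.a_closed[OF free_gen_closed free_gen_closed]
    Fr.smult_closed[OF _ free_gen_closed, simplified] free_gen_closed
  note d = tensor_relators_def Let_def
  show "pure_tensor V W (v \<oplus>\<^bsub>V\<^esub> v') w =
      pure_tensor V W v w \<oplus>\<^bsub>tensor V W\<^esub> pure_tensor V W v' w" if "v' \<in> carrier V"
    unfolding pure_tensor_add unfolding pure_tensor_def
    by (rule tensor_coset_eqI[OF _ free_gen_closed cl(1)]) (use assms that in \<open>unfold d, blast\<close>)
  show "pure_tensor V W v (w \<oplus>\<^bsub>W\<^esub> w') =
      pure_tensor V W v w \<oplus>\<^bsub>tensor V W\<^esub> pure_tensor V W v w'" if "w' \<in> carrier W"
    unfolding pure_tensor_add unfolding pure_tensor_def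
    by (rule tensor_coset_eqI[OF _ free_gen_closed cl(1)]) (use assms that in \<open>unfold d, blast\<close>)
  show "pure_tensor V W (c \<odot>\<^bsub>V\<^esub> v) w = c \<odot>\<^bsub>tensor V W\<^esub> pure_tensor V W v w"
    unfolding pure_tensor_smult unfolding pure_tensor_def
    by (rule tensor_coset_eqI[OF _ free_gen_closed cl(2)]) (use assms in \<open>unfold d, blast\<close>)
  show "pure_tensor V W v (c \<odot>\<^bsub>W\<^esub> w) = c \<odot>\<^bsub>tensor V W\<^esub> pure_tensor V W v w"
    unfolding pure_tensor_smult unfolding pure_tensor_def
    by (rule tensor_coset_eqI[OF _ free_gen_closed cl(2)]) (use assms in \<open>unfold d, blast\<close>)
qed

lemma pure_tensor_bilinear: "pure_tensor V W \<in> bilinear_maps V W (tensor V W)"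
  by (auto simp: bilinear_maps_def LinearCombinations.module_hom_def pure_tensor_closed
      pure_tensor_linear)

lemma tensor_universal:
  fixes V :: "('k::field, 'a) module" and W :: "('k, 'b) module" and U :: "('k, 'c) module"
  assumes V: "vectorspace class_ring V" and W: "vectorspace class_ring W"
    and U: "vectorspace class_ring U" and \<beta>: "\<beta> \<in> bilinear_maps V W U"
  shows "\<exists>!h. h \<in> Lin (tensor V W) U \<and> h \<in> extensional (carrier (tensor V W)) \<and>
           (\<forall>v\<in>carrier V. \<forall>w\<in>carrier W. h (pure_tensor V W v w) = \<beta> v w)"
proof (rule ex_ex1I)
  let ?B = "carrier V \<times> carrier W"
  let ?F = "free_space ?B :: ('k, _) module" and ?N = "tensor_relations V W"
  note FN = free_space_vectorspace[of ?B] tensor_relations_submodule[of V W]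
  interpret Fr: vectorspace class_ring ?F by (rule FN)
  interpret V: vectorspace class_ring V by (rule V)
  interpret W: vectorspace class_ring W by (rule W)
  interpret U: vectorspace class_ring U by (rule U)
  interpret T: vectorspace class_ring "tensor V W" by (rule tensor_vectorspace)
  have clV: "c \<odot>\<^bsub>V\<^esub> v \<in> carrier V" if "v \<in> carrier V" for c v
    using V.smult_closed that by auto
  have clW: "c \<odot>\<^bsub>W\<^esub> v \<in> carrier W" if "v \<in> carrier W" for c v
    using W.smult_closed that by auto
  have clU: "c \<odot>\<^bsub>U\<^esub> v \<in> carrier U" if "v \<in> carrier U" for c v
    using U.smult_closed that by auto
  have clF: "c \<odot>\<^bsub>?F\<^esub> free_gen ?B x \<in> carrier ?F" for c x
    by (simp add: free_gen_closed)
  have \<beta>_closed: "\<beta> v w \<in> carrier U" if "v \<in> carrier V" "w \<in> carrier W" for v w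
    using \<beta> that by (auto simp: bilinear_maps_def LinearCombinations.module_hom_def)
  have \<beta>_lin: "\<beta> (v \<oplus>\<^bsub>V\<^esub> v') w = \<beta> v w \<oplus>\<^bsub>U\<^esub> \<beta> v' w" "\<beta> v (w \<oplus>\<^bsub>W\<^esub> w') = \<beta> v w \<oplus>\<^bsub>U\<^esub> \<beta> v w'"
      "\<beta> (c \<odot>\<^bsub>V\<^esub> v) w = c \<odot>\<^bsub>U\<^esub> \<beta> v w" "\<beta> v (c \<odot>\<^bsub>W\<^esub> w) = c \<odot>\<^bsub>U\<^esub> \<beta> v w"
    if "v \<in> carrier V" "v' \<in> carrier V" "w \<in> carrier W" "w' \<in> carrier W" for v v' w w' c
    using \<beta> that by (auto simp: bilinear_maps_def LinearCombinations.module_hom_def)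
  {
    obtain f where f: "f \<in> Lin ?F U"
      and fg: "\<And>x. x \<in> ?B \<Longrightarrow> f (free_gen ?B x) = (case x of (v, w) \<Rightarrow> \<beta> v w)"
      using free_space_lift[OF U, of ?B "\<lambda>(v, w). \<beta> v w"] \<beta>_closed by (auto split: prod.splits)
    interpret f: mod_hom class_ring ?F U f
      using f Fr.module_axioms U.module_axioms by (auto simp: mod_hom_def mod_hom_axioms_def)
    have fs: "f (c \<odot>\<^bsub>?F\<^esub> free_gen ?B x) = c \<odot>\<^bsub>U\<^esub> f (free_gen ?B x)" for c x
      by (rule f.f_smult[OF _ free_gen_closed]) simp
    have r0: "a \<ominus>\<^bsub>U\<^esub> a = \<zero>\<^bsub>U\<^esub>" if "a \<in> carrier U" for a
      using that by (simp add: a_minus_def U.M.r_neg)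
    have "tensor_relators V W \<subseteq> f.ker"
      using tensor_relators_closed[of V W]
      unfolding f.ker_def tensor_relators_def Let_def
      by (auto simp: f.f_minus f.f_add free_gen_closed clF fs fg \<beta>_lin \<beta>_closed clV clW clU r0)
    then have "?N \<subseteq> f.ker"
      unfolding tensor_relations_def by (rule Fr.span_is_subset[OF _ f.ker_is_submodule])
    then have f0: "f n = \<zero>\<^bsub>U\<^esub>" if "n \<in> ?N" for n
      using that f.f_ker by blast
    obtain h where h: "h \<in> Lin (tensor V W) U" "\<And>F. F \<in> carrier ?F \<Longrightarrow> h (?N +>\<^bsub>?F\<^esub> F) = f F"
      using quotient_space_lift[OF FN U f f0] unfolding tensor_def by blast
    have cT: "c \<odot>\<^bsub>tensor V W\<^esub> t \<in> carrier (tensor V W)" if "t \<in> carrier (tensor V W)" for c t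
      using T.smult_closed that by auto
    have "restrict h (carrier (tensor V W)) \<in> Lin (tensor V W) U"
      using h(1) cT by (auto simp: LinearCombinations.module_hom_def)
    moreover have "restrict h (carrier (tensor V W)) (pure_tensor V W v w) = \<beta> v w"
      if "v \<in> carrier V" "w \<in> carrier W" for v w
      using that h(2)[OF free_gen_closed] fg
      by (simp add: pure_tensor_closed) (simp add: pure_tensor_def)
    ultimately show "\<exists>h. h \<in> Lin (tensor V W) U \<and> h \<in> extensional (carrier (tensor V W)) \<and>
           (\<forall>v\<in>carrier V. \<forall>w\<in>carrier W. h (pure_tensor V W v w) = \<beta> v w)"
      by (intro exI[of _ "restrict h (carrier (tensor V W))"]) auto
  }
  fix g h
  assume g: "g \<in> Lin (tensor V W) U \<and> g \<in> extensional (carrier (tensor V W)) \<and>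
           (\<forall>v\<in>carrier V. \<forall>w\<in>carrier W. g (pure_tensor V W v w) = \<beta> v w)"
    and h: "h \<in> Lin (tensor V W) U \<and> h \<in> extensional (carrier (tensor V W)) \<and>
           (\<forall>v\<in>carrier V. \<forall>w\<in>carrier W. h (pure_tensor V W v w) = \<beta> v w)"
  have pl: "(\<lambda>F. k (?N +>\<^bsub>?F\<^esub> F)) \<in> Lin ?F U" if "k \<in> Lin (tensor V W) U" for k
    using that quotient_space_carrier[OF FN]
    unfolding LinearCombinations.module_hom_def tensor_def
    by (auto simp flip: coset_add[OF FN] coset_smult[OF FN])
  have "g (?N +>\<^bsub>?F\<^esub> F) = h (?N +>\<^bsub>?F\<^esub> F)" if "F \<in> carrier ?F" for F
    by (rule free_space_ext[OF U pl pl _ that]) (use g h in \<open>auto simp: pure_tensor_def\<close>)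
  then have "g t = h t" if "t \<in> carrier (tensor V W)" for t
    using that by (auto simp: tensor_def quotient_space_carrier[OF FN])
  with g h show "g = h" by (auto intro: extensionalityI)
qed

text \<open>The linear map \<open>V \<otimes> W \<rightarrow> U\<close> induced by a bilinear map \<open>\<beta>\<close>; it exists
  uniquely by \<open>tensor_universal\<close>.\<close>

definition tensor_lift ::
  "('k::field, 'a) module \<Rightarrow> ('k, 'b) module \<Rightarrow> ('k, 'c) module \<Rightarrow>
    ('a \<Rightarrow> 'b \<Rightarrow> 'c) \<Rightarrow> ('a \<times> 'b \<Rightarrow> 'k) set \<Rightarrow> 'c" where
  "tensor_lift V W U \<beta> =
     (THE h. h \<in> Lin (tensor V W) U \<and> h \<in> extensional (carrier (tensor V W)) \<and>
        (\<forall>v\<in>carrier V. \<forall>w\<in>carrier W. h (pure_tensor V W v w) = \<beta> v w))"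

definition tensor_map ::
  "('k::field, 'a) module \<Rightarrow> ('k, 'b) module \<Rightarrow> ('k, 'c) module \<Rightarrow> ('k, 'd) module \<Rightarrow>
    ('a \<Rightarrow> 'c) \<Rightarrow> ('b \<Rightarrow> 'd) \<Rightarrow> ('a \<times> 'b \<Rightarrow> 'k) set \<Rightarrow> ('c \<times> 'd \<Rightarrow> 'k) set" where
  "tensor_map V W V' W' f g =
     tensor_lift V W (tensor V' W') (\<lambda>v w. pure_tensor V' W' (f v) (g w))"


section \<open>Species and \<open>E\<close>-bicomodules\<close>

text \<open>Finite sets of labels are finite sets of natural numbers.  A bijection between finite sets is
  given by a source \<open>I\<close> and a function \<open>\<sigma>\<close> injective on \<open>I\<close>, the target being
  \<open>\<sigma> ` I\<close>; only the values of \<open>\<sigma>\<close> on \<open>I\<close> matter.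

  Since \<open>E[S]\<close> is one-dimensional with basis \<open>e\<^sub>S\<close>, the space \<open>(E \<cdot> X)[I]\<close> is the
  direct sum of the \<open>X[T]\<close> over the decompositions \<open>(S, T)\<close> of \<open>I\<close>, and a left coaction
  \<open>\<lambda>(z) = \<Sum> e\<^sub>S \<otimes> z//T\<close> is recorded by its components
  \<open>lcoact X I T z = z//T\<close> for \<open>z \<in> X[I]\<close>.  In the same way a right coaction is
  \<open>\<rho>(z) = \<Sum> rcoact X I S z \<otimes> e\<^sub>T\<close>.\<close>

record ('k, 'a) bicomodule_data =
  space_on :: "nat set \<Rightarrow> ('k, 'a) module"
  transport :: "nat set \<Rightarrow> (nat \<Rightarrow> nat) \<Rightarrow> 'a \<Rightarrow> 'a"
  lcoact :: "nat set \<Rightarrow> nat set \<Rightarrow> 'a \<Rightarrow> 'a"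
  rcoact :: "nat set \<Rightarrow> nat set \<Rightarrow> 'a \<Rightarrow> 'a"

locale linear_species =
  fixes X :: "('k::field, 'a) bicomodule_data"
  assumes space: "finite I \<Longrightarrow> vectorspace class_ring (space_on X I)"
    and transport_linear: "\<lbrakk>finite I; inj_on \<sigma> I\<rbrakk> \<Longrightarrow>
      transport X I \<sigma> \<in> Lin (space_on X I) (space_on X (\<sigma> ` I))"
    and transport_cong: "\<lbrakk>finite I; inj_on \<sigma> I; \<And>i. i \<in> I \<Longrightarrow> \<sigma> i = \<tau> i; z \<in> carrier (space_on X I)\<rbrakk> \<Longrightarrow>
      transport X I \<sigma> z = transport X I \<tau> z"
    and transport_id: "\<lbrakk>finite I; z \<in> carrier (space_on X I)\<rbrakk> \<Longrightarrow> transport X I id z = z"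
    and transport_comp: "\<lbrakk>finite I; inj_on \<sigma> I; inj_on \<tau> (\<sigma> ` I); z \<in> carrier (space_on X I)\<rbrakk> \<Longrightarrow>
      transport X I (\<tau> \<circ> \<sigma>) z = transport X (\<sigma> ` I) \<tau> (transport X I \<sigma> z)"

text \<open>The axioms say, in this order and for each side: the coaction is linear, natural, counital
  (the counit of \<open>E\<close> lives on the empty set) and coassociative
  (\<open>e\<^sub>I \<mapsto> e\<^sub>S \<otimes> e\<^sub>T\<close>).  The last one,
  \<open>(\<lambda> \<cdot> id) \<rho> = (id \<cdot> \<rho>) \<lambda>\<close>, makes the two coactions compatible.\<close>

locale E_bicomodule = linear_species X for X :: "('k::field, 'a) bicomodule_data" +
  assumes lcoact_linear: "\<lbrakk>finite I; T \<subseteq> I\<rbrakk> \<Longrightarrow> lcoact X I T \<in> Lin (space_on X I) (space_on X T)"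
    and rcoact_linear: "\<lbrakk>finite I; S \<subseteq> I\<rbrakk> \<Longrightarrow> rcoact X I S \<in> Lin (space_on X I) (space_on X S)"
    and lcoact_natural: "\<lbrakk>finite I; inj_on \<sigma> I; T \<subseteq> I; z \<in> carrier (space_on X I)\<rbrakk> \<Longrightarrow>
      lcoact X (\<sigma> ` I) (\<sigma> ` T) (transport X I \<sigma> z) = transport X T \<sigma> (lcoact X I T z)"
    and rcoact_natural: "\<lbrakk>finite I; inj_on \<sigma> I; S \<subseteq> I; z \<in> carrier (space_on X I)\<rbrakk> \<Longrightarrow>
      rcoact X (\<sigma> ` I) (\<sigma> ` S) (transport X I \<sigma> z) = transport X S \<sigma> (rcoact X I S z)"
    and lcoact_counit: "\<lbrakk>finite I; z \<in> carrier (space_on X I)\<rbrakk> \<Longrightarrow> lcoact X I I z = z"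
    and rcoact_counit: "\<lbrakk>finite I; z \<in> carrier (space_on X I)\<rbrakk> \<Longrightarrow> rcoact X I I z = z"
    and lcoact_coassoc: "\<lbrakk>finite I; T \<subseteq> U; U \<subseteq> I; z \<in> carrier (space_on X I)\<rbrakk> \<Longrightarrow>
      lcoact X U T (lcoact X I U z) = lcoact X I T z"
    and rcoact_coassoc: "\<lbrakk>finite I; S \<subseteq> U; U \<subseteq> I; z \<in> carrier (space_on X I)\<rbrakk> \<Longrightarrow>
      rcoact X U S (rcoact X I U z) = rcoact X I S z"
    and coact_compatible: "\<lbrakk>finite I; R \<union> S \<union> T = I; R \<inter> S = {}; R \<inter> T = {}; S \<inter> T = {};
        z \<in> carrier (space_on X I)\<rbrakk> \<Longrightarrow>
      lcoact X (R \<union> S) S (rcoact X I (R \<union> S) z) = rcoact X (S \<union> T) S (lcoact X I (S \<union> T) z)"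

definition locally_finite :: "('k::field, 'a) bicomodule_data \<Rightarrow> bool" where
  "locally_finite X \<longleftrightarrow> (\<forall>I. finite I \<longrightarrow> vectorspace.fin_dim class_ring (space_on X I))"

definition decompositions :: "nat set \<Rightarrow> (nat set \<times> nat set) set" where
  "decompositions I = {(S, T). S \<union> T = I \<and> S \<inter> T = {}}"

text \<open>The Cauchy product with the diagonal coactions.  An element of \<open>(X \<cdot> Y)[I]\<close> is a family
  indexed by the decompositions of \<open>I\<close>.  The operations are given by the components of their
  values: a transport along \<open>\<sigma>\<close> sends the summand \<open>(S, T)\<close> to
  \<open>(\<sigma> ` S, \<sigma> ` T)\<close>, a coaction onto \<open>U\<close> sends it to
  \<open>(S \<inter> U, T \<inter> U)\<close>, so that component \<open>(S', T')\<close> of the result of the latter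
  collects all \<open>(S, T)\<close> that restrict to \<open>(S', T')\<close>.\<close>

definition cauchy_product ::
  "('k::field, 'a) bicomodule_data \<Rightarrow> ('k, 'b) bicomodule_data \<Rightarrow>
    ('k, nat set \<times> nat set \<Rightarrow> ('a \<times> 'b \<Rightarrow> 'k) set) bicomodule_data" where
  "cauchy_product X Y =
     \<lparr>space_on = (\<lambda>I. direct_sum_family (decompositions I)
        (\<lambda>(S, T). tensor (space_on X S) (space_on Y T))),
      transport = (\<lambda>I \<sigma> x. \<lambda>(S', T') \<in> decompositions (\<sigma> ` I).
        let S = I \<inter> \<sigma> -` S'; T = I \<inter> \<sigma> -` T' in
          tensor_map (space_on X S) (space_on Y T) (space_on X S') (space_on Y T')
            (transport X S \<sigma>) (transport Y T \<sigma>) (x (S, T))),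
      lcoact = (\<lambda>I U x. \<lambda>(S', T') \<in> decompositions U.
        finsum (tensor (space_on X S') (space_on Y T'))
          (\<lambda>(S, T). tensor_map (space_on X S) (space_on Y T) (space_on X S') (space_on Y T')
                     (lcoact X S S') (lcoact Y T T') (x (S, T)))
          {(S, T) \<in> decompositions I. S \<inter> U = S' \<and> T \<inter> U = T'}),
      rcoact = (\<lambda>I U x. \<lambda>(S', T') \<in> decompositions U.
        finsum (tensor (space_on X S') (space_on Y T'))
          (\<lambda>(S, T). tensor_map (space_on X S) (space_on Y T) (space_on X S') (space_on Y T')
                     (rcoact X S S') (rcoact Y T T') (x (S, T)))
          {(S, T) \<in> decompositions I. S \<inter> U = S' \<and> T \<inter> U = T'})\<rparr>"


section \<open>Cochain complexes\<close>

record ('k, 'c) cochain_data =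
  degree_space :: "nat \<Rightarrow> ('k, 'c) module"
  differential :: "nat \<Rightarrow> 'c \<Rightarrow> 'c"

locale cochain_complex =
  fixes C :: "('k::field, 'c) cochain_data"
  assumes degree_space: "vectorspace class_ring (degree_space C n)"
    and differential_linear: "differential C n \<in> Lin (degree_space C n) (degree_space C (Suc n))"
    and differential_squared: "c \<in> carrier (degree_space C n) \<Longrightarrow>
      differential C (Suc n) (differential C n c) = \<zero>\<^bsub>degree_space C (Suc (Suc n))\<^esub>"

locale cochain_map = source: cochain_complex C + target: cochain_complex D
  for C :: "('k::field, 'c) cochain_data" and D :: "('k, 'd) cochain_data" +
  fixes \<phi> :: "nat \<Rightarrow> 'c \<Rightarrow> 'd"
  assumes map_linear: "\<phi> n \<in> Lin (degree_space C n) (degree_space D n)"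
    and map_differential: "c \<in> carrier (degree_space C n) \<Longrightarrow>
      \<phi> (Suc n) (differential C n c) = differential D n (\<phi> n c)"

locale cochain_isomorphism = cochain_map +
  assumes map_bij: "bij_betw (\<phi> n) (carrier (degree_space C n)) (carrier (degree_space D n))"

text \<open>The tensor product complex, with
  \<open>d(f \<otimes> g) = df \<otimes> g + (-1)\<^sup>p f \<otimes> dg\<close> for \<open>f\<close> of degree \<open>p\<close>.  Component
  \<open>(p, q)\<close> of the differential of \<open>x\<close> receives contributions from the components
  \<open>(p - 1, q)\<close> and \<open>(p, q - 1)\<close> of \<open>x\<close>, as far as these exist.\<close>

definition tensor_complex ::
  "('k::field, 'c) cochain_data \<Rightarrow> ('k, 'd) cochain_data \<Rightarrow>
    ('k, nat \<times> nat \<Rightarrow> ('c \<times> 'd \<Rightarrow> 'k) set) cochain_data" where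
  "tensor_complex C D =
    (let T = (\<lambda>(p, q). tensor (degree_space C p) (degree_space D q)) in
     \<lparr>degree_space = (\<lambda>n. direct_sum_family {(p, q). p + q = n} T),
      differential = (\<lambda>n x. \<lambda>(p, q) \<in> {(p, q). p + q = Suc n}.
        (if p = 0 then \<zero>\<^bsub>T (p, q)\<^esub>
         else tensor_map (degree_space C (p - 1)) (degree_space D q)
                (degree_space C p) (degree_space D q)
                (differential C (p - 1)) (\<lambda>g. g) (x (p - 1, q)))
        \<oplus>\<^bsub>T (p, q)\<^esub>
        (if q = 0 then \<zero>\<^bsub>T (p, q)\<^esub>
         else (- 1) ^ p \<odot>\<^bsub>T (p, q)\<^esub>
              tensor_map (degree_space C p) (degree_space D (q - 1))
                (degree_space C p) (degree_space D q)
                (\<lambda>f. f) (differential D (q - 1)) (x (p, q - 1))))\<rparr>)"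


section \<open>The Koszul complex\<close>

text \<open>The order-preserving bijection \<open>S \<rightarrow> {1..card S}\<close>.\<close>

definition rank_in :: "nat set \<Rightarrow> nat \<Rightarrow> nat" where
  "rank_in S x = card {y \<in> S. y \<le> x}"

lemma rank_in_strict_mono: "finite S \<Longrightarrow> strict_mono_on S (rank_in S)"
  unfolding strict_mono_on_def rank_in_def
  by (intro allI impI psubset_card_mono) (auto simp: psubset_eq set_eq_iff dest: leD)

lemma rank_in_bij:
  assumes "finite S"
  shows "bij_betw (rank_in S) S {1..card S}"
proof -
  have inj: "inj_on (rank_in S) S"
    using rank_in_strict_mono[OF assms] by (rule strict_mono_on_imp_inj_on)
  have "rank_in S x \<in> {1..card S}" if "x \<in> S" for x
    using that assms card_gt_0_iff[of "{y \<in> S. y \<le> x}"]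
    by (auto simp: rank_in_def Suc_le_eq intro: card_mono)
  then have "rank_in S ` S = {1..card S}"
    by (intro card_subset_eq) (auto simp: card_image[OF inj])
  with inj show ?thesis by (simp add: bij_betw_def)
qed

text \<open>The space of \<open>S\<^sub>p\<close>-equivariant linear maps from \<open>X[p]\<close> to the sign representation.
  To make equality of maps extensional, they are undefined outside \<open>X[p]\<close>.\<close>

definition koszul_space :: "('k::field, 'a) bicomodule_data \<Rightarrow> nat \<Rightarrow> ('k, 'a \<Rightarrow> 'k) module" where
  "koszul_space X p = (ring.func_space class_ring (carrier (space_on X {1..p})))
     \<lparr>carrier := {f \<in> Lin (space_on X {1..p}) scalars \<inter> extensional (carrier (space_on X {1..p})).
        \<forall>\<sigma>. \<sigma> permutes {1..p} \<longrightarrow> (\<forall>z \<in> carrier (space_on X {1..p}).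
          f (transport X {1..p} \<sigma> z) = of_int (sign \<sigma>) * f z)}\<rparr>"

definition koszul_differential ::
  "('k::field, 'a) bicomodule_data \<Rightarrow> nat \<Rightarrow> ('a \<Rightarrow> 'k) \<Rightarrow> ('a \<Rightarrow> 'k)" where
  "koszul_differential X p f = (\<lambda>z \<in> carrier (space_on X {1..p + 1}).
     \<Sum>i = 1..p + 1. (- 1) ^ (i - 1) *
       (let J = {1..p + 1} - {i}; std = transport X J (rank_in J) in
          f (std (rcoact X {1..p + 1} J z)) - f (std (lcoact X {1..p + 1} J z))))"

definition koszul_complex ::
  "('k::field, 'a) bicomodule_data \<Rightarrow> ('k, 'a \<Rightarrow> 'k) cochain_data" where
  "koszul_complex X =
     \<lparr>degree_space = koszul_space X, differential = koszul_differential X\<rparr>"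

definition sch :: "nat set \<Rightarrow> nat set \<Rightarrow> nat" where
  "sch S T = card {(s, t). s \<in> S \<and> t \<in> T \<and> s > t}"

definition cross ::
  "('k::field, 'a) bicomodule_data \<Rightarrow> ('k, 'b) bicomodule_data \<Rightarrow> nat \<Rightarrow> nat \<Rightarrow>
    ('a \<Rightarrow> 'k) \<Rightarrow> ('b \<Rightarrow> 'k) \<Rightarrow> (nat set \<times> nat set \<Rightarrow> ('a \<times> 'b \<Rightarrow> 'k) set) \<Rightarrow> 'k" where
  "cross X Y p q f g = (\<lambda>x \<in> carrier (space_on (cauchy_product X Y) {1..p + q}).
     \<Sum>(S, T) \<in> {(S, T) \<in> decompositions {1..p + q}. card S = p \<and> card T = q}.
       tensor_lift (space_on X S) (space_on Y T) scalars
         (\<lambda>z w. (- 1) ^ sch S T * f (transport X S (rank_in S) z) * g (transport Y T (rank_in T) w))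
         (x (S, T)))"

definition kuenneth_map ::
  "('k::field, 'a) bicomodule_data \<Rightarrow> ('k, 'b) bicomodule_data \<Rightarrow> nat \<Rightarrow>
    (nat \<times> nat \<Rightarrow> (('a \<Rightarrow> 'k) \<times> ('b \<Rightarrow> 'k) \<Rightarrow> 'k) set) \<Rightarrow>
    (nat set \<times> nat set \<Rightarrow> ('a \<times> 'b \<Rightarrow> 'k) set) \<Rightarrow> 'k" where
  "kuenneth_map X Y n x =
     finsum (koszul_space (cauchy_product X Y) n)
       (\<lambda>(p, q). tensor_lift (koszul_space X p) (koszul_space Y q)
                  (koszul_space (cauchy_product X Y) n) (cross X Y p q) (x (p, q)))
       {(p, q). p + q = n}"

end

theory Submission
  imports Defs
begin

text \<open>A degree-\<open>p\<close> Koszul cochain \<open>f\<close> of \<open>X\<close> lives on \<open>X[p]\<close>, but equivariance allows it to be evaluated on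
every \<open>X[S]\<close> with \<open>S\<close> of size \<open>p\<close>, by \<open>f\<^sub>S(z) = f(\<lambda>\<^sub>S z)\<close>. The family \<open>(f\<^sub>S)\<close> transforms under an
injection \<open>\<sigma>\<close> by the parity of the number of inversions of \<open>\<sigma>\<close> on \<open>S\<close>, and every such family comes
from a unique cochain. In this form all signs of the problem are products of two elementary ones: the
inversion sign of an injection on a set, and the shuffle sign \<open>(-1)\<close> to the power \<open>sch(S,T)\<close>. The
latter is multiplicative in \<open>S\<close> and in \<open>T\<close>, and the two are tied together by
\<open>inversion_sign_Un\<close>.

A cochain of \<open>X \<cdot> Y\<close> of degree \<open>n\<close> is a functional on the direct sum of the \<open>X[S] \<otimes> Y[T]\<close>, that is, a
family of bilinear forms on \<open>X[S] \<times> Y[T]\<close>. A permutation that is increasing on \<open>S\<close> and on \<open>T\<close> moves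
\<open>(S,T)\<close> to a decomposition of \<open>{1..n}\<close> into two consecutive blocks, so equivariance leaves exactly one
bilinear form on \<open>X[p] \<times> Y[q]\<close> for each \<open>p + q = n\<close>, which is alternating in each variable; all others
differ from it by the shuffle sign (\<open>koszul_cauchy_shuffle\<close>).

The map \<open>\<times>\<close> sends \<open>t\<close> in \<open>K\<^sup>p(X) \<otimes> K\<^sup>q(Y)\<close> to the cochain whose bilinear form is the evaluation
\<open>(z,w) \<mapsto> t(z,w)\<close> (\<open>kuenneth_map_gen\<close>, \<open>kuenneth_map_block\<close>). So bijectivity is the statement that
evaluation identifies \<open>K\<^sup>p(X) \<otimes> K\<^sup>q(Y)\<close> with the bilinear forms that belong to \<open>K\<^sup>p(X)\<close> in the first and
to \<open>K\<^sup>q(Y)\<close> in the second variable. Local finiteness enters here: if \<open>X[p]\<close> is finite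
dimensional, there are finitely many points \<open>z\<^sub>i\<close> and cochains \<open>b\<^sub>i\<close> with \<open>f = \<Sum> f(z\<^sub>i) b\<^sub>i\<close> for all \<open>f\<close>
in \<open>K\<^sup>p(X)\<close>, and \<open>\<beta> \<mapsto> \<Sum> b\<^sub>i \<otimes> \<beta>(z\<^sub>i, -)\<close> is the inverse of evaluation.

For the differentials one evaluates both sides on \<open>z \<otimes> w\<close> in \<open>X[S] \<otimes> Y[T]\<close>. Removing a label \<open>i\<close> from
\<open>S \<union> T\<close> removes it from one of the two sets, and by counitality the coaction does nothing on the other
factor. The labels in \<open>S\<close> thus produce the differential of \<open>X\<close> and those in \<open>T\<close> that of \<open>Y\<close>; moving
\<open>i\<close> past all of \<open>S\<close> accounts for the sign \<open>(-1)\<^sup>p\<close> (\<open>coboundary_pairing_gen\<close>).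

Since the map is a linear bijection which commutes with the differentials, the differential of
\<open>K(X \<cdot> Y)\<close> is linear, well defined and of square zero because that of \<open>K(X) \<otimes> K(Y)\<close> is
(\<open>cochain_isomorphism_transfer\<close>).\<close>

section \<open>Linear maps, direct sums and tensor products\<close>

lemma vectorspace_closed:
  fixes V :: "('k::field, 'a) module"
  assumes "vectorspace class_ring V"
  shows "\<zero>\<^bsub>V\<^esub> \<in> carrier V"
    and "\<lbrakk>u \<in> carrier V; v \<in> carrier V\<rbrakk> \<Longrightarrow> u \<oplus>\<^bsub>V\<^esub> v \<in> carrier V"
    and "v \<in> carrier V \<Longrightarrow> c \<odot>\<^bsub>V\<^esub> v \<in> carrier V"
proof -
  interpret V: vectorspace class_ring V by (rule assms)
  show "\<zero>\<^bsub>V\<^esub> \<in> carrier V" by simp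
  show "u \<oplus>\<^bsub>V\<^esub> v \<in> carrier V" if "u \<in> carrier V" "v \<in> carrier V" using that by simp
  show "c \<odot>\<^bsub>V\<^esub> v \<in> carrier V" if "v \<in> carrier V" using that V.smult_closed by simp
qed

lemma vectorspace_abelian_monoid:
  "vectorspace class_ring (V :: ('k::field, 'a) module) \<Longrightarrow> abelian_monoid V"
  by (simp add: vectorspace_def Module.module_def abelian_group_def)

lemma LinI:
  fixes V :: "('k::field, 'a) module" and W :: "('k, 'b) module"
  assumes "\<And>v. v \<in> carrier V \<Longrightarrow> f v \<in> carrier W"
    and "\<And>u v. \<lbrakk>u \<in> carrier V; v \<in> carrier V\<rbrakk> \<Longrightarrow> f (u \<oplus>\<^bsub>V\<^esub> v) = f u \<oplus>\<^bsub>W\<^esub> f v"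
    and "\<And>c v. v \<in> carrier V \<Longrightarrow> f (c \<odot>\<^bsub>V\<^esub> v) = c \<odot>\<^bsub>W\<^esub> f v"
  shows "f \<in> Lin V W"
  using assms by (auto simp: LinearCombinations.module_hom_def)

lemma LinD:
  fixes V :: "('k::field, 'a) module" and W :: "('k, 'b) module"
  assumes "f \<in> Lin V W"
  shows Lin_closed: "v \<in> carrier V \<Longrightarrow> f v \<in> carrier W"
    and Lin_add: "\<lbrakk>u \<in> carrier V; v \<in> carrier V\<rbrakk> \<Longrightarrow> f (u \<oplus>\<^bsub>V\<^esub> v) = f u \<oplus>\<^bsub>W\<^esub> f v"
    and Lin_smult: "v \<in> carrier V \<Longrightarrow> f (c \<odot>\<^bsub>V\<^esub> v) = c \<odot>\<^bsub>W\<^esub> f v"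
  using assms by (auto simp: LinearCombinations.module_hom_def)

lemma Lin_zero:
  fixes V :: "('k::field, 'a) module" and W :: "('k, 'b) module"
  assumes "vectorspace class_ring V" "vectorspace class_ring W" "f \<in> Lin V W"
  shows "f \<zero>\<^bsub>V\<^esub> = \<zero>\<^bsub>W\<^esub>"
proof -
  interpret f: mod_hom class_ring V W f
    using assms by (auto simp: mod_hom_def mod_hom_axioms_def vectorspace_iff_module)
  show ?thesis by simp
qed

lemma Lin_id: "(\<lambda>v. v) \<in> Lin V V"
  by (rule LinI) auto

lemma Lin_comp:
  "\<lbrakk>f \<in> Lin U V; g \<in> Lin V W\<rbrakk> \<Longrightarrow> (\<lambda>u. g (f u)) \<in> Lin U W"
  by (rule LinI) (auto simp: LinD)

lemma Lin_cong:
  fixes V :: "('k::field, 'a) module"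
  assumes "vectorspace class_ring V" "\<And>v. v \<in> carrier V \<Longrightarrow> f v = g v"
  shows "f \<in> Lin V W \<longleftrightarrow> g \<in> Lin V W"
  using vectorspace_closed[OF assms(1)] assms(2)
  by (auto simp: LinearCombinations.module_hom_def Pi_def)

lemma Lin_restrict:
  fixes V :: "('k::field, 'a) module"
  assumes "vectorspace class_ring V"
  shows "restrict f (carrier V) \<in> Lin V W \<longleftrightarrow> f \<in> Lin V W"
  by (rule Lin_cong[OF assms]) simp

lemma Lin_zero_map:
  fixes W :: "('k::field, 'a) module"
  assumes "vectorspace class_ring W"
  shows "(\<lambda>v. \<zero>\<^bsub>W\<^esub>) \<in> Lin V W"
proof -
  interpret W: vectorspace class_ring W by (rule assms)
  show ?thesis by (rule LinI) (auto simp: W.smult_r_null)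
qed

lemma Lin_add_map:
  fixes W :: "('k::field, 'a) module"
  assumes "vectorspace class_ring W" "f \<in> Lin V W" "g \<in> Lin V W"
  shows "(\<lambda>v. f v \<oplus>\<^bsub>W\<^esub> g v) \<in> Lin V W"
proof -
  interpret W: vectorspace class_ring W by (rule assms)
  show ?thesis
    using assms(2,3) by (intro LinI) (auto simp: LinD W.M.a_ac W.smult_r_distr)
qed

lemma Lin_smult_map:
  fixes W :: "('k::field, 'a) module"
  assumes "vectorspace class_ring W" "f \<in> Lin V W"
  shows "(\<lambda>v. c \<odot>\<^bsub>W\<^esub> f v) \<in> Lin V W"
proof -
  interpret W: vectorspace class_ring W by (rule assms)
  show ?thesis
    using assms(2) vectorspace_closed[OF assms(1)]
    by (intro LinI) (auto simp: LinD W.smult_r_distr W.smult_assoc1[symmetric, simplified] mult.commute)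
qed

lemma Lin_finsum_map:
  fixes W :: "('k::field, 'a) module"
  assumes W: "vectorspace class_ring W" and f: "\<And>a. a \<in> A \<Longrightarrow> f a \<in> Lin V W"
  shows "(\<lambda>v. finsum W (\<lambda>a. f a v) A) \<in> Lin V W"
proof -
  interpret W: vectorspace class_ring W by (rule W)
  note [simp] = LinD[OF f]
  show ?thesis
  proof (cases "finite A")
    case True
    show ?thesis
    proof (rule LinI, goal_cases)
      case (1 v) then show ?case using f by (auto intro!: W.M.finsum_closed simp: LinD)
    next
      case (2 u v)
      have "finsum W (\<lambda>a. f a (u \<oplus>\<^bsub>V\<^esub> v)) A = finsum W (\<lambda>a. f a u \<oplus>\<^bsub>W\<^esub> f a v) A"
        using 2 f by (intro W.M.finsum_cong') (auto simp: LinD)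
      then show ?case using 2 f by (simp add: W.M.finsum_addf Pi_def LinD)
    next
      case (3 c v)
      have "finsum W (\<lambda>a. f a (c \<odot>\<^bsub>V\<^esub> v)) A = finsum W (\<lambda>a. c \<odot>\<^bsub>W\<^esub> f a v) A"
        using 3 f vectorspace_closed[OF W] by (intro W.M.finsum_cong') (auto simp: LinD)
      also have "\<dots> = c \<odot>\<^bsub>W\<^esub> finsum W (\<lambda>a. f a v) A"
        using 3 f W.finsum_smult[of c "\<lambda>a. f a v" A] by (auto simp: LinD)
      finally show ?case .
    qed
  next
    case False
    then have "finsum W (\<lambda>a. f a v) A = \<zero>\<^bsub>W\<^esub>" for v by (simp add: finsum_def finprod_def)
    then show ?thesis using Lin_zero_map[OF W] by simp
  qed
qed

lemma Lin_finsum: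
  fixes V :: "('k::field, 'a) module" and W :: "('k, 'b) module"
  assumes V: "vectorspace class_ring V" and W: "vectorspace class_ring W" and h: "h \<in> Lin V W"
    and F: "\<And>a. a \<in> A \<Longrightarrow> F a \<in> carrier V" and A: "finite A"
  shows "h (finsum V F A) = finsum W (\<lambda>a. h (F a)) A"
proof -
  interpret V: vectorspace class_ring V by (rule V)
  interpret W: vectorspace class_ring W by (rule W)
  show ?thesis using A F
    by (induction A) (auto simp: Lin_zero[OF V W h] Lin_add[OF h] Pi_def Lin_closed[OF h] V.M.finsum_closed)
qed

lemma scalars_simps [simp]:
  "carrier scalars = UNIV" "\<zero>\<^bsub>scalars\<^esub> = 0" "a \<oplus>\<^bsub>scalars\<^esub> b = a + b" "a \<odot>\<^bsub>scalars\<^esub> b = a * b"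
  by (simp_all add: scalars_def)

lemma scalars_vectorspace: "vectorspace class_ring (scalars :: ('k::field, 'k) module)"
  unfolding vectorspace_iff_module
proof (rule module_criteria, goal_cases)
  case 4 show ?case by (auto intro!: exI[of _ "- _"])
qed (auto simp: class_cring.cring_axioms algebra_simps)

lemma finsum_scalars: "finite A \<Longrightarrow> finsum scalars h A = (\<Sum>a\<in>A. h a :: 'k::field)"
proof (induction A rule: finite_induct)
  interpret S: vectorspace class_ring "scalars :: ('k, 'k) module" by (rule scalars_vectorspace)
  {
    case empty
    show ?case by simp
  next
    case (insert a A)
    then show ?case by (simp add: Pi_def)
  }
qed

lemma Lin_scalars_sum:
  assumes "\<And>a. a \<in> A \<Longrightarrow> f a \<in> Lin V scalars"
  shows "(\<lambda>v. \<Sum>a\<in>A. f a v) \<in> Lin V scalars"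
  using LinD[OF assms] by (intro LinI) (auto simp: sum.distrib sum_distrib_left)

lemma Lin_scalars_mult: "f \<in> Lin V scalars \<Longrightarrow> (\<lambda>v. c * f v) \<in> Lin V scalars"
  by (rule LinI) (auto simp: LinD algebra_simps)

lemma Lin_scalars_diff:
  "\<lbrakk>f \<in> Lin V scalars; g \<in> Lin V scalars\<rbrakk> \<Longrightarrow> (\<lambda>v. f v - g v) \<in> Lin V scalars"
  by (rule LinI) (auto simp: LinD algebra_simps)

lemma direct_sum_simps:
  "carrier (direct_sum_family J V) = (\<Pi>\<^sub>E j\<in>J. carrier (V j))"
  "\<zero>\<^bsub>direct_sum_family J V\<^esub> = (\<lambda>j\<in>J. \<zero>\<^bsub>V j\<^esub>)"
  "x \<oplus>\<^bsub>direct_sum_family J V\<^esub> y = (\<lambda>j\<in>J. x j \<oplus>\<^bsub>V j\<^esub> y j)"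
  "c \<odot>\<^bsub>direct_sum_family J V\<^esub> x = (\<lambda>j\<in>J. c \<odot>\<^bsub>V j\<^esub> x j)"
  by (simp_all add: direct_sum_family_def)

text \<open>Each axiom holds componentwise; the inverse of a family is chosen componentwise.\<close>

lemma direct_sum_vectorspace:
  fixes V :: "'i \<Rightarrow> ('k::field, 'a) module"
  assumes V: "\<And>j. j \<in> J \<Longrightarrow> vectorspace class_ring (V j)"
  shows "vectorspace class_ring (direct_sum_family J V)"
proof -
  have M: "Module.module class_ring (V j)" if "j \<in> J" for j
    using V[OF that] by (simp add: vectorspace_iff_module)
  have neg: "\<exists>w\<in>carrier (V j). v \<oplus>\<^bsub>V j\<^esub> w = \<zero>\<^bsub>V j\<^esub>" if "j \<in> J" "v \<in> carrier (V j)" for j v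
  proof -
    interpret V: vectorspace class_ring "V j" by (rule V[OF that(1)])
    show ?thesis using that by (intro bexI[of _ "\<ominus>\<^bsub>V j\<^esub> v"]) (simp_all add: V.M.r_neg)
  qed
  note cl = vectorspace_closed[OF V]
  note mm = abelian_monoid.a_comm[OF vectorspace_abelian_monoid[OF V]]
     abelian_monoid.a_lcomm[OF vectorspace_abelian_monoid[OF V]]
     abelian_monoid.a_assoc[OF vectorspace_abelian_monoid[OF V]]
     abelian_monoid.r_zero[OF vectorspace_abelian_monoid[OF V]]
     abelian_monoid.l_zero[OF vectorspace_abelian_monoid[OF V]]
     Module.module.smult_l_distr[OF M, simplified]
     Module.module.smult_r_distr[OF M, simplified]
     Module.module.smult_assoc1[OF M, simplified]
     Module.module.smult_one[OF M, simplified]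
  show ?thesis
    unfolding vectorspace_iff_module
  proof (rule module_criteria, goal_cases)
    case 4
    show ?case
    proof
      fix x assume x: "x \<in> carrier (direct_sum_family J V)"
      then have "\<forall>j\<in>J. \<exists>w. w \<in> carrier (V j) \<and> x j \<oplus>\<^bsub>V j\<^esub> w = \<zero>\<^bsub>V j\<^esub>"
        using neg by (fastforce simp: direct_sum_simps)
      then obtain y where "\<forall>j\<in>J. y j \<in> carrier (V j) \<and> x j \<oplus>\<^bsub>V j\<^esub> y j = \<zero>\<^bsub>V j\<^esub>"
        by (auto dest: bchoice)
      then show "\<exists>y\<in>carrier (direct_sum_family J V).
          x \<oplus>\<^bsub>direct_sum_family J V\<^esub> y = \<zero>\<^bsub>direct_sum_family J V\<^esub>"
        by (intro bexI[of _ "restrict y J"]) (auto simp: direct_sum_simps fun_eq_iff restrict_def)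
    qed
  qed (auto simp: direct_sum_simps fun_eq_iff class_cring.cring_axioms cl mm PiE_iff
       extensional_def)
qed

definition summand ::
  "'i set \<Rightarrow> ('i \<Rightarrow> ('k::field, 'a) module) \<Rightarrow> 'i \<Rightarrow> 'a \<Rightarrow> 'i \<Rightarrow> 'a" where
  "summand J V j v = (\<lambda>i\<in>J. if i = j then v else \<zero>\<^bsub>V i\<^esub>)"

context
  fixes J and V :: "'i \<Rightarrow> ('k::field, 'a) module"
  assumes V: "\<And>j. j \<in> J \<Longrightarrow> vectorspace class_ring (V j)"
begin

lemma summand_linear:
  assumes "j \<in> J"
  shows "summand J V j \<in> Lin (V j) (direct_sum_family J V)"
proof (rule LinI, goal_cases)
  case (2 u v)
  have "\<zero>\<^bsub>V i\<^esub> = \<zero>\<^bsub>V i\<^esub> \<oplus>\<^bsub>V i\<^esub> \<zero>\<^bsub>V i\<^esub>" if "i \<in> J" for i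
    using abelian_monoid.r_zero[OF vectorspace_abelian_monoid[OF V[OF that]]] 
      vectorspace_closed[OF V[OF that]] by simp
  then show ?case by (auto simp: direct_sum_simps summand_def fun_eq_iff)
next
  case (3 c v)
  have "\<zero>\<^bsub>V i\<^esub> = c \<odot>\<^bsub>V i\<^esub> \<zero>\<^bsub>V i\<^esub>" if "i \<in> J" for i
    using V[OF that] Module.module.smult_r_null[of class_ring "V i" c]
    by (simp add: vectorspace_iff_module)
  then show ?case by (auto simp: direct_sum_simps summand_def fun_eq_iff)
qed (auto simp: direct_sum_simps summand_def vectorspace_closed[OF V])

lemma component_linear:
  assumes "j \<in> J"
  shows "(\<lambda>x. x j) \<in> Lin (direct_sum_family J V) (V j)"
  using assms by (intro LinI) (auto simp: direct_sum_simps)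

lemma tuple_linear:
  assumes "\<And>j. j \<in> J \<Longrightarrow> f j \<in> Lin W (V j)"
  shows "(\<lambda>w. \<lambda>j\<in>J. f j w) \<in> Lin W (direct_sum_family J V)"
  using LinD[OF assms] by (intro LinI) (auto simp: direct_sum_simps fun_eq_iff)

text \<open>A linear map on a finite direct sum is determined on the summands: split off one component of the
support at a time.\<close>

lemma direct_sum_ext:
  assumes J: "finite J" and U: "vectorspace class_ring U"
    and f: "f \<in> Lin (direct_sum_family J V) U" and g: "g \<in> Lin (direct_sum_family J V) U"
    and eq: "\<And>j v. \<lbrakk>j \<in> J; v \<in> carrier (V j)\<rbrakk> \<Longrightarrow> f (summand J V j v) = g (summand J V j v)"
    and x: "x \<in> carrier (direct_sum_family J V)"
  shows "f x = g x"
proof -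
  let ?D = "direct_sum_family J V"
  note D = direct_sum_vectorspace[of J V, OF V]
  have "f y = g y" if "finite A" "A \<subseteq> J" "y \<in> carrier ?D" "\<And>j. j \<in> J - A \<Longrightarrow> y j = \<zero>\<^bsub>V j\<^esub>" for A y
    using that
  proof (induction A arbitrary: y)
    case empty
    then have "y = \<zero>\<^bsub>?D\<^esub>" by (auto simp: direct_sum_simps fun_eq_iff PiE_iff extensional_def restrict_def)
    then show ?case by (simp add: Lin_zero[OF D U f] Lin_zero[OF D U g])
  next
    case (insert j A)
    then have j: "j \<in> J" "y j \<in> carrier (V j)" by (auto simp: direct_sum_simps)
    let ?y = "restrict (y(j := \<zero>\<^bsub>V j\<^esub>)) J"
    note cl = vectorspace_closed[OF V]
    have y': "?y \<in> carrier ?D" using insert.prems j cl by (auto simp: direct_sum_simps)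
    have s: "summand J V j (y j) \<in> carrier ?D"
      using Lin_closed[OF summand_linear[OF j(1)] j(2)] .
    have "y = ?y \<oplus>\<^bsub>?D\<^esub> summand J V j (y j)"
    proof
      fix i
      show "y i = (?y \<oplus>\<^bsub>?D\<^esub> summand J V j (y j)) i"
      proof (cases "i \<in> J")
        case True
        interpret Vi: vectorspace class_ring "V i" by (rule V[OF True])
        interpret Vj: vectorspace class_ring "V j" by (rule V[OF j(1)])
        have "y i \<in> carrier (V i)" using insert.prems True by (auto simp: direct_sum_simps)
        then show ?thesis using True by (auto simp: direct_sum_simps summand_def)
      next
        case False
        then show ?thesis using insert.prems by (auto simp: direct_sum_simps intro: PiE_arb)
      qed
    qed
    moreover have "f ?y = g ?y" using insert.prems by (intro insert.IH y') auto
    ultimately show ?case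
      using Lin_add[OF f y' s] Lin_add[OF g y' s] eq[OF j] by simp
  qed
  from this[OF J subset_refl x] show ?thesis by simp
qed

end

lemma bilinear_mapsI:
  fixes V :: "('k::field, 'a) module"
  assumes "\<And>v. v \<in> carrier V \<Longrightarrow> \<beta> v \<in> Lin W U" "\<And>w. w \<in> carrier W \<Longrightarrow> (\<lambda>v. \<beta> v w) \<in> Lin V U"
  shows "\<beta> \<in> bilinear_maps V W U"
  using assms by (simp add: bilinear_maps_def)

lemma bilinear_mapsD:
  fixes V :: "('k::field, 'a) module"
  assumes "\<beta> \<in> bilinear_maps V W U"
  shows "v \<in> carrier V \<Longrightarrow> \<beta> v \<in> Lin W U" "w \<in> carrier W \<Longrightarrow> (\<lambda>v. \<beta> v w) \<in> Lin V U"
  using assms by (auto simp: bilinear_maps_def)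

lemma bilinear_maps_comp:
  assumes \<beta>: "\<beta> \<in> bilinear_maps V W U" and f: "f \<in> Lin V' V" and g: "g \<in> Lin W' W"
    and h: "h \<in> Lin U U'"
  shows "(\<lambda>v w. h (\<beta> (f v) (g w))) \<in> bilinear_maps V' W' U'"
proof (rule bilinear_mapsI)
  show "(\<lambda>w. h (\<beta> (f v) (g w))) \<in> Lin W' U'" if "v \<in> carrier V'" for v
    by (rule Lin_comp[OF g Lin_comp[OF bilinear_mapsD(1)[OF \<beta>] h]]) (rule Lin_closed[OF f that])
  show "(\<lambda>v. h (\<beta> (f v) (g w))) \<in> Lin V' U'" if "w \<in> carrier W'" for w
    by (rule Lin_comp[OF f Lin_comp[OF bilinear_mapsD(2)[OF \<beta>] h]]) (rule Lin_closed[OF g that])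
qed

context
  fixes V :: "('k::field, 'a) module" and W :: "('k, 'b) module"
  assumes V: "vectorspace class_ring V" and W: "vectorspace class_ring W"
begin

lemma tensor_lift:
  assumes U: "vectorspace class_ring U" and \<beta>: "\<beta> \<in> bilinear_maps V W U"
  shows tensor_lift_linear: "tensor_lift V W U \<beta> \<in> Lin (tensor V W) U"
    and tensor_lift_pure: "\<lbrakk>v \<in> carrier V; w \<in> carrier W\<rbrakk> \<Longrightarrow>
      tensor_lift V W U \<beta> (pure_tensor V W v w) = \<beta> v w"
  using theI'[OF tensor_universal[OF V W U \<beta>]] unfolding tensor_lift_def by auto

text \<open>The uniqueness part of the universal property, applied to the bilinear map which \<open>f\<close> induces.
All identities between maps out of tensor products below are obtained in this way.\<close>

lemma tensor_ext:
  assumes U: "vectorspace class_ring U"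
    and f: "f \<in> Lin (tensor V W) U" and g: "g \<in> Lin (tensor V W) U"
    and eq: "\<And>v w. \<lbrakk>v \<in> carrier V; w \<in> carrier W\<rbrakk> \<Longrightarrow> f (pure_tensor V W v w) = g (pure_tensor V W v w)"
    and t: "t \<in> carrier (tensor V W)"
  shows "f t = g t"
proof -
  let ?T = "carrier (tensor V W)"
  have \<beta>: "(\<lambda>v w. f (pure_tensor V W v w)) \<in> bilinear_maps V W U"
    using bilinear_maps_comp[OF pure_tensor_bilinear Lin_id Lin_id f] .
  let ?P = "\<lambda>h. h \<in> Lin (tensor V W) U \<and> h \<in> extensional ?T \<and>
    (\<forall>v\<in>carrier V. \<forall>w\<in>carrier W. h (pure_tensor V W v w) = f (pure_tensor V W v w))"
  have "?P (restrict f ?T)" "?P (restrict g ?T)"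
    using f g eq by (simp_all add: Lin_restrict[OF tensor_vectorspace] pure_tensor_closed)
  then have "restrict f ?T = restrict g ?T"
    using tensor_universal[OF V W U \<beta>] by blast
  then show ?thesis using t by (metis restrict_apply')
qed

lemma tensor_map:
  assumes f: "f \<in> Lin V V'" and g: "g \<in> Lin W W'"
  shows tensor_map_linear: "tensor_map V W V' W' f g \<in> Lin (tensor V W) (tensor V' W')"
    and tensor_map_pure: "\<lbrakk>v \<in> carrier V; w \<in> carrier W\<rbrakk> \<Longrightarrow>
      tensor_map V W V' W' f g (pure_tensor V W v w) = pure_tensor V' W' (f v) (g w)"
  using tensor_lift[OF tensor_vectorspace bilinear_maps_comp[OF pure_tensor_bilinear f g Lin_id]]
  unfolding tensor_map_def by auto

end

section \<open>Signs of injections and shuffles\<close>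

text \<open>The signs take values in an arbitrary commutative ring, so that they can be multiplied with
functionals without coercions.\<close>

definition shuffle_sign :: "nat set \<Rightarrow> nat set \<Rightarrow> 'k::comm_ring_1" where
  "shuffle_sign S T = (\<Prod>s\<in>S. \<Prod>t\<in>T. if t < s then - 1 else 1)"

definition inversion_sign :: "(nat \<Rightarrow> nat) \<Rightarrow> nat set \<Rightarrow> 'k::comm_ring_1" where
  "inversion_sign \<sigma> S = (\<Prod>a\<in>S. \<Prod>b\<in>S. if a < b \<and> \<sigma> b < \<sigma> a then - 1 else 1)"

lemma shuffle_sign_empty [simp]: "shuffle_sign {} T = 1" "shuffle_sign S {} = 1"
  by (simp_all add: shuffle_sign_def)

lemma shuffle_sign_Un:
  assumes "finite S" "finite S'" "S \<inter> S' = {}"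
  shows shuffle_sign_Un_left: "shuffle_sign (S \<union> S') T = shuffle_sign S T * shuffle_sign S' T"
    and shuffle_sign_Un_right: "shuffle_sign T (S \<union> S') = shuffle_sign T S * shuffle_sign T S'"
  using assms by (simp_all add: shuffle_sign_def prod.union_disjoint prod.distrib)

lemma sign_product_square:
  fixes f :: "'a \<Rightarrow> 'k::comm_ring_1"
  assumes "\<And>a. a \<in> A \<Longrightarrow> f a * f a = 1"
  shows "prod f A * prod f A = 1"
  using assms by (simp flip: prod.distrib)

lemma shuffle_sign_square [simp]: "shuffle_sign S T * shuffle_sign S T = 1"
  unfolding shuffle_sign_def by (intro sign_product_square) auto

lemma inversion_sign_square [simp]: "inversion_sign \<sigma> S * inversion_sign \<sigma> S = 1"
  unfolding inversion_sign_def by (intro sign_product_square) auto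

lemma shuffle_sign_cancel [simp]:
  "shuffle_sign S T * (shuffle_sign S T * x) = x"
  "inversion_sign \<sigma> S * (inversion_sign \<sigma> S * x) = x"
  by (simp_all flip: mult.assoc)

lemma minus_one_power_card:
  "finite A \<Longrightarrow> (\<Prod>a\<in>A. if P a then - 1 else 1 :: 'k::comm_ring_1) = (- 1) ^ card {a \<in> A. P a}"
  by (simp add: prod.If_cases Collect_conj_eq Int_commute)

lemma shuffle_sign_sch:
  assumes "finite S" "finite T"
  shows "shuffle_sign S T = (- 1) ^ sch S T"
proof -
  have "shuffle_sign S T = (\<Prod>x\<in>S \<times> T. if snd x < fst x then - 1 else 1)"
    by (simp add: shuffle_sign_def prod.cartesian_product case_prod_beta)
  also have "\<dots> = (- 1) ^ card {x \<in> S \<times> T. snd x < fst x}"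
    using assms by (intro minus_one_power_card) simp
  also have "{x \<in> S \<times> T. snd x < fst x} = {(s, t). s \<in> S \<and> t \<in> T \<and> s > t}" by auto
  finally show ?thesis by (simp add: sch_def)
qed

lemma shuffle_sign_singleton:
  "finite T \<Longrightarrow> shuffle_sign {i} T = (- 1) ^ card {t \<in> T. t < i}"
  by (simp add: shuffle_sign_def minus_one_power_card)

lemma shuffle_sign_swap:
  assumes "finite S" "i \<notin> S"
  shows "shuffle_sign {i} S = (- 1) ^ card S * shuffle_sign S {i}"
proof -
  have "shuffle_sign {i} S = (\<Prod>s\<in>S. - 1 * (if i < s then - 1 else 1 :: 'a))"
    unfolding shuffle_sign_def using assms by (auto intro!: prod.cong)
  also have "\<dots> = (\<Prod>s\<in>S. - 1) * (\<Prod>s\<in>S. if i < s then - 1 else 1)" by (rule prod.distrib)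
  finally show ?thesis by (simp add: shuffle_sign_def)
qed

lemma shuffle_sign_upto:
  assumes "i \<in> {1..n}"
  shows "shuffle_sign {i} ({1..n} - {i}) = (- 1) ^ (i - 1)"
proof -
  have "{t \<in> {1..n} - {i}. t < i} = {1..<i}" using assms by auto
  then show ?thesis by (simp add: shuffle_sign_singleton)
qed

lemma shuffle_sign_sorted:
  "(\<And>s t. \<lbrakk>s \<in> S; t \<in> T\<rbrakk> \<Longrightarrow> s < t) \<Longrightarrow> shuffle_sign S T = 1"
  unfolding shuffle_sign_def by (intro prod.neutral ballI) (auto dest: order.asym)

lemma inversion_sign_empty [simp]: "inversion_sign \<sigma> {} = 1"
  by (simp add: inversion_sign_def)

lemma inversion_sign_singleton [simp]: "inversion_sign \<sigma> {a} = 1"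
  by (simp add: inversion_sign_def)

lemma inversion_sign_strict_mono:
  "strict_mono_on S \<sigma> \<Longrightarrow> inversion_sign \<sigma> S = 1"
  unfolding inversion_sign_def by (intro prod.neutral ballI) (auto simp: strict_mono_on_less)

lemma inversion_sign_cong:
  "(\<And>a. a \<in> S \<Longrightarrow> \<sigma> a = \<tau> a) \<Longrightarrow> inversion_sign \<sigma> S = inversion_sign \<tau> S"
  unfolding inversion_sign_def by (intro prod.cong) auto

text \<open>The pairs inside \<open>S\<close> and inside \<open>T\<close> contribute the inversion signs. A mixed pair is inverted by \<open>\<sigma>\<close>
if and only if exactly one of the orders of the pair and of its image is the wrong one for a shuffle.\<close>

lemma inversion_sign_Un:
  assumes fin: "finite S" "finite T" and dis: "S \<inter> T = {}" and inj: "inj_on \<sigma> (S \<union> T)"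
  shows "inversion_sign \<sigma> (S \<union> T) * shuffle_sign S T =
    shuffle_sign (\<sigma> ` S) (\<sigma> ` T) * inversion_sign \<sigma> S * (inversion_sign \<sigma> T :: 'k::comm_ring_1)"
proof -
  define g :: "nat \<Rightarrow> nat \<Rightarrow> 'k" where "g a b = (if a < b \<and> \<sigma> b < \<sigma> a then - 1 else 1)" for a b
  have "inversion_sign \<sigma> (S \<union> T) * shuffle_sign S T =
     inversion_sign \<sigma> S * inversion_sign \<sigma> T *
       ((\<Prod>s\<in>S. \<Prod>t\<in>T. g s t) * (\<Prod>t\<in>T. \<Prod>s\<in>S. g t s) * shuffle_sign S T)"
    using fin dis by (simp add: inversion_sign_def g_def prod.union_disjoint prod.distrib algebra_simps)
  also have "(\<Prod>t\<in>T. \<Prod>s\<in>S. g t s) = (\<Prod>s\<in>S. \<Prod>t\<in>T. g t s)" by (rule prod.swap)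
  also have "(\<Prod>s\<in>S. \<Prod>t\<in>T. g s t) * (\<Prod>s\<in>S. \<Prod>t\<in>T. g t s) * shuffle_sign S T =
      (\<Prod>s\<in>S. \<Prod>t\<in>T. g s t * g t s * (if t < s then - 1 else 1))"
    by (simp add: shuffle_sign_def prod.distrib)
  also have "\<dots> = (\<Prod>s\<in>S. \<Prod>t\<in>T. if \<sigma> t < \<sigma> s then - 1 else 1)"
  proof (intro prod.cong refl)
    fix s t assume st: "s \<in> S" "t \<in> T"
    then have "s \<noteq> t" "\<sigma> s \<noteq> \<sigma> t" using dis inj by (auto dest: inj_onD)
    then show "g s t * g t s * (if t < s then - 1 else 1) = (if \<sigma> t < \<sigma> s then - 1 else 1)"
      unfolding g_def by (cases s t rule: linorder_cases; cases "\<sigma> s" "\<sigma> t" rule: linorder_cases) auto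
  qed
  also have "\<dots> = shuffle_sign (\<sigma> ` S) (\<sigma> ` T)"
    using inj by (simp add: shuffle_sign_def inj_on_Un prod.reindex)
  finally show ?thesis by (simp add: algebra_simps)
qed

lemma inversion_sign_insert:
  assumes "finite S" "a \<notin> S" "inj_on \<sigma> (insert a S)"
  shows "inversion_sign \<sigma> (insert a S) =
    shuffle_sign {a} S * shuffle_sign {\<sigma> a} (\<sigma> ` S) * inversion_sign \<sigma> S"
proof -
  have "inversion_sign \<sigma> (insert a S) =
      shuffle_sign {a} S * (inversion_sign \<sigma> (insert a S) * shuffle_sign {a} S :: 'a)"
    by (simp add: mult.left_commute)
  also have "inversion_sign \<sigma> (insert a S) * shuffle_sign {a} S =
      shuffle_sign {\<sigma> a} (\<sigma> ` S) * inversion_sign \<sigma> S"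
    using inversion_sign_Un[of "{a}" S \<sigma>] assms by simp
  finally show ?thesis by (simp add: mult.assoc)
qed

text \<open>Adding one point \<open>a\<close> to \<open>S\<close> changes each of the three inversion signs by a product of two shuffle signs
(\<open>inversion_sign_insert\<close>), and the factor for \<open>\<sigma> a\<close> and \<open>\<sigma> ` S\<close> occurs twice.\<close>

lemma inversion_sign_comp:
  assumes "finite S" "inj_on \<sigma> S" "inj_on \<tau> (\<sigma> ` S)"
  shows "inversion_sign (\<tau> \<circ> \<sigma>) S = inversion_sign \<tau> (\<sigma> ` S) * (inversion_sign \<sigma> S :: 'k::comm_ring_1)"
  using assms
proof (induction S)
  case (insert a S)
  have \<tau>\<sigma>: "inj_on (\<tau> \<circ> \<sigma>) (insert a S)" using insert.prems by (rule comp_inj_on)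
  have \<tau>: "inj_on \<tau> (insert (\<sigma> a) (\<sigma> ` S))" using insert.prems by simp
  have a: "\<sigma> a \<notin> \<sigma> ` S" using insert by auto
  have IH: "inversion_sign (\<tau> \<circ> \<sigma>) S = inversion_sign \<tau> (\<sigma> ` S) * (inversion_sign \<sigma> S :: 'k)"
    using insert by (intro insert.IH) (auto elim: inj_on_subset)
  have "inversion_sign (\<tau> \<circ> \<sigma>) (insert a S) = shuffle_sign {a} S *
      shuffle_sign {\<tau> (\<sigma> a)} (\<tau> ` \<sigma> ` S) * (inversion_sign \<tau> (\<sigma> ` S) * (inversion_sign \<sigma> S :: 'k))"
    by (simp only: inversion_sign_insert[OF insert.hyps \<tau>\<sigma>] IH image_comp o_apply)
  moreover have "inversion_sign \<tau> (\<sigma> ` insert a S) = shuffle_sign {\<sigma> a} (\<sigma> ` S) *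
      shuffle_sign {\<tau> (\<sigma> a)} (\<tau> ` \<sigma> ` S) * (inversion_sign \<tau> (\<sigma> ` S) :: 'k)"
    using inversion_sign_insert[OF _ a \<tau>] insert.hyps by simp
  moreover have "inversion_sign \<sigma> (insert a S) =
      shuffle_sign {a} S * shuffle_sign {\<sigma> a} (\<sigma> ` S) * (inversion_sign \<sigma> S :: 'k)"
    by (rule inversion_sign_insert[OF insert.hyps insert.prems(1)])
  ultimately show ?case by (simp add: ac_simps comp_def)
qed simp

text \<open>The transposition maps \<open>{a, b}\<close> and its complement to themselves and is increasing on the complement,
so only the pair \<open>{a, b}\<close> itself contributes.\<close>

lemma inversion_sign_transpose:
  assumes "finite S" "a \<in> S" "b \<in> S" "a \<noteq> b"
  shows "inversion_sign (transpose a b) S = (- 1 :: 'k::comm_ring_1)"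
proof -
  let ?\<tau> = "transpose a b" and ?R = "S - {a, b}"
  have S: "S = {a, b} \<union> ?R" using assms by auto
  have inj: "inj_on ?\<tau> A" for A by (rule inj_on_subset[OF inj_transpose]) simp
  have R: "?\<tau> ` ?R = ?R" by (rule image_cong[where g = "\<lambda>x. x", simplified]) (auto simp: transpose_def)
  have "inversion_sign ?\<tau> ({a, b} \<union> ?R) * shuffle_sign {a, b} ?R =
      shuffle_sign {a, b} ?R * inversion_sign ?\<tau> {a, b} * (inversion_sign ?\<tau> ?R :: 'k)"
    using inversion_sign_Un[OF _ _ _ inj, of "{a, b}" ?R] assms R
    by (simp add: insert_commute)
  then have "shuffle_sign {a, b} ?R * (shuffle_sign {a, b} ?R * inversion_sign ?\<tau> S) =
     shuffle_sign {a, b} ?R * (shuffle_sign {a, b} ?R * (inversion_sign ?\<tau> {a, b} * (inversion_sign ?\<tau> ?R :: 'k)))"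
    using S by (simp add: mult.commute mult.left_commute)
  then have "inversion_sign ?\<tau> S = inversion_sign ?\<tau> {a, b} * (inversion_sign ?\<tau> ?R :: 'k)"
    by (simp only: shuffle_sign_cancel)
  also have "inversion_sign ?\<tau> ?R = 1"
    by (rule inversion_sign_strict_mono) (auto simp: strict_mono_on_def transpose_def)
  also have "inversion_sign ?\<tau> {a, b} = - 1"
    using assms by (auto simp: inversion_sign_def transpose_def)
  finally show ?thesis by simp
qed

text \<open>Both sides are multiplicative and equal to \<open>- 1\<close> on transpositions.\<close>

lemma sign_eq_inversion_sign:
  assumes "\<sigma> permutes S" "finite S"
  shows "of_int (sign \<sigma>) = (inversion_sign \<sigma> S :: 'k::comm_ring_1)"
  using assms
proof (induction rule: permutes_induct)
  case id
  then show ?case by (simp add: inversion_sign_strict_mono strict_mono_on_def sign_id)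
next
  case (swap a b p)
  have "permutation p" using swap assms by (auto simp: permutation_permutes)
  then have "sign (transpose a b \<circ> p) = - sign p"
    using swap by (simp add: sign_compose permutation_swap_id sign_swap_id)
  moreover have "inversion_sign (transpose a b \<circ> p) S = - (inversion_sign p S :: 'k)"
    using swap assms inversion_sign_transpose[of S a b, where ?'k = 'k]
    by (subst inversion_sign_comp) (auto simp: permutes_image permutes_inj_on)
  ultimately show ?case using swap by (simp add: comp_def)
qed

section \<open>The Koszul complex of a bicomodule\<close>

text \<open>The index sets are the intervals \<open>{1..p}\<close>; their lower end is kept as the numeral \<open>1\<close>, so that
the sets stay in the form in which they occur in the definition of the Koszul complex.\<close>

declare One_nat_def [simp del]

abbreviation elems :: "('k::field, 'a) bicomodule_data \<Rightarrow> nat set \<Rightarrow> 'a set" where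
  "elems X I \<equiv> carrier (space_on X I)"

abbreviation standardize :: "('k::field, 'a) bicomodule_data \<Rightarrow> nat set \<Rightarrow> 'a \<Rightarrow> 'a" where
  "standardize X S \<equiv> transport X S (rank_in S)"

text \<open>Membership in \<open>K\<^sup>p(X)\<close> without the extensionality requirement, so that it applies to functions
given by abstraction, such as \<open>\<lambda>z. \<beta> z w\<close>.\<close>

definition koszul_form :: "('k::field, 'a) bicomodule_data \<Rightarrow> nat \<Rightarrow> ('a \<Rightarrow> 'k) \<Rightarrow> bool" where
  "koszul_form X p f \<longleftrightarrow> f \<in> Lin (space_on X {1..p}) scalars \<and>
     (\<forall>\<sigma>. \<sigma> permutes {1..p} \<longrightarrow> (\<forall>z \<in> elems X {1..p}.
        f (transport X {1..p} \<sigma> z) = of_int (sign \<sigma>) * f z))"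

text \<open>A cochain of degree \<open>p\<close> in a form that does not single out the label set \<open>{1..p}\<close>.\<close>

definition alternating_family ::
  "('k::field, 'a) bicomodule_data \<Rightarrow> nat \<Rightarrow> (nat set \<Rightarrow> 'a \<Rightarrow> 'k) \<Rightarrow> bool" where
  "alternating_family X p \<phi> \<longleftrightarrow> (\<forall>S. finite S \<and> card S = p \<longrightarrow>
     \<phi> S \<in> Lin (space_on X S) scalars \<and>
     (\<forall>\<sigma>. inj_on \<sigma> S \<longrightarrow> (\<forall>z \<in> elems X S.
        \<phi> (\<sigma> ` S) (transport X S \<sigma> z) = inversion_sign \<sigma> S * \<phi> S z)))"

text \<open>The Koszul differential on families. It needs no renumbering of labels: the sign \<open>(-1)\<^sup>i\<^sup>-\<^sup>1\<close> becomes the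
shuffle sign of \<open>{i}\<close> and its complement.\<close>

definition coboundary ::
  "('k::field, 'a) bicomodule_data \<Rightarrow> (nat set \<Rightarrow> 'a \<Rightarrow> 'k) \<Rightarrow> nat set \<Rightarrow> 'a \<Rightarrow> 'k" where
  "coboundary X \<phi> I z = (\<Sum>i\<in>I. shuffle_sign {i} (I - {i}) *
     (\<phi> (I - {i}) (rcoact X I (I - {i}) z) - \<phi> (I - {i}) (lcoact X I (I - {i}) z)))"

lemma koszul_space_carrier:
  "f \<in> carrier (koszul_space X p) \<longleftrightarrow>
     f \<in> extensional (elems X {1..p}) \<and> koszul_form X p f"
  by (auto simp: koszul_space_def koszul_form_def)

lemma koszul_space_simps:
  "\<zero>\<^bsub>koszul_space X p\<^esub> = (\<lambda>z\<in>elems X {1..p}. 0)"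
  "f \<oplus>\<^bsub>koszul_space X p\<^esub> g = (\<lambda>z\<in>elems X {1..p}. f z + g z)"
  "c \<odot>\<^bsub>koszul_space X p\<^esub> f = (\<lambda>z\<in>elems X {1..p}. c * f z)"
  by (simp_all add: koszul_space_def class_ring.func_space_def)

lemma koszul_form_cong:
  assumes "vectorspace class_ring (space_on X {1..p})"
    and "\<And>\<sigma>. \<sigma> permutes {1..p} \<Longrightarrow> transport X {1..p} \<sigma> \<in> Lin (space_on X {1..p}) (space_on X {1..p})"
    and "\<And>z. z \<in> elems X {1..p} \<Longrightarrow> f z = g z"
  shows "koszul_form X p f \<longleftrightarrow> koszul_form X p g"
  unfolding koszul_form_def using Lin_cong[OF assms(1,3)] assms(3) Lin_closed[OF assms(2)] by auto

text \<open>Only the label set \<open>{1..p}\<close> is involved. The lemma applies to the Cauchy product, for which no bicomodule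
axioms are at hand.\<close>

lemma koszul_space_vectorspace:
  fixes X :: "('k::field, 'a) bicomodule_data"
  assumes V: "vectorspace class_ring (space_on X {1..p})"
    and T: "\<And>\<sigma>. \<sigma> permutes {1..p} \<Longrightarrow>
      transport X {1..p} \<sigma> \<in> Lin (space_on X {1..p}) (space_on X {1..p})"
  shows "vectorspace class_ring (koszul_space X p)"
proof -
  let ?V = "space_on X {1..p}"
  let ?F = "ring.func_space class_ring (carrier ?V) :: ('k, 'a \<Rightarrow> 'k) module"
  interpret F: Module.module class_ring ?F by (rule class_cring.func_space_is_module)
  note cong = koszul_form_cong[OF V T]
  have 0: "koszul_form X p (\<lambda>z\<in>carrier ?V. 0)"
    by (subst cong[where g = "\<lambda>z. 0"]) (auto simp: koszul_form_def intro!: LinI)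
  have a: "koszul_form X p (\<lambda>z\<in>carrier ?V. f z + g z)"
    if "koszul_form X p f" "koszul_form X p g" for f g
    using that by (subst cong[where g = "\<lambda>z. f z + g z"])
      (auto simp: koszul_form_def LinD algebra_simps intro!: LinI)
  have s: "koszul_form X p (\<lambda>z\<in>carrier ?V. c * f z)" if "koszul_form X p f" for c f
    using that by (subst cong[where g = "\<lambda>z. c * f z"])
      (auto simp: koszul_form_def LinD algebra_simps intro!: LinI)
  have "LinearCombinations.submodule class_ring (carrier (koszul_space X p)) ?F"
    by (rule submodule.intro[OF F.module_axioms])
      (auto simp: class_ring.func_space_def koszul_space_carrier PiE_iff 0 a s
          intro: extensional_arb)
  from F.submodule_is_module[OF this] show ?thesis
    by (simp add: vectorspace_iff_module koszul_space_def)
qed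

lemma finite_card_rank_image: "finite S \<Longrightarrow> rank_in S ` S = {1..card S}"
  using rank_in_bij by (auto simp: bij_betw_def)

lemma rank_in_inj: "finite S \<Longrightarrow> inj_on (rank_in S) S"
  using rank_in_bij by (auto simp: bij_betw_def)

lemma rank_in_upto: "i \<in> {1..n} \<Longrightarrow> rank_in {1..n} i = i"
proof -
  assume "i \<in> {1..n}"
  then have "{y \<in> {1..n}. y \<le> i} = {1..i}" by auto
  then show ?thesis by (simp add: rank_in_def)
qed

lemma alternating_koszul_form:
  fixes X :: "('k::field, 'a) bicomodule_data"
  shows "alternating_family X p \<phi> \<Longrightarrow> koszul_form X p (\<phi> {1..p})"
  unfolding koszul_form_def
proof (intro conjI allI impI ballI)
  assume "alternating_family X p \<phi>"
  then have \<phi>: "\<phi> {1..p} \<in> Lin (space_on X {1..p}) scalars"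
    "\<And>\<sigma> z. \<lbrakk>inj_on \<sigma> {1..p}; z \<in> elems X {1..p}\<rbrakk> \<Longrightarrow>
      \<phi> (\<sigma> ` {1..p}) (transport X {1..p} \<sigma> z) = inversion_sign \<sigma> {1..p} * \<phi> {1..p} z"
    unfolding alternating_family_def by simp_all
  then show "\<phi> {1..p} \<in> Lin (space_on X {1..p}) scalars" by blast
  fix \<sigma> z assume "\<sigma> permutes {1..p}" "z \<in> elems X {1..p}"
  then show "\<phi> {1..p} (transport X {1..p} \<sigma> z) = of_int (sign \<sigma>) * \<phi> {1..p} z"
    using \<phi>(2)[of \<sigma> z] by (simp add: permutes_image permutes_inj_on sign_eq_inversion_sign)
qed

lemma alternating_standardize:
  fixes X :: "('k::field, 'a) bicomodule_data"
  assumes \<phi>: "alternating_family X p \<phi>" and S: "finite S" "card S = p"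
    and z: "z \<in> elems X S"
  shows "\<phi> {1..p} (standardize X S z) = \<phi> S z"
proof -
  have "\<phi> (rank_in S ` S) (standardize X S z) = inversion_sign (rank_in S) S * \<phi> S z"
    using \<phi> S z rank_in_inj[OF S(1)] unfolding alternating_family_def by blast
  then show ?thesis
    using S by (simp add: finite_card_rank_image inversion_sign_strict_mono[OF rank_in_strict_mono])
qed

lemma koszul_differential_extensional:
  "koszul_differential X p f \<in> extensional (elems X {1..Suc p})"
  unfolding koszul_differential_def Suc_eq_plus1 by (rule restrict_extensional)

lemma koszul_differential_coboundary:
  "z \<in> elems X {1..Suc p} \<Longrightarrow>
    koszul_differential X p f z = coboundary X (\<lambda>S z. f (standardize X S z)) {1..Suc p} z"
  unfolding koszul_differential_def coboundary_def Let_def Suc_eq_plus1[symmetric] restrict_apply'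
  by (rule sum.cong[OF refl]) (simp only: shuffle_sign_upto)

context linear_species
begin

lemma transport_closed:
  "\<lbrakk>finite I; inj_on \<sigma> I; z \<in> elems X I\<rbrakk> \<Longrightarrow>
    transport X I \<sigma> z \<in> elems X (\<sigma> ` I)"
  by (rule Lin_closed[OF transport_linear])

lemma transport_permutation_linear:
  "\<sigma> permutes {1..p} \<Longrightarrow> transport X {1..p} \<sigma> \<in> Lin (space_on X {1..p}) (space_on X {1..p})"
  using transport_linear[of "{1..p}" \<sigma>] by (simp add: permutes_image permutes_inj_on)

lemma standardize_linear:
  "\<lbrakk>finite S; card S = p\<rbrakk> \<Longrightarrow> standardize X S \<in> Lin (space_on X S) (space_on X {1..p})"
  using transport_linear[of S "rank_in S"] by (auto simp: rank_in_inj finite_card_rank_image)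

lemma standardize_upto:
  "z \<in> elems X {1..p} \<Longrightarrow> standardize X {1..p} z = z"
  using transport_cong[of "{1..p}" "rank_in {1..p}" id z] transport_id[of "{1..p}" z]
  by (simp add: rank_in_inj rank_in_upto)

lemma koszul_form_restrict:
  "koszul_form X p (restrict f (elems X {1..p})) \<longleftrightarrow> koszul_form X p f"
  by (rule koszul_form_cong) (auto simp: space transport_permutation_linear)

lemma koszul_vectorspace: "vectorspace class_ring (koszul_space X p)"
  by (rule koszul_space_vectorspace) (auto simp: space transport_permutation_linear)

text \<open>The injection \<open>\<sigma>\<close> from \<open>S\<close> to \<open>\<sigma> ` S\<close> corresponds under standardization to a permutation \<open>\<pi>\<close> of \<open>{1..p}\<close>.
Its sign is the inversion sign of \<open>\<sigma>\<close>, because the rank functions are increasing.\<close>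

lemma koszul_form_alternating:
  assumes f: "koszul_form X p f"
  shows "alternating_family X p (\<lambda>S z. f (standardize X S z))"
  unfolding alternating_family_def
proof (intro allI impI ballI conjI; elim conjE)
  fix S :: "nat set" assume S: "finite S" "card S = p"
  show "(\<lambda>z. f (standardize X S z)) \<in> Lin (space_on X S) scalars"
    using f by (intro Lin_comp[OF standardize_linear[OF S]]) (auto simp: koszul_form_def)
  fix \<sigma> :: "nat \<Rightarrow> nat" and z assume \<sigma>: "inj_on \<sigma> S" and z: "z \<in> elems X S"
  have S': "finite (\<sigma> ` S)" "card (\<sigma> ` S) = p" using S \<sigma> by (auto simp: card_image)
  define r where "r = inv_into S (rank_in S)"
  \<comment> \<open>The identity outside \<open>{1..p}\<close>, as required of a permutation.\<close>
  define \<pi> where "\<pi> i = (if i \<in> {1..p} then rank_in (\<sigma> ` S) (\<sigma> (r i)) else i)" for i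
  have r: "bij_betw r {1..p} S"
    unfolding r_def using rank_in_bij[OF S(1)] S(2) by (auto intro: bij_betw_inv_into)
  have r_rank: "r (rank_in S s) = s" if "s \<in> S" for s
    unfolding r_def using rank_in_inj[OF S(1)] that by simp
  have "bij_betw (\<lambda>i. rank_in (\<sigma> ` S) (\<sigma> (r i))) {1..p} {1..p}"
    using bij_betw_trans[OF bij_betw_trans[OF r, of \<sigma> "\<sigma> ` S"] rank_in_bij[OF S'(1)]] \<sigma> S'
    by (simp add: bij_betw_def comp_def)
  also have "bij_betw (\<lambda>i. rank_in (\<sigma> ` S) (\<sigma> (r i))) {1..p} {1..p} \<longleftrightarrow> bij_betw \<pi> {1..p} {1..p}"
    by (rule bij_betw_cong) (simp add: \<pi>_def)
  finally have "bij_betw \<pi> {1..p} {1..p}" .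
  then have \<pi>: "\<pi> permutes {1..p}" by (rule bij_imp_permutes) (auto simp: \<pi>_def)
  have rank_closed: "rank_in S s \<in> {1..p}" if "s \<in> S" for s
    using finite_card_rank_image[OF S(1)] S(2) that by blast
  have \<pi>_rank: "\<pi> (rank_in S s) = rank_in (\<sigma> ` S) (\<sigma> s)" if "s \<in> S" for s
    using rank_closed[OF that] r_rank[OF that] by (simp add: \<pi>_def)
  have im: "rank_in S ` S = {1..p}" using finite_card_rank_image[OF S(1)] S(2) by simp
  have inj\<pi>: "inj_on \<pi> (rank_in S ` S)" using \<pi> by (simp add: permutes_inj_on)
  have "standardize X (\<sigma> ` S) (transport X S \<sigma> z) = transport X S (rank_in (\<sigma> ` S) \<circ> \<sigma>) z"
    using transport_comp[OF S(1) \<sigma> rank_in_inj[OF S'(1)] z] by simp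
  also have "\<dots> = transport X S (\<pi> \<circ> rank_in S) z"
    using S \<sigma> S' z by (intro transport_cong comp_inj_on) (auto simp: rank_in_inj \<pi>_rank)
  also have "\<dots> = transport X {1..p} \<pi> (standardize X S z)"
    using transport_comp[OF S(1) rank_in_inj[OF S(1)] inj\<pi> z] by (simp add: im)
  finally have "f (standardize X (\<sigma> ` S) (transport X S \<sigma> z)) = inversion_sign \<pi> {1..p} * f (standardize X S z)"
    using f \<pi> Lin_closed[OF standardize_linear[OF S] z]
    by (simp add: koszul_form_def sign_eq_inversion_sign)
  also have "inversion_sign \<pi> {1..p} = (inversion_sign (\<pi> \<circ> rank_in S) S :: 'k)"
    using inversion_sign_comp[OF S(1) rank_in_inj[OF S(1)] inj\<pi>, where ?'k = 'k]
      inversion_sign_strict_mono[OF rank_in_strict_mono[OF S(1)], where ?'a = 'k]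
    by (simp add: im)
  also have "\<dots> = inversion_sign (rank_in (\<sigma> ` S) \<circ> \<sigma>) S"
    by (rule inversion_sign_cong) (simp add: \<pi>_rank)
  also have "\<dots> = inversion_sign \<sigma> S"
    using inversion_sign_comp[OF S(1) \<sigma> rank_in_inj[OF S'(1)], where ?'k = 'k]
      inversion_sign_strict_mono[OF rank_in_strict_mono[OF S'(1)], where ?'a = 'k]
    by simp
  finally show "f (standardize X (\<sigma> ` S) (transport X S \<sigma> z)) = inversion_sign \<sigma> S * f (standardize X S z)" .
qed

end

lemma antisymmetric_sum:
  fixes F :: "'i \<Rightarrow> 'i \<Rightarrow> 'b::ab_group_add"
  assumes "finite I" "\<And>i j. \<lbrakk>i \<in> I; j \<in> I; i \<noteq> j\<rbrakk> \<Longrightarrow> F i j = - F j i"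
  shows "(\<Sum>i\<in>I. \<Sum>j\<in>I - {i}. F i j) = 0"
  using assms
proof (induction I)
  case (insert a I)
  have "(\<Sum>j\<in>insert a I - {i}. F i j) = F i a + (\<Sum>j\<in>I - {i}. F i j)" if "i \<in> I" for i
  proof -
    have "insert a I - {i} = insert a (I - {i})" using that insert.hyps by auto
    then show ?thesis using that insert.hyps by simp
  qed
  then have "(\<Sum>i\<in>insert a I. \<Sum>j\<in>insert a I - {i}. F i j) =
      (\<Sum>j\<in>I. F a j) + ((\<Sum>i\<in>I. F i a) + (\<Sum>i\<in>I. \<Sum>j\<in>I - {i}. F i j))"
    using insert.hyps by (simp add: sum.distrib)
  also have "(\<Sum>i\<in>I. \<Sum>j\<in>I - {i}. F i j) = 0" by (intro insert.IH insert.prems) simp_all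
  also have "(\<Sum>j\<in>I. F a j) = - (\<Sum>i\<in>I. F i a)"
    unfolding sum_negf[symmetric]
  proof (rule sum.cong[OF refl])
    fix j assume "j \<in> I"
    then show "F a j = - F j a" using insert.hyps by (intro insert.prems) auto
  qed
  finally show ?case by simp
qed simp

context E_bicomodule
begin

text \<open>Naturality of the coactions turns the \<open>\<sigma> i\<close>-th term at \<open>\<sigma> ` S\<close> into the \<open>i\<close>-th term at \<open>S\<close>; the signs agree
by \<open>inversion_sign_insert\<close> for the point \<open>i\<close>.\<close>

lemma coboundary_alternating:
  assumes \<phi>: "alternating_family X p \<phi>"
  shows "alternating_family X (Suc p) (coboundary X \<phi>)"
  unfolding alternating_family_def
proof (intro allI impI ballI conjI; elim conjE)
  fix S :: "nat set" assume S: "finite S" "card S = Suc p"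
  have S': "finite (S - {i}) \<and> card (S - {i}) = p" if "i \<in> S" for i
    using S that by simp
  have lin: "\<phi> (S - {i}) \<in> Lin (space_on X (S - {i})) scalars" if "i \<in> S" for i
    using \<phi> S'[OF that] unfolding alternating_family_def by blast
  show "coboundary X \<phi> S \<in> Lin (space_on X S) scalars"
    unfolding coboundary_def[abs_def]
    using S by (intro Lin_scalars_sum Lin_scalars_mult Lin_scalars_diff Lin_comp[OF rcoact_linear lin]
        Lin_comp[OF lcoact_linear lin]) auto
  fix \<sigma> :: "nat \<Rightarrow> nat" and z assume \<sigma>: "inj_on \<sigma> S" and z: "z \<in> elems X S"
  have "coboundary X \<phi> (\<sigma> ` S) (transport X S \<sigma> z) = (\<Sum>i\<in>S. shuffle_sign {\<sigma> i} (\<sigma> ` S - {\<sigma> i}) *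
     (\<phi> (\<sigma> ` S - {\<sigma> i}) (rcoact X (\<sigma> ` S) (\<sigma> ` S - {\<sigma> i}) (transport X S \<sigma> z)) -
      \<phi> (\<sigma> ` S - {\<sigma> i}) (lcoact X (\<sigma> ` S) (\<sigma> ` S - {\<sigma> i}) (transport X S \<sigma> z))))"
    using \<sigma> by (simp add: coboundary_def sum.reindex)
  also have "\<dots> = (\<Sum>i\<in>S. inversion_sign \<sigma> S * (shuffle_sign {i} (S - {i}) *
     (\<phi> (S - {i}) (rcoact X S (S - {i}) z) - \<phi> (S - {i}) (lcoact X S (S - {i}) z))))"
  proof (rule sum.cong[OF refl])
    fix i assume i: "i \<in> S"
    have im: "\<sigma> ` S - {\<sigma> i} = \<sigma> ` (S - {i})" using \<sigma> i by (auto simp: inj_on_def)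
    have inj: "inj_on \<sigma> (S - {i})" using \<sigma> by (rule inj_on_subset) auto
    have nat: "\<phi> (\<sigma> ` (S - {i})) (transport X (S - {i}) \<sigma> y) = inversion_sign \<sigma> (S - {i}) * \<phi> (S - {i}) y"
      if "y \<in> elems X (S - {i})" for y
      using \<phi> S'[OF i] inj that unfolding alternating_family_def by blast
    have cl: "rcoact X S (S - {i}) z \<in> elems X (S - {i})"
      "lcoact X S (S - {i}) z \<in> elems X (S - {i})"
      using Lin_closed[OF rcoact_linear z] Lin_closed[OF lcoact_linear z] S by auto
    have ins: "insert i (S - {i}) = S" using i by auto
    have "inversion_sign \<sigma> (insert i (S - {i})) = shuffle_sign {i} (S - {i}) *
        shuffle_sign {\<sigma> i} (\<sigma> ` (S - {i})) * (inversion_sign \<sigma> (S - {i}) :: 'k)"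
      by (rule inversion_sign_insert) (simp_all add: S(1) \<sigma> ins del: insert_Diff_single)
    then have "inversion_sign \<sigma> S = shuffle_sign {i} (S - {i}) *
        shuffle_sign {\<sigma> i} (\<sigma> ` (S - {i})) * (inversion_sign \<sigma> (S - {i}) :: 'k)"
      by (simp only: ins)
    then have "inversion_sign \<sigma> S * shuffle_sign {i} (S - {i}) =
        shuffle_sign {i} (S - {i}) * shuffle_sign {i} (S - {i}) *
        (shuffle_sign {\<sigma> i} (\<sigma> ` (S - {i})) * (inversion_sign \<sigma> (S - {i}) :: 'k))"
      by (simp only: ac_simps)
    then have sgn: "shuffle_sign {\<sigma> i} (\<sigma> ` (S - {i})) * (inversion_sign \<sigma> (S - {i}) * x) =
        inversion_sign \<sigma> S * (shuffle_sign {i} (S - {i}) * x)" for x :: 'k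
      by (simp only: shuffle_sign_square mult_1 mult.assoc[symmetric])
    have coact: "rcoact X (\<sigma> ` S) (\<sigma> ` (S - {i})) (transport X S \<sigma> z) =
        transport X (S - {i}) \<sigma> (rcoact X S (S - {i}) z)"
      "lcoact X (\<sigma> ` S) (\<sigma> ` (S - {i})) (transport X S \<sigma> z) =
        transport X (S - {i}) \<sigma> (lcoact X S (S - {i}) z)"
      using S(1) \<sigma> z by (auto intro!: rcoact_natural lcoact_natural)
    show "shuffle_sign {\<sigma> i} (\<sigma> ` S - {\<sigma> i}) *
     (\<phi> (\<sigma> ` S - {\<sigma> i}) (rcoact X (\<sigma> ` S) (\<sigma> ` S - {\<sigma> i}) (transport X S \<sigma> z)) -
      \<phi> (\<sigma> ` S - {\<sigma> i}) (lcoact X (\<sigma> ` S) (\<sigma> ` S - {\<sigma> i}) (transport X S \<sigma> z))) =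
      inversion_sign \<sigma> S * (shuffle_sign {i} (S - {i}) *
     (\<phi> (S - {i}) (rcoact X S (S - {i}) z) - \<phi> (S - {i}) (lcoact X S (S - {i}) z)))"
      unfolding im coact nat[OF cl(1)] nat[OF cl(2)] right_diff_distrib[symmetric] sgn ..
  qed
  finally show "coboundary X \<phi> (\<sigma> ` S) (transport X S \<sigma> z) = inversion_sign \<sigma> S * coboundary X \<phi> S z"
    by (simp add: coboundary_def sum_distrib_left)
qed

text \<open>The double sum runs over ordered pairs of distinct labels \<open>i\<close>, \<open>j\<close>. By coassociativity and the
compatibility of the two coactions, the four terms for \<open>(i, j)\<close> and for \<open>(j, i)\<close> have the same sum \<open>M\<close>, while
the signs are opposite since \<open>shuffle_sign {i} {j} = - shuffle_sign {j} {i}\<close>.\<close>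

lemma coboundary_square:
  assumes I: "finite I" and z: "z \<in> elems X I"
  shows "coboundary X (coboundary X \<phi>) I z = 0"
proof -
  define F where "F i j = shuffle_sign {i} (I - {i}) * (shuffle_sign {j} (I - {i} - {j}) *
     (\<phi> (I - {i} - {j}) (rcoact X (I - {i}) (I - {i} - {j}) (rcoact X I (I - {i}) z)) -
      \<phi> (I - {i} - {j}) (lcoact X (I - {i}) (I - {i} - {j}) (rcoact X I (I - {i}) z))) -
     shuffle_sign {j} (I - {i} - {j}) *
     (\<phi> (I - {i} - {j}) (rcoact X (I - {i}) (I - {i} - {j}) (lcoact X I (I - {i}) z)) -
      \<phi> (I - {i} - {j}) (lcoact X (I - {i}) (I - {i} - {j}) (lcoact X I (I - {i}) z))))" for i j
  have "coboundary X (coboundary X \<phi>) I z = (\<Sum>i\<in>I. \<Sum>j\<in>I - {i}. F i j)"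
    unfolding coboundary_def[of X "coboundary X \<phi>"] unfolding coboundary_def[of X \<phi>]
    by (rule sum.cong[OF refl]) (simp only: F_def sum_distrib_left[symmetric] sum_subtractf)
  also have "\<dots> = 0"
  proof (rule antisymmetric_sum[OF I])
    fix i j assume ij: "i \<in> I" "j \<in> I" "i \<noteq> j"
    define R where "R = I - {i} - {j}"
    have R: "I - {i} = insert j R" "I - {j} = insert i R" "I - {j} - {i} = R"
      "R \<subseteq> I" "insert i R \<subseteq> I" "insert j R \<subseteq> I" "R \<subseteq> insert i R" "R \<subseteq> insert j R" "i \<notin> R" "j \<notin> R" "finite R"
      using ij I by (auto simp: R_def)
    have R': "insert j R - {j} = R" "insert i R - {i} = R" using R(9,10) by auto
    have dis: "{j} \<union> R \<union> {i} = I" "{j} \<inter> R = {}" "{j} \<inter> {i} = {}" "R \<inter> {i} = {}"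
        "{i} \<union> R \<union> {j} = I" "{i} \<inter> R = {}" "{i} \<inter> {j} = {}" "R \<inter> {j} = {}"
      using ij by (auto simp: R_def)
    have comp: "lcoact X (insert j R) R (rcoact X I (insert j R) z) = rcoact X (insert i R) R (lcoact X I (insert i R) z)"
       "lcoact X (insert i R) R (rcoact X I (insert i R) z) = rcoact X (insert j R) R (lcoact X I (insert j R) z)"
      using coact_compatible[OF I dis(1-4) z] coact_compatible[OF I dis(5-8) z] by simp_all
    have s: "shuffle_sign {i} (insert j R) = shuffle_sign {i} {j} * (shuffle_sign {i} R :: 'k)"
       "shuffle_sign {j} (insert i R) = shuffle_sign {j} {i} * (shuffle_sign {j} R :: 'k)"
      using shuffle_sign_Un_right[of "{j}" R "{i}"] shuffle_sign_Un_right[of "{i}" R "{j}"] R by simp_all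
    have s': "shuffle_sign {i} {j} = - (shuffle_sign {j} {i} :: 'k)"
      using shuffle_sign_swap[of "{j}" i] ij by simp
    have coassoc: "rcoact X (insert j R) R (rcoact X I (insert j R) z) = rcoact X I R z"
        "rcoact X (insert i R) R (rcoact X I (insert i R) z) = rcoact X I R z"
        "lcoact X (insert j R) R (lcoact X I (insert j R) z) = lcoact X I R z"
        "lcoact X (insert i R) R (lcoact X I (insert i R) z) = lcoact X I R z"
      by (rule rcoact_coassoc[OF I R(7,5) z] rcoact_coassoc[OF I R(8,6) z]
          lcoact_coassoc[OF I R(7,5) z] lcoact_coassoc[OF I R(8,6) z])+
    define M where "M = \<phi> R (rcoact X I R z) + \<phi> R (lcoact X I R z) -
      \<phi> R (rcoact X (insert i R) R (lcoact X I (insert i R) z)) -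
      \<phi> R (rcoact X (insert j R) R (lcoact X I (insert j R) z))"
    have "F i j = shuffle_sign {i} {j} * (shuffle_sign {i} R * shuffle_sign {j} R * M)"
      unfolding F_def R(1-2) R' comp coassoc s M_def by (simp only: algebra_simps)
    moreover have "F j i = shuffle_sign {j} {i} * (shuffle_sign {i} R * shuffle_sign {j} R * M)"
      unfolding F_def R(1-2) R' comp coassoc s M_def by (simp only: algebra_simps)
    ultimately show "F i j = - F j i" by (simp only: s' mult_minus_left)
  qed
  finally show ?thesis .
qed

text \<open>The differential of \<open>f\<close> as a family is the coboundary of the family of \<open>f\<close>, on all label sets and not
only on \<open>{1..p + 1}\<close>.\<close>

lemma koszul_differential_standardize:
  assumes f: "koszul_form X p f" and S: "finite S" "card S = Suc p" and z: "z \<in> elems X S"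
  shows "koszul_differential X p f (standardize X S z) = coboundary X (\<lambda>S z. f (standardize X S z)) S z"
  using alternating_standardize[OF coboundary_alternating[OF koszul_form_alternating[OF f]] S z]
    Lin_closed[OF standardize_linear[OF S] z]
  by (simp add: koszul_differential_coboundary)

lemma koszul_differential_form:
  assumes f: "koszul_form X p f"
  shows "koszul_form X (Suc p) (koszul_differential X p f)"
proof -
  have "koszul_form X (Suc p) (coboundary X (\<lambda>S z. f (standardize X S z)) {1..Suc p})"
    by (intro alternating_koszul_form coboundary_alternating koszul_form_alternating f)
  then show ?thesis
    by (subst koszul_form_cong) (auto simp: space transport_permutation_linear koszul_differential_coboundary)
qed

lemma koszul_differential_closed:
  "f \<in> carrier (koszul_space X p) \<Longrightarrow> koszul_differential X p f \<in> carrier (koszul_space X (Suc p))"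
  by (simp add: koszul_space_carrier koszul_differential_form koszul_differential_extensional)

lemma koszul_complex_cochain: "cochain_complex (koszul_complex X)"
proof (rule cochain_complex.intro)
  fix p
  show "vectorspace class_ring (degree_space (koszul_complex X) p)"
    by (simp add: koszul_complex_def koszul_vectorspace)
  have J: "finite ({1..Suc p} - {i})" "card ({1..Suc p} - {i}) = p" if "i \<in> {1..Suc p}" for i
    using that by simp_all
  have st: "standardize X ({1..Suc p} - {i}) (rcoact X {1..Suc p} ({1..Suc p} - {i}) z) \<in> elems X {1..p}"
    if "z \<in> elems X {1..Suc p}" "i \<in> {1..Suc p}" for z i
    by (rule Lin_closed[OF standardize_linear[OF J[OF that(2)]] Lin_closed[OF rcoact_linear that(1)]]) auto
  have st': "standardize X ({1..Suc p} - {i}) (lcoact X {1..Suc p} ({1..Suc p} - {i}) z) \<in> elems X {1..p}"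
    if "z \<in> elems X {1..Suc p}" "i \<in> {1..Suc p}" for z i
    by (rule Lin_closed[OF standardize_linear[OF J[OF that(2)]] Lin_closed[OF lcoact_linear that(1)]]) auto
  have "koszul_differential X p \<in> Lin (koszul_space X p) (koszul_space X (Suc p))"
  proof (rule LinI)
    fix f g c assume f: "f \<in> carrier (koszul_space X p)"
    show "koszul_differential X p f \<in> carrier (koszul_space X (Suc p))"
      using f by (rule koszul_differential_closed)
    show "koszul_differential X p (c \<odot>\<^bsub>koszul_space X p\<^esub> f) = c \<odot>\<^bsub>koszul_space X (Suc p)\<^esub> koszul_differential X p f"
      unfolding koszul_space_simps
    proof (rule extensionalityI[where A = "elems X {1..Suc p}"])
      fix z assume z: "z \<in> elems X {1..Suc p}"
      show "koszul_differential X p (\<lambda>z\<in>elems X {1..p}. c * f z) z =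
         (\<lambda>z\<in>elems X {1..Suc p}. c * koszul_differential X p f z) z"
        unfolding restrict_apply'[OF z] koszul_differential_coboundary[OF z] coboundary_def sum_distrib_left
        by (rule sum.cong) (simp_all add: st[OF z] st'[OF z] algebra_simps del: atLeastAtMost_iff)
    qed (simp_all add: koszul_differential_extensional)
    fix g assume g: "g \<in> carrier (koszul_space X p)"
    show "koszul_differential X p (f \<oplus>\<^bsub>koszul_space X p\<^esub> g) =
       koszul_differential X p f \<oplus>\<^bsub>koszul_space X (Suc p)\<^esub> koszul_differential X p g"
      unfolding koszul_space_simps
    proof (rule extensionalityI[where A = "elems X {1..Suc p}"])
      fix z assume z: "z \<in> elems X {1..Suc p}"
      show "koszul_differential X p (\<lambda>z\<in>elems X {1..p}. f z + g z) z =
         (\<lambda>z\<in>elems X {1..Suc p}. koszul_differential X p f z + koszul_differential X p g z) z"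
        unfolding restrict_apply'[OF z] koszul_differential_coboundary[OF z] coboundary_def sum.distrib[symmetric]
        by (rule sum.cong) (simp_all add: st[OF z] st'[OF z] algebra_simps del: atLeastAtMost_iff)
    qed (simp_all add: koszul_differential_extensional)
  qed
  then show "differential (koszul_complex X) p
      \<in> Lin (degree_space (koszul_complex X) p) (degree_space (koszul_complex X) (Suc p))"
    by (simp add: koszul_complex_def)
  fix f assume "f \<in> carrier (degree_space (koszul_complex X) p)"
  then have f: "koszul_form X p f" by (simp add: koszul_complex_def koszul_space_carrier)
  have "koszul_differential X (Suc p) (koszul_differential X p f) =
      (\<lambda>z\<in>elems X {1..Suc (Suc p)}. 0)"
  proof (rule extensionalityI[where A = "elems X {1..Suc (Suc p)}"])
    fix z assume z: "z \<in> elems X {1..Suc (Suc p)}"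
    let ?\<phi> = "\<lambda>S z. f (standardize X S z)"
    have "coboundary X (\<lambda>S z. koszul_differential X p f (standardize X S z)) {1..Suc (Suc p)} z =
        coboundary X (coboundary X ?\<phi>) {1..Suc (Suc p)} z"
      unfolding coboundary_def[of X _ "{1..Suc (Suc p)}"]
      using Lin_closed[OF rcoact_linear z] Lin_closed[OF lcoact_linear z]
      by (intro sum.cong refl arg_cong2[of _ _ _ _ "(*)"] arg_cong2[of _ _ _ _ "(-)"]
          koszul_differential_standardize[OF f]) auto
    then show "koszul_differential X (Suc p) (koszul_differential X p f) z =
        (\<lambda>z\<in>elems X {1..Suc (Suc p)}. 0) z"
      using z by (simp add: koszul_differential_coboundary coboundary_square)
  qed (simp_all add: koszul_differential_extensional)
  then show "differential (koszul_complex X) (Suc p) (differential (koszul_complex X) p f) =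
      \<zero>\<^bsub>degree_space (koszul_complex X) (Suc (Suc p))\<^esub>"
    by (simp add: koszul_complex_def koszul_space_simps)
qed

end

section \<open>The tensor product of two complexes\<close>

lemma pure_tensor_zero:
  fixes V :: "('k::field, 'a) module" and W :: "('k, 'b) module"
  assumes V: "vectorspace class_ring V" and W: "vectorspace class_ring W"
  shows "w \<in> carrier W \<Longrightarrow> pure_tensor V W \<zero>\<^bsub>V\<^esub> w = \<zero>\<^bsub>tensor V W\<^esub>"
    and "v \<in> carrier V \<Longrightarrow> pure_tensor V W v \<zero>\<^bsub>W\<^esub> = \<zero>\<^bsub>tensor V W\<^esub>"
  by (simp_all add: Lin_zero[OF V tensor_vectorspace bilinear_mapsD(2)[OF pure_tensor_bilinear]]
      Lin_zero[OF W tensor_vectorspace bilinear_mapsD(1)[OF pure_tensor_bilinear]])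

text \<open>Write \<open>d\<^sub>1\<close> and \<open>d\<^sub>2\<close> for \<open>d \<otimes> id\<close> and \<open>id \<otimes> d\<close>. On pure tensors one sees that both have square zero and
that they commute. In each bidegree the square of the total differential then consists of two copies of
\<open>d\<^sub>1 d\<^sub>2\<close> with opposite signs; at the boundary \<open>p = 0\<close> or \<open>q = 0\<close> both are absent.\<close>

lemma tensor_complex_cochain:
  fixes C :: "('k::field, 'c) cochain_data" and D :: "('k, 'd) cochain_data"
  assumes C: "cochain_complex C" and D: "cochain_complex D"
  shows "cochain_complex (tensor_complex C D)"
proof -
  interpret C: cochain_complex C by (rule C)
  interpret D: cochain_complex D by (rule D)
  define T where "T = (\<lambda>(p, q). tensor (degree_space C p) (degree_space D q))"
  define J :: "nat \<Rightarrow> (nat \<times> nat) set" where "J n = {(p, q). p + q = n}" for n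
  define d1 where "d1 p q = tensor_map (degree_space C p) (degree_space D q)
    (degree_space C (Suc p)) (degree_space D q) (differential C p) (\<lambda>g. g)" for p q
  define d2 where "d2 p q = tensor_map (degree_space C p) (degree_space D q)
    (degree_space C p) (degree_space D (Suc q)) (\<lambda>f. f) (differential D q)" for p q
  note C_lin = C.differential_linear and D_lin = D.differential_linear
  note vs = C.degree_space D.degree_space
  have T: "vectorspace class_ring (T j)" for j by (simp add: T_def tensor_vectorspace split: prod.split)
  have d1: "d1 p q \<in> Lin (T (p, q)) (T (Suc p, q))" for p q
    unfolding T_def d1_def by (simp add: tensor_map_linear[OF vs C_lin Lin_id])
  have d2: "d2 p q \<in> Lin (T (p, q)) (T (p, Suc q))" for p q
    unfolding T_def d2_def by (simp add: tensor_map_linear[OF vs Lin_id D_lin])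
  have d1_pure: "d1 p q (pure_tensor (degree_space C p) (degree_space D q) f g) =
      pure_tensor (degree_space C (Suc p)) (degree_space D q) (differential C p f) g"
    if "f \<in> carrier (degree_space C p)" "g \<in> carrier (degree_space D q)" for p q f g
    unfolding d1_def by (rule tensor_map_pure[OF vs C_lin Lin_id that])
  have d2_pure: "d2 p q (pure_tensor (degree_space C p) (degree_space D q) f g) =
      pure_tensor (degree_space C p) (degree_space D (Suc q)) f (differential D q g)"
    if "f \<in> carrier (degree_space C p)" "g \<in> carrier (degree_space D q)" for p q f g
    unfolding d2_def by (rule tensor_map_pure[OF vs Lin_id D_lin that])
  note cl = Lin_closed[OF C_lin] Lin_closed[OF D_lin]
  have ext: "h t = k t"
    if "h \<in> Lin (T (p, q)) U" "k \<in> Lin (T (p, q)) U" "vectorspace class_ring U" "t \<in> carrier (T (p, q))"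
      "\<And>f g. \<lbrakk>f \<in> carrier (degree_space C p); g \<in> carrier (degree_space D q)\<rbrakk> \<Longrightarrow>
         h (pure_tensor (degree_space C p) (degree_space D q) f g) =
         k (pure_tensor (degree_space C p) (degree_space D q) f g)"
    for p q and h k :: "_ \<Rightarrow> 'u" and U :: "('k, 'u) module" and t
    using that unfolding T_def by (auto intro: tensor_ext[OF vs that(3), of h _ _ k])
  have d1_d1: "d1 (Suc p) q (d1 p q t) = \<zero>\<^bsub>T (Suc (Suc p), q)\<^esub>" if "t \<in> carrier (T (p, q))" for p q t
    by (rule ext[OF Lin_comp[OF d1 d1] Lin_zero_map[OF T] T that])
      (simp add: d1_pure cl C.differential_squared pure_tensor_zero vs T_def)
  have d2_d2: "d2 p (Suc q) (d2 p q t) = \<zero>\<^bsub>T (p, Suc (Suc q))\<^esub>" if "t \<in> carrier (T (p, q))" for p q t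
    by (rule ext[OF Lin_comp[OF d2 d2] Lin_zero_map[OF T] T that])
      (simp add: d2_pure cl D.differential_squared pure_tensor_zero vs T_def)
  have d1_d2: "d1 p (Suc q) (d2 p q t) = d2 (Suc p) q (d1 p q t)" if "t \<in> carrier (T (p, q))" for p q t
    by (rule ext[OF Lin_comp[OF d2 d1] Lin_comp[OF d1 d2] T that])
      (simp add: d1_pure d2_pure cl)
  \<comment> \<open>The two contributions to component \<open>(p, q)\<close> of the differential.\<close>
  define A where "A p q x = (if p = 0 then \<zero>\<^bsub>T (p, q)\<^esub> else d1 (p - 1) q (x (p - 1, q)))" for p q x
  define B where "B p q x = (if q = 0 then \<zero>\<^bsub>T (p, q)\<^esub> else (- 1) ^ p \<odot>\<^bsub>T (p, q)\<^esub> d2 p (q - 1) (x (p, q - 1)))" for p q x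
  have deg: "degree_space (tensor_complex C D) n = direct_sum_family (J n) T" for n
    unfolding tensor_complex_def Let_def T_def J_def by simp
  have diff: "differential (tensor_complex C D) n x =
      (\<lambda>j\<in>J (Suc n). A (fst j) (snd j) x \<oplus>\<^bsub>T j\<^esub> B (fst j) (snd j) x)" for n x
    unfolding tensor_complex_def Let_def T_def J_def A_def B_def d1_def d2_def
    by (auto simp: fun_eq_iff restrict_def)
  have comp: "(\<lambda>x. x j) \<in> Lin (direct_sum_family (J n) T) (T j)" if "j \<in> J n" for j n
    by (rule component_linear[OF T that])
  have A: "A p q \<in> Lin (direct_sum_family (J n) T) (T (p, q))" if "p + q = Suc n" for n p q
  proof (cases p)
    case 0 then show ?thesis by (simp add: A_def[abs_def] Lin_zero_map[OF T])
  next
    case (Suc r)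
    then have "(r, q) \<in> J n" using that by (simp add: J_def)
    then show ?thesis using Suc Lin_comp[OF comp d1, of r q n]
      by (simp add: A_def[abs_def])
  qed
  have B: "B p q \<in> Lin (direct_sum_family (J n) T) (T (p, q))" if "p + q = Suc n" for n p q
  proof (cases q)
    case 0 then show ?thesis by (simp add: B_def[abs_def] Lin_zero_map[OF T])
  next
    case (Suc r)
    then have "(p, r) \<in> J n" using that by (simp add: J_def)
    then show ?thesis using Suc Lin_smult_map[OF T Lin_comp[OF comp d2, of p r n]]
      by (simp add: B_def[abs_def])
  qed
  show ?thesis
  proof (rule cochain_complex.intro)
    fix n
    show "vectorspace class_ring (degree_space (tensor_complex C D) n)"
      unfolding deg by (rule direct_sum_vectorspace) (rule T)
    show lin: "differential (tensor_complex C D) n \<in>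
        Lin (degree_space (tensor_complex C D) n) (degree_space (tensor_complex C D) (Suc n))"
      unfolding deg diff[abs_def]
      by (intro tuple_linear T Lin_add_map) (auto simp: J_def intro!: A[unfolded J_def] B[unfolded J_def])
    fix x assume x: "x \<in> carrier (degree_space (tensor_complex C D) n)"
    let ?y = "differential (tensor_complex C D) n x"
    have y: "?y \<in> carrier (degree_space (tensor_complex C D) (Suc n))" by (rule Lin_closed[OF lin x])
    have xT: "x (p, q) \<in> carrier (T (p, q))" if "p + q = n" for p q
      using x that by (auto simp: deg direct_sum_simps J_def)
    have y_at: "?y (p, q) = A p q x \<oplus>\<^bsub>T (p, q)\<^esub> B p q x" if "p + q = Suc n" for p q
      using that by (simp add: diff J_def)
    have "A p q ?y \<oplus>\<^bsub>T (p, q)\<^esub> B p q ?y = \<zero>\<^bsub>T (p, q)\<^esub>" if pq: "p + q = Suc (Suc n)" for p q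
    proof -
      interpret Tpq: vectorspace class_ring "T (p, q)" by (rule T)
      have A_sq: "A p q ?y = (if p = 0 \<or> q = 0 then \<zero>\<^bsub>T (p, q)\<^esub> else
          (- 1) ^ (p - 1) \<odot>\<^bsub>T (p, q)\<^esub> d2 p (q - 1) (d1 (p - 1) (q - 1) (x (p - 1, q - 1))))"
      proof (cases "p = 0")
        case False
        then obtain r where p: "p = Suc r" by (cases p) auto
        have r: "r + q = Suc n" using pq p by simp
        note T0 = Lin_zero[OF T T d1]
        have 1: "d1 r q (A r q x) = \<zero>\<^bsub>T (p, q)\<^esub>"
          using r by (cases r) (auto simp: A_def p T0 d1_d1 xT)
        have 2: "d1 r q (B r q x) = (if q = 0 then \<zero>\<^bsub>T (p, q)\<^esub> else
          (- 1) ^ r \<odot>\<^bsub>T (p, q)\<^esub> d2 p (q - 1) (d1 r (q - 1) (x (r, q - 1))))"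
          using r by (cases q) (auto simp: B_def p T0 Lin_smult[OF d1] Lin_closed[OF d2] d1_d2 xT)
        have "A p q ?y = d1 r q (?y (r, q))" by (simp add: A_def p)
        also have "\<dots> = d1 r q (A r q x) \<oplus>\<^bsub>T (p, q)\<^esub> d1 r q (B r q x)"
          unfolding y_at[OF r] p
          by (rule Lin_add[OF d1 Lin_closed[OF A[OF r] x[unfolded deg]] Lin_closed[OF B[OF r] x[unfolded deg]]])
        also have "\<dots> = d1 r q (B r q x)"
          unfolding 1 p
          by (rule Tpq.M.l_zero[unfolded p]) (rule Lin_closed[OF d1 Lin_closed[OF B[OF r] x[unfolded deg]]])
        finally show ?thesis using p 2 by simp
      qed (simp add: A_def)
      have B_sq: "B p q ?y = (if p = 0 \<or> q = 0 then \<zero>\<^bsub>T (p, q)\<^esub> else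
          (- 1) ^ p \<odot>\<^bsub>T (p, q)\<^esub> d2 p (q - 1) (d1 (p - 1) (q - 1) (x (p - 1, q - 1))))"
      proof (cases "q = 0")
        case False
        then obtain r where q: "q = Suc r" by (cases q) auto
        have r: "p + r = Suc n" using pq q by simp
        note T0 = Lin_zero[OF T T d2]
        have 1: "d2 p r (B p r x) = \<zero>\<^bsub>T (p, q)\<^esub>"
          using r Tpq.smult_r_null by (cases r) (auto simp: B_def q T0 Lin_smult[OF d2] Lin_closed[OF d2] d2_d2 xT)
        have 2: "d2 p r (A p r x) = (if p = 0 then \<zero>\<^bsub>T (p, q)\<^esub> else d2 p r (d1 (p - 1) r (x (p - 1, r))))"
          by (auto simp: A_def q T0)
        have "B p q ?y = (- 1) ^ p \<odot>\<^bsub>T (p, q)\<^esub> d2 p r (?y (p, r))" by (simp add: B_def q)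
        also have "d2 p r (?y (p, r)) = d2 p r (A p r x) \<oplus>\<^bsub>T (p, q)\<^esub> d2 p r (B p r x)"
          unfolding y_at[OF r] q
          by (rule Lin_add[OF d2 Lin_closed[OF A[OF r] x[unfolded deg]] Lin_closed[OF B[OF r] x[unfolded deg]]])
        also have "(- 1) ^ p \<odot>\<^bsub>T (p, q)\<^esub> (d2 p r (A p r x) \<oplus>\<^bsub>T (p, q)\<^esub> d2 p r (B p r x)) =
            (- 1) ^ p \<odot>\<^bsub>T (p, q)\<^esub> d2 p r (A p r x)"
          unfolding 1 q
          by (subst Tpq.M.r_zero[unfolded q]) (rule Lin_closed[OF d2 Lin_closed[OF A[OF r] x[unfolded deg]]], rule refl)
        finally have "B p q ?y = (- 1) ^ p \<odot>\<^bsub>T (p, q)\<^esub> d2 p r (A p r x)" .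
        moreover have "(- 1) ^ p \<odot>\<^bsub>T (p, q)\<^esub> \<zero>\<^bsub>T (p, q)\<^esub> = \<zero>\<^bsub>T (p, q)\<^esub>"
          by (simp add: Tpq.smult_r_null)
        ultimately show ?thesis unfolding 2 by (auto simp only: q diff_Suc_1 split: if_splits)
      qed (simp add: B_def)
      show ?thesis
      proof (cases "p = 0 \<or> q = 0")
        case False
        then obtain r s where p: "p = Suc r" and q: "q = Suc s" by (cases p; cases q) auto
        let ?u = "d2 p s (d1 r s (x (r, s)))"
        have u: "?u \<in> carrier (T (p, q))"
          using pq unfolding p q by (intro Lin_closed[OF d2] Lin_closed[OF d1] xT) simp
        have "A p q ?y = (- 1) ^ r \<odot>\<^bsub>T (p, q)\<^esub> ?u" "B p q ?y = (- 1) ^ p \<odot>\<^bsub>T (p, q)\<^esub> ?u"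
          using A_sq B_sq by (simp_all add: p q)
        then have "A p q ?y \<oplus>\<^bsub>T (p, q)\<^esub> B p q ?y = ((- 1) ^ r + (- 1) ^ p) \<odot>\<^bsub>T (p, q)\<^esub> ?u"
          using Tpq.smult_l_distr[of "(- 1) ^ r" "(- 1) ^ p" ?u] u by simp
        also have "\<dots> = \<zero>\<^bsub>T (p, q)\<^esub>"
          using Tpq.lmult_0[OF u] by (simp add: p)
        finally show ?thesis .
      qed (simp add: A_sq B_sq)
    qed
    then show "differential (tensor_complex C D) (Suc n) ?y = \<zero>\<^bsub>degree_space (tensor_complex C D) (Suc (Suc n))\<^esub>"
      unfolding diff[of "Suc n"] deg direct_sum_simps
      by (intro restrict_ext) (auto simp: J_def simp del: diff)
  qed
qed

section \<open>Tensor products of spaces of functions\<close>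

text \<open>A vector space of functions on \<open>A\<close> with operations that are pointwise on \<open>A\<close>, expressed by linearity of
the evaluations.\<close>

definition function_space :: "'a set \<Rightarrow> ('k::field, 'a \<Rightarrow> 'k) module \<Rightarrow> bool" where
  "function_space A V \<longleftrightarrow> vectorspace class_ring V \<and> carrier V \<subseteq> extensional A \<and>
     (\<forall>z\<in>A. (\<lambda>f. f z) \<in> Lin V scalars)"

lemma function_spaceD:
  assumes "function_space A V"
  shows "vectorspace class_ring V" "f \<in> carrier V \<Longrightarrow> f \<in> extensional A"
    "z \<in> A \<Longrightarrow> (\<lambda>f. f z) \<in> Lin V scalars"
  using assms by (auto simp: function_space_def)

text \<open>Each function of the space is recovered from its values at finitely many points. This is the form in
which finite dimensionality is used: it gives an explicit inverse of the evaluation map from the tensor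
product to bilinear forms.\<close>

definition dual_system :: "'a set \<Rightarrow> ('k::field, 'a \<Rightarrow> 'k) module \<Rightarrow> 'a set \<Rightarrow> ('a \<Rightarrow> 'a \<Rightarrow> 'k) \<Rightarrow> bool" where
  "dual_system A V Z b \<longleftrightarrow> finite Z \<and> Z \<subseteq> A \<and> (\<forall>z\<in>Z. b z \<in> carrier V) \<and>
     (\<forall>f\<in>carrier V. \<forall>y\<in>A. f y = (\<Sum>z\<in>Z. f z * b z y))"

text \<open>Points are added one by one. If some function does not vanish at the new point \<open>z\<close>, take \<open>e\<close> with
\<open>e z = 1\<close> and a dual system for the functions vanishing at \<open>z\<close>; the function which belongs to \<open>z\<close> is \<open>e\<close>
minus the combination \<open>\<Sum> e(x) b\<^sub>x\<close> of the previous ones. The closure hypotheses are phrased with plain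
functions, as the space changes in the induction.\<close>

lemma dual_points_exist:
  fixes S :: "('a \<Rightarrow> 'k::field) set"
  assumes "finite Z"
    and S: "\<And>f g c. \<lbrakk>f \<in> S; g \<in> S\<rbrakk> \<Longrightarrow> (\<lambda>y. f y - c * g y) \<in> S" "(\<lambda>y. 0) \<in> S"
    and det: "\<And>f y. \<lbrakk>f \<in> S; \<forall>z\<in>Z. f z = 0; y \<in> A\<rbrakk> \<Longrightarrow> f y = 0"
  shows "\<exists>Z' b. Z' \<subseteq> Z \<and> (\<forall>z\<in>Z'. b z \<in> S) \<and> (\<forall>f\<in>S. \<forall>y\<in>A. f y = (\<Sum>z\<in>Z'. f z * b z y))"
  using assms
proof (induction Z arbitrary: S)
  case empty
  then show ?case by (intro exI[of _ "{}"]) auto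
next
  case (insert z Z)
  define S' where "S' = {f \<in> S. f z = 0}"
  have "\<exists>Z' b. Z' \<subseteq> Z \<and> (\<forall>z\<in>Z'. b z \<in> S') \<and> (\<forall>f\<in>S'. \<forall>y\<in>A. f y = (\<Sum>z\<in>Z'. f z * b z y))"
    using insert.prems by (intro insert.IH) (auto simp: S'_def)
  then obtain Z' b where Z': "Z' \<subseteq> Z" and b': "\<forall>x\<in>Z'. b x \<in> S'"
    and dual': "\<forall>f\<in>S'. \<forall>y\<in>A. f y = (\<Sum>x\<in>Z'. f x * b x y)"
    by blast
  note b = bspec[OF b'] and dual = bspec[OF bspec[OF dual']]
  show ?case
  proof (cases "\<forall>f\<in>S. f z = 0")
    case True
    then have "S' = S" by (auto simp: S'_def)
    with Z' b have "Z' \<subseteq> insert z Z" "\<forall>x\<in>Z'. b x \<in> S" by auto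
    moreover have "\<forall>f\<in>S. \<forall>y\<in>A. f y = (\<Sum>x\<in>Z'. f x * b x y)"
      using dual unfolding \<open>S' = S\<close> by blast
    ultimately show ?thesis by blast
  next
    case False
    then obtain h where h: "h \<in> S" "h z \<noteq> 0" by auto
    have "(\<lambda>y. 0 - (- inverse (h z)) * h y) \<in> S" by (intro insert.prems h)
    then obtain e where e: "e \<in> S" "e z = 1" using h by auto
    have fin: "finite Z'" and z: "z \<notin> Z'" using Z' insert.hyps by (auto intro: finite_subset)
    have span: "(\<lambda>y. e y - (\<Sum>x\<in>F. c x * b x y)) \<in> S" if "finite F" "F \<subseteq> Z'" for c F
      using that
    proof (induction F)
      case empty
      then show ?case using e by simp
    next
      case (insert x F)
      then have "(\<lambda>y. (e y - (\<Sum>x\<in>F. c x * b x y)) - c x * b x y) \<in> S"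
        using b[of x] by (intro \<open>\<And>f g c. \<lbrakk>f \<in> S; g \<in> S\<rbrakk> \<Longrightarrow> (\<lambda>y. f y - c * g y) \<in> S\<close>) (auto simp: S'_def)
      then show ?case using insert.hyps by (simp add: algebra_simps)
    qed
    define b' where "b' = b(z := \<lambda>y. e y - (\<Sum>x\<in>Z'. e x * b x y))"
    have "b' x \<in> S" if "x \<in> insert z Z'" for x
      using that b[of x] span[OF fin subset_refl, of e] by (auto simp: b'_def S'_def)
    moreover have "f y = (\<Sum>x\<in>insert z Z'. f x * b' x y)" if f: "f \<in> S" and y: "y \<in> A" for f y
    proof -
      have "(\<lambda>y. f y - f z * e y) \<in> S'" using insert.prems(1) f e by (simp add: S'_def)
      from dual[OF this y] have "f y - f z * e y = (\<Sum>x\<in>Z'. (f x - f z * e x) * b x y)" .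
      moreover have "(\<Sum>x\<in>Z'. f x * b' x y) = (\<Sum>x\<in>Z'. f x * b x y)"
        using z by (intro sum.cong) (auto simp: b'_def)
      ultimately show ?thesis using fin z
        by (simp add: b'_def left_diff_distrib right_diff_distrib sum_subtractf sum_distrib_left mult.assoc)
          (simp add: algebra_simps)
    qed
    moreover have "insert z Z' \<subseteq> insert z Z" using Z' by auto
    ultimately show ?thesis by (intro exI[of _ "insert z Z'"] exI[of _ b'] conjI ballI)
  qed
qed

text \<open>For a fixed point \<open>(z, w)\<close> this is the functional \<open>f \<otimes> g \<mapsto> f(z) g(w)\<close>; as \<open>(z, w)\<close> varies, it turns a tensor
into a function of two variables.\<close>

definition tensor_eval ::
  "('k::field, 'a \<Rightarrow> 'k) module \<Rightarrow> ('k, 'b \<Rightarrow> 'k) module \<Rightarrow> 'a \<Rightarrow> 'b \<Rightarrow>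
    (('a \<Rightarrow> 'k) \<times> ('b \<Rightarrow> 'k) \<Rightarrow> 'k) set \<Rightarrow> 'k" where
  "tensor_eval V W z w = tensor_lift V W scalars (\<lambda>f g. f z * g w)"

context
  fixes A :: "'a set" and B :: "'b set"
    and V :: "('k::field, 'a \<Rightarrow> 'k) module" and W :: "('k, 'b \<Rightarrow> 'k) module"
  assumes V: "function_space A V" and W: "function_space B W"
begin

lemma evaluation_bilinear:
  assumes "z \<in> A" "w \<in> B"
  shows "(\<lambda>f g. f z * g w) \<in> bilinear_maps V W scalars"
  using Lin_scalars_mult[OF function_spaceD(3)[OF W assms(2)]]
    Lin_scalars_mult[OF function_spaceD(3)[OF V assms(1)]]
  by (intro bilinear_mapsI) (auto simp: mult.commute)

lemmas function_vectorspaces = function_spaceD(1)[OF V] function_spaceD(1)[OF W]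

lemma tensor_eval:
  assumes "z \<in> A" "w \<in> B"
  shows tensor_eval_linear: "tensor_eval V W z w \<in> Lin (tensor V W) scalars"
    and tensor_eval_pure: "\<lbrakk>f \<in> carrier V; g \<in> carrier W\<rbrakk> \<Longrightarrow>
      tensor_eval V W z w (pure_tensor V W f g) = f z * g w"
  unfolding tensor_eval_def
  by (rule tensor_lift[OF function_vectorspaces scalars_vectorspace evaluation_bilinear[OF assms]]; assumption)+

text \<open>Every tensor satisfies \<open>u = \<Sum> b\<^sub>z \<otimes> e\<^sub>z(u)\<close>, where \<open>e\<^sub>z\<close> is evaluation at \<open>z\<close> in the first factor: on
\<open>f \<otimes> g\<close> this is the expansion of \<open>f\<close> in the dual system. The functions \<open>e\<^sub>z(u)\<close> only depend on the values
of \<open>u\<close>.\<close>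

lemma tensor_eval_inj_left:
  assumes dual: "dual_system A V Z b" and t: "t \<in> carrier (tensor V W)" "t' \<in> carrier (tensor V W)"
    and eq: "\<And>z w. \<lbrakk>z \<in> A; w \<in> B\<rbrakk> \<Longrightarrow> tensor_eval V W z w t = tensor_eval V W z w t'"
  shows "t = t'"
proof -
  let ?T = "tensor V W"
  note vs = function_vectorspaces
  interpret V: vectorspace class_ring V by (rule vs)
  interpret W: vectorspace class_ring W by (rule vs)
  interpret T: vectorspace class_ring ?T by (rule tensor_vectorspace)
  define e where "e z = tensor_lift V W W (\<lambda>f g. f z \<odot>\<^bsub>W\<^esub> g)" for z
  have "(\<lambda>f g. f z \<odot>\<^bsub>W\<^esub> g) \<in> bilinear_maps V W W" if z: "z \<in> A" for z
  proof (rule bilinear_mapsI)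
    show "(\<lambda>g. f z \<odot>\<^bsub>W\<^esub> g) \<in> Lin W W" for f by (rule Lin_smult_map[OF vs(2) Lin_id])
    show "(\<lambda>f. f z \<odot>\<^bsub>W\<^esub> g) \<in> Lin V W" if "g \<in> carrier W" for g
      using that LinD[OF function_spaceD(3)[OF V z]] vectorspace_closed[OF vs(2)]
      by (intro LinI) (simp_all add: W.smult_l_distr[simplified] W.smult_assoc1[simplified])
  qed
  note e = tensor_lift[OF vs vs(2) this, folded e_def]
  have e_at: "e z u w = tensor_eval V W z w u" if "z \<in> A" "w \<in> B" "u \<in> carrier ?T" for z w u
  proof (rule tensor_ext[OF vs scalars_vectorspace _ tensor_eval_linear[OF that(1,2)] _ that(3)])
    show "(\<lambda>u. e z u w) \<in> Lin ?T scalars"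
      by (rule Lin_comp[OF e(1)[OF that(1)] function_spaceD(3)[OF W that(2)]])
    show "e z (pure_tensor V W f g) w = tensor_eval V W z w (pure_tensor V W f g)"
      if "f \<in> carrier V" "g \<in> carrier W" for f g
      using that \<open>z \<in> A\<close> \<open>w \<in> B\<close> LinD[OF function_spaceD(3)[OF W \<open>w \<in> B\<close>]]
      by (simp add: e(2) tensor_eval_pure)
  qed
  have Z: "finite Z" "Z \<subseteq> A" and b: "\<And>z. z \<in> Z \<Longrightarrow> b z \<in> carrier V"
    and rec: "\<And>f y. \<lbrakk>f \<in> carrier V; y \<in> A\<rbrakk> \<Longrightarrow> f y = (\<Sum>z\<in>Z. f z * b z y)"
    using dual unfolding dual_system_def by blast+
  have expand: "finsum V (\<lambda>z. f z \<odot>\<^bsub>V\<^esub> b z) Z = f" if f: "f \<in> carrier V" for f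
  proof (rule extensionalityI)
    have cl: "\<And>z. z \<in> Z \<Longrightarrow> f z \<odot>\<^bsub>V\<^esub> b z \<in> carrier V" using b vectorspace_closed[OF vs(1)] by simp
    then have "finsum V (\<lambda>z. f z \<odot>\<^bsub>V\<^esub> b z) Z \<in> carrier V" by (intro V.M.finsum_closed) auto
    then show "finsum V (\<lambda>z. f z \<odot>\<^bsub>V\<^esub> b z) Z \<in> extensional A" "f \<in> extensional A"
      using f function_spaceD(2)[OF V] by auto
    fix y assume y: "y \<in> A"
    have "finsum V (\<lambda>z. f z \<odot>\<^bsub>V\<^esub> b z) Z y = finsum scalars (\<lambda>z. (f z \<odot>\<^bsub>V\<^esub> b z) y) Z"
      by (rule Lin_finsum[OF vs(1) scalars_vectorspace function_spaceD(3)[OF V y] cl Z(1)])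
    also have "\<dots> = (\<Sum>z\<in>Z. f z * b z y)"
      unfolding finsum_scalars[OF Z(1)] using b Lin_smult[OF function_spaceD(3)[OF V y]] by (intro sum.cong) auto
    finally show "finsum V (\<lambda>z. f z \<odot>\<^bsub>V\<^esub> b z) Z y = f y" using rec[OF f y] by simp
  qed
  have rebuild: "finsum ?T (\<lambda>z. pure_tensor V W (b z) (e z u)) Z = u" if u: "u \<in> carrier ?T" for u
  proof (rule tensor_ext[OF vs tensor_vectorspace _ Lin_id _ u])
    show "(\<lambda>u. finsum ?T (\<lambda>z. pure_tensor V W (b z) (e z u)) Z) \<in> Lin ?T ?T"
    proof (rule Lin_finsum_map[OF tensor_vectorspace])
      fix z assume "z \<in> Z"
      then show "(\<lambda>u. pure_tensor V W (b z) (e z u)) \<in> Lin ?T ?T"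
        using Z b by (intro Lin_comp[OF e(1) bilinear_mapsD(1)[OF pure_tensor_bilinear]]) auto
    qed
    fix f g assume f: "f \<in> carrier V" and g: "g \<in> carrier W"
    note lin = bilinear_mapsD(2)[OF pure_tensor_bilinear g, of V]
    have "finsum ?T (\<lambda>z. pure_tensor V W (b z) (e z (pure_tensor V W f g))) Z =
        finsum ?T (\<lambda>z. pure_tensor V W (f z \<odot>\<^bsub>V\<^esub> b z) g) Z"
      using Z b f g vectorspace_closed[OF vs(1)]
      by (intro T.M.finsum_cong') (auto simp: e(2) pure_tensor_linear pure_tensor_closed subset_iff)
    also have "\<dots> = pure_tensor V W (finsum V (\<lambda>z. f z \<odot>\<^bsub>V\<^esub> b z) Z) g"
      using b vectorspace_closed[OF vs(1)]
      by (intro Lin_finsum[OF vs(1) tensor_vectorspace lin _ Z(1), symmetric]) auto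
    finally show "finsum ?T (\<lambda>z. pure_tensor V W (b z) (e z (pure_tensor V W f g))) Z = pure_tensor V W f g"
      by (simp only: expand[OF f])
  qed
  have "e z t = e z t'" if "z \<in> Z" for z
  proof (rule extensionalityI)
    show "e z t \<in> extensional B" "e z t' \<in> extensional B"
      using Lin_closed[OF e(1)] t that Z function_spaceD(2)[OF W] by blast+
    show "e z t w = e z t' w" if "w \<in> B" for w
      using e_at eq t Z that \<open>z \<in> Z\<close> by auto
  qed
  then have "finsum ?T (\<lambda>z. pure_tensor V W (b z) (e z t)) Z = finsum ?T (\<lambda>z. pure_tensor V W (b z) (e z t')) Z"
    by (intro T.M.finsum_cong') (auto simp: pure_tensor_closed)
  then show ?thesis using rebuild t by simp
qed

text \<open>The preimage of \<open>\<beta>\<close> is \<open>\<Sum> b\<^sub>z \<otimes> \<beta>(z, -)\<close>; its value at \<open>(y, w)\<close> is the expansion of \<open>\<beta>(-, w)\<close> at \<open>y\<close>.\<close>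

lemma tensor_eval_surj_left:
  assumes dual: "dual_system A V Z b"
    and \<beta>: "\<And>z. z \<in> A \<Longrightarrow> restrict (\<beta> z) B \<in> carrier W"
      "\<And>w. w \<in> B \<Longrightarrow> (\<lambda>z\<in>A. \<beta> z w) \<in> carrier V"
  shows "\<exists>t\<in>carrier (tensor V W). \<forall>z\<in>A. \<forall>w\<in>B. tensor_eval V W z w t = \<beta> z w"
proof (intro bexI ballI)
  let ?T = "tensor V W" and ?t = "finsum (tensor V W) (\<lambda>z. pure_tensor V W (b z) (restrict (\<beta> z) B)) Z"
  note vs = function_vectorspaces
  interpret T: vectorspace class_ring ?T by (rule tensor_vectorspace)
  have Z: "finite Z" "Z \<subseteq> A" and b: "\<And>z. z \<in> Z \<Longrightarrow> b z \<in> carrier V"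
    and rec: "\<And>f y. \<lbrakk>f \<in> carrier V; y \<in> A\<rbrakk> \<Longrightarrow> f y = (\<Sum>z\<in>Z. f z * b z y)"
    using dual unfolding dual_system_def by blast+
  show "?t \<in> carrier ?T" by (intro T.M.finsum_closed) (auto simp: pure_tensor_closed)
  fix z w assume zw: "z \<in> A" "w \<in> B"
  have "tensor_eval V W z w ?t = (\<Sum>x\<in>Z. tensor_eval V W z w (pure_tensor V W (b x) (restrict (\<beta> x) B)))"
    using Lin_finsum[OF tensor_vectorspace scalars_vectorspace tensor_eval_linear[OF zw] pure_tensor_closed Z(1)]
    by (simp add: finsum_scalars[OF Z(1)])
  also have "\<dots> = (\<Sum>x\<in>Z. \<beta> x w * b x z)"
    using Z b \<beta>(1) zw by (intro sum.cong) (auto simp: tensor_eval_pure subset_iff mult.commute)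
  also have "\<dots> = \<beta> z w"
    using rec[OF \<beta>(2)[OF zw(2)] zw(1)] Z zw by (simp add: subset_iff)
  finally show "tensor_eval V W z w ?t = \<beta> z w" .
qed

end

text \<open>Carries the statements for a dual system in the first factor over to the second factor.\<close>

definition tensor_swap :: "('k::field, 'a) module \<Rightarrow> ('k, 'b) module \<Rightarrow> ('a \<times> 'b \<Rightarrow> 'k) set \<Rightarrow> ('b \<times> 'a \<Rightarrow> 'k) set" where
  "tensor_swap V W = tensor_lift V W (tensor W V) (\<lambda>v w. pure_tensor W V w v)"

lemma tensor_swap:
  fixes V :: "('k::field, 'a) module" and W :: "('k, 'b) module"
  assumes V: "vectorspace class_ring V" and W: "vectorspace class_ring W"
  shows tensor_swap_linear: "tensor_swap V W \<in> Lin (tensor V W) (tensor W V)"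
    and tensor_swap_pure: "\<lbrakk>v \<in> carrier V; w \<in> carrier W\<rbrakk> \<Longrightarrow>
      tensor_swap V W (pure_tensor V W v w) = pure_tensor W V w v"
proof -
  have "(\<lambda>v w. pure_tensor W V w v) \<in> bilinear_maps V W (tensor W V)"
    by (rule bilinear_mapsI[OF bilinear_mapsD(2)[OF pure_tensor_bilinear]
          bilinear_mapsD(1)[OF pure_tensor_bilinear]])
  note * = tensor_lift[OF V W tensor_vectorspace this, folded tensor_swap_def]
  show "tensor_swap V W \<in> Lin (tensor V W) (tensor W V)" by (rule *)
  show "\<lbrakk>v \<in> carrier V; w \<in> carrier W\<rbrakk> \<Longrightarrow>
      tensor_swap V W (pure_tensor V W v w) = pure_tensor W V w v" by (rule *)
qed

lemma tensor_swap_swap: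
  fixes V :: "('k::field, 'a) module" and W :: "('k, 'b) module"
  assumes V: "vectorspace class_ring V" and W: "vectorspace class_ring W" and t: "t \<in> carrier (tensor V W)"
  shows "tensor_swap W V (tensor_swap V W t) = t"
  by (rule tensor_ext[OF V W tensor_vectorspace Lin_comp[OF tensor_swap_linear[OF V W] tensor_swap_linear[OF W V]] Lin_id _ t])
    (simp add: tensor_swap_pure V W)

lemma tensor_eval_swap:
  assumes V: "function_space A V" and W: "function_space B W" and zw: "z \<in> A" "w \<in> B"
    and t: "t \<in> carrier (tensor V W)"
  shows "tensor_eval W V w z (tensor_swap V W t) = tensor_eval V W z w t"
proof -
  note vs = function_spaceD(1)[OF V] function_spaceD(1)[OF W]
  show ?thesis
    by (rule tensor_ext[OF vs scalars_vectorspace Lin_comp[OF tensor_swap_linear[OF vs]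
          tensor_eval_linear[OF W V zw(2,1)]] tensor_eval_linear[OF V W zw] _ t])
      (simp add: tensor_swap_pure vs tensor_eval_pure[OF V W zw] tensor_eval_pure[OF W V zw(2,1)])
qed

lemma tensor_eval_inj:
  assumes V: "function_space A V" and W: "function_space B W"
    and dual: "(\<exists>Z b. dual_system A V Z b) \<or> (\<exists>Z b. dual_system B W Z b)"
    and t: "t \<in> carrier (tensor V W)" "t' \<in> carrier (tensor V W)"
    and eq: "\<And>z w. \<lbrakk>z \<in> A; w \<in> B\<rbrakk> \<Longrightarrow> tensor_eval V W z w t = tensor_eval V W z w t'"
  shows "t = t'"
  using dual
proof
  assume "\<exists>Z b. dual_system A V Z b"
  then obtain Z b where "dual_system A V Z b" by blast
  then show ?thesis by (rule tensor_eval_inj_left[OF V W _ t]) (rule eq)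
next
  assume "\<exists>Z b. dual_system B W Z b"
  then obtain Z b where b: "dual_system B W Z b" by blast
  note vs = function_spaceD(1)[OF V] function_spaceD(1)[OF W]
  note cl = Lin_closed[OF tensor_swap_linear[OF vs]]
  have "tensor_swap V W t = tensor_swap V W t'"
  proof (rule tensor_eval_inj_left[OF W V b cl[OF t(1)] cl[OF t(2)]])
    fix w z assume wz: "w \<in> B" "z \<in> A"
    show "tensor_eval W V w z (tensor_swap V W t) = tensor_eval W V w z (tensor_swap V W t')"
      unfolding tensor_eval_swap[OF V W wz(2,1) t(1)] tensor_eval_swap[OF V W wz(2,1) t(2)]
      by (rule eq[OF wz(2,1)])
  qed
  then show ?thesis using tensor_swap_swap[OF vs t(1)] tensor_swap_swap[OF vs t(2)] by metis
qed

lemma tensor_eval_surj: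
  assumes V: "function_space A V" and W: "function_space B W"
    and dual: "(\<exists>Z b. dual_system A V Z b) \<or> (\<exists>Z b. dual_system B W Z b)"
    and \<beta>: "\<And>z. z \<in> A \<Longrightarrow> restrict (\<beta> z) B \<in> carrier W"
      "\<And>w. w \<in> B \<Longrightarrow> (\<lambda>z\<in>A. \<beta> z w) \<in> carrier V"
  shows "\<exists>t\<in>carrier (tensor V W). \<forall>z\<in>A. \<forall>w\<in>B. tensor_eval V W z w t = \<beta> z w"
  using dual
proof
  assume "\<exists>Z b. dual_system A V Z b"
  then obtain Z b where "dual_system A V Z b" by blast
  then show ?thesis by (rule tensor_eval_surj_left[OF V W]) (rule \<beta>, assumption)+
next
  assume "\<exists>Z b. dual_system B W Z b"
  then obtain Z b where b: "dual_system B W Z b" by blast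
  note vs = function_spaceD(1)[OF V] function_spaceD(1)[OF W]
  have "\<exists>t\<in>carrier (tensor W V). \<forall>w\<in>B. \<forall>z\<in>A. tensor_eval W V w z t = \<beta> z w"
    by (rule tensor_eval_surj_left[OF W V b]) (rule \<beta>, assumption)+
  then obtain t where t: "t \<in> carrier (tensor W V)"
    and eval: "\<forall>w\<in>B. \<forall>z\<in>A. tensor_eval W V w z t = \<beta> z w"
    by blast
  show ?thesis
  proof (intro bexI ballI)
    show "tensor_swap W V t \<in> carrier (tensor V W)"
      by (rule Lin_closed[OF tensor_swap_linear[OF vs(2,1)] t])
    fix z w assume zw: "z \<in> A" "w \<in> B"
    show "tensor_eval V W z w (tensor_swap W V t) = \<beta> z w"
      unfolding tensor_eval_swap[OF W V zw(2,1) t] using eval zw by blast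
  qed
qed

lemma (in linear_species) koszul_function_space:
  "function_space (elems X {1..p}) (koszul_space X p)"
  unfolding function_space_def
proof (intro conjI ballI)
  show "vectorspace class_ring (koszul_space X p)" by (rule koszul_vectorspace)
  show "carrier (koszul_space X p) \<subseteq> extensional (elems X {1..p})"
    by (auto simp: koszul_space_carrier)
  show "(\<lambda>f. f z) \<in> Lin (koszul_space X p) scalars" if "z \<in> elems X {1..p}" for z
    using that by (intro LinI) (simp_all add: koszul_space_simps)
qed

text \<open>A linear form that vanishes on a finite spanning set of \<open>X[p]\<close> vanishes; so the cochains are determined
by their values on this set, from which the points are taken.\<close>

lemma (in linear_species) locally_finite_dual_system:
  assumes "locally_finite X"
  shows "\<exists>Z b. dual_system (elems X {1..p}) (koszul_space X p) Z b"
proof -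
  let ?V = "space_on X {1..p}"
  interpret V: vectorspace class_ring ?V by (rule space) simp
  have "V.fin_dim" using assms unfolding locally_finite_def by simp
  then obtain Z where Z: "finite Z" "Z \<subseteq> carrier ?V" and gen: "V.span Z = carrier ?V"
    unfolding V.fin_dim_def by auto
  define S where "S = {f. koszul_form X p f}"
  have 0: "(\<lambda>y. 0) \<in> S" by (auto simp: S_def koszul_form_def intro!: LinI)
  have diff: "(\<lambda>y. f y - c * g y) \<in> S" if "f \<in> S" "g \<in> S" for f g c
    using that unfolding S_def koszul_form_def
    by (auto simp: algebra_simps intro!: Lin_scalars_diff Lin_scalars_mult)
  have det: "f y = 0" if f: "f \<in> S" and van: "\<forall>z\<in>Z. f z = 0" and y: "y \<in> carrier ?V" for f y
  proof -
    have lin: "f \<in> Lin ?V scalars" using f by (simp add: S_def koszul_form_def)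
    interpret f: mod_hom class_ring ?V scalars f
      using V.module_axioms scalars_vectorspace lin
      by (auto simp: mod_hom_def mod_hom_axioms_def vectorspace_iff_module)
    have "Z \<subseteq> f.ker" using Z(2) van by (auto simp: f.ker_def)
    then have "V.span Z \<subseteq> f.ker" by (rule V.span_is_subset[OF _ f.ker_is_submodule])
    then have "y \<in> f.ker" using y gen by blast
    then show ?thesis by (simp add: f.ker_def)
  qed
  have "\<exists>Z' b. Z' \<subseteq> Z \<and> (\<forall>z\<in>Z'. b z \<in> S) \<and>
      (\<forall>f\<in>S. \<forall>y\<in>carrier ?V. f y = (\<Sum>z\<in>Z'. f z * b z y))"
    by (rule dual_points_exist[OF Z(1)]; (rule diff 0 det; assumption?)?)
  then obtain Z' b where Z': "Z' \<subseteq> Z" and b: "\<forall>z\<in>Z'. b z \<in> S"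
    and rec: "\<forall>f\<in>S. \<forall>y\<in>carrier ?V. f y = (\<Sum>z\<in>Z'. f z * b z y)"
    by blast
  have "dual_system (carrier ?V) (koszul_space X p) Z' (\<lambda>z. restrict (b z) (carrier ?V))"
    unfolding dual_system_def
  proof (intro conjI ballI)
    show "finite Z'" "Z' \<subseteq> carrier ?V" using Z Z' by (auto intro: finite_subset)
    show "restrict (b z) (carrier ?V) \<in> carrier (koszul_space X p)" if "z \<in> Z'" for z
      using b that by (simp add: koszul_space_carrier koszul_form_restrict S_def)
    fix f y assume f: "f \<in> carrier (koszul_space X p)" and y: "y \<in> carrier ?V"
    have "f \<in> S" using f by (simp add: S_def koszul_space_carrier)
    then have "f y = (\<Sum>z\<in>Z'. f z * b z y)" using rec y by blast
    then show "f y = (\<Sum>z\<in>Z'. f z * restrict (b z) (carrier ?V) y)"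
      by (simp only: restrict_apply'[OF y])
  qed
  then show ?thesis by blast
qed

section \<open>Functionals on the Cauchy product\<close>

abbreviation tensor_at ::
  "('k::field, 'a) bicomodule_data \<Rightarrow> ('k, 'b) bicomodule_data \<Rightarrow> nat set \<times> nat set \<Rightarrow>
    ('k, ('a \<times> 'b \<Rightarrow> 'k) set) module" where
  "tensor_at X Y \<equiv> \<lambda>(S, T). tensor (space_on X S) (space_on Y T)"

text \<open>The element \<open>z \<otimes> w\<close> of the summand \<open>(S, T)\<close> of \<open>(X \<cdot> Y)[S \<union> T]\<close>.\<close>

definition cauchy_gen ::
  "('k::field, 'a) bicomodule_data \<Rightarrow> ('k, 'b) bicomodule_data \<Rightarrow> nat set \<Rightarrow> nat set \<Rightarrow>
    'a \<Rightarrow> 'b \<Rightarrow> nat set \<times> nat set \<Rightarrow> ('a \<times> 'b \<Rightarrow> 'k) set" where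
  "cauchy_gen X Y S T z w = summand (decompositions (S \<union> T)) (tensor_at X Y) (S, T)
     (pure_tensor (space_on X S) (space_on Y T) z w)"

text \<open>The common form of the left and the right coaction of the Cauchy product.\<close>

definition cauchy_coact ::
  "('k::field, 'a) bicomodule_data \<Rightarrow> ('k, 'b) bicomodule_data \<Rightarrow>
    (nat set \<Rightarrow> nat set \<Rightarrow> 'a \<Rightarrow> 'a) \<Rightarrow> (nat set \<Rightarrow> nat set \<Rightarrow> 'b \<Rightarrow> 'b) \<Rightarrow> nat set \<Rightarrow> nat set \<Rightarrow>
    (nat set \<times> nat set \<Rightarrow> ('a \<times> 'b \<Rightarrow> 'k) set) \<Rightarrow> nat set \<times> nat set \<Rightarrow> ('a \<times> 'b \<Rightarrow> 'k) set" where
  "cauchy_coact X Y cX cY I U x = (\<lambda>(S', T') \<in> decompositions U.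
        finsum (tensor (space_on X S') (space_on Y T'))
          (\<lambda>(S, T). tensor_map (space_on X S) (space_on Y T) (space_on X S') (space_on Y T')
                     (cX S S') (cY T T') (x (S, T)))
          {(S, T) \<in> decompositions I. S \<inter> U = S' \<and> T \<inter> U = T'})"

text \<open>A family of bilinear forms on the \<open>X[S] \<times> Y[T]\<close>, signed by \<open>sch(S,T)\<close> and assembled to a functional on
\<open>(X \<cdot> Y)[I]\<close>. For \<open>b S T z w = f(\<lambda>\<^sub>S z) g(\<lambda>\<^sub>T w)\<close>, set to zero unless \<open>S\<close> and \<open>T\<close> have the sizes \<open>p\<close>
and \<open>q\<close>, it is the cross product of \<open>f\<close> and \<open>g\<close>.\<close>

definition shuffle_pairing ::
  "('k::field, 'a) bicomodule_data \<Rightarrow> ('k, 'b) bicomodule_data \<Rightarrow>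
    (nat set \<Rightarrow> nat set \<Rightarrow> 'a \<Rightarrow> 'b \<Rightarrow> 'k) \<Rightarrow> nat set \<Rightarrow>
    (nat set \<times> nat set \<Rightarrow> ('a \<times> 'b \<Rightarrow> 'k) set) \<Rightarrow> 'k" where
  "shuffle_pairing X Y b I y = (\<Sum>(S, T)\<in>decompositions I.
     tensor_lift (space_on X S) (space_on Y T) scalars
       (\<lambda>z w. shuffle_sign S T * b S T z w) (y (S, T)))"

definition bialternating ::
  "('k::field, 'a) bicomodule_data \<Rightarrow> ('k, 'b) bicomodule_data \<Rightarrow> nat \<Rightarrow>
    (nat set \<Rightarrow> nat set \<Rightarrow> 'a \<Rightarrow> 'b \<Rightarrow> 'k) \<Rightarrow> bool" where
  "bialternating X Y n b \<longleftrightarrow>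
     (\<forall>p T w. finite T \<and> p + card T = n \<and> w \<in> elems Y T \<longrightarrow>
        alternating_family X p (\<lambda>S z. b S T z w)) \<and>
     (\<forall>q S z. finite S \<and> card S + q = n \<and> z \<in> elems X S \<longrightarrow>
        alternating_family Y q (\<lambda>T w. b S T z w))"

lemma alternating_familyD:
  assumes "alternating_family X p \<phi>" "finite S" "card S = p"
  shows "\<phi> S \<in> Lin (space_on X S) scalars"
    and "\<lbrakk>inj_on \<sigma> S; z \<in> elems X S\<rbrakk> \<Longrightarrow>
      \<phi> (\<sigma> ` S) (transport X S \<sigma> z) = inversion_sign \<sigma> S * \<phi> S z"
  using assms unfolding alternating_family_def by blast+

lemma finite_decompositions: "finite I \<Longrightarrow> finite (decompositions I)"
  by (rule finite_subset[of _ "Pow I \<times> Pow I"]) (auto simp: decompositions_def)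

lemma decompositionsD:
  assumes "(S, T) \<in> decompositions I"
  shows "I = S \<union> T" "S \<inter> T = {}" "S \<subseteq> I" "T \<subseteq> I"
    "finite I \<Longrightarrow> finite S" "finite I \<Longrightarrow> finite T" "finite I \<Longrightarrow> card S + card T = card I"
  using assms by (auto simp: decompositions_def card_Un_disjoint)

lemma cauchy_product_simps:
  "space_on (cauchy_product X Y) I = direct_sum_family (decompositions I) (tensor_at X Y)"
  "lcoact (cauchy_product X Y) = cauchy_coact X Y (lcoact X) (lcoact Y)"
  "rcoact (cauchy_product X Y) = cauchy_coact X Y (rcoact X) (rcoact Y)"
  by (simp_all add: cauchy_product_def cauchy_coact_def fun_eq_iff)

lemma tensor_at_vectorspace: "vectorspace class_ring (tensor_at X Y j)"
  by (simp add: tensor_vectorspace split: prod.split)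

lemma cauchy_vectorspace: "vectorspace class_ring (space_on (cauchy_product X Y) I)"
  unfolding cauchy_product_simps by (rule direct_sum_vectorspace) (rule tensor_at_vectorspace)

lemma cauchy_component_linear:
  assumes "(S, T) \<in> decompositions I"
  shows "(\<lambda>y. y (S, T)) \<in> Lin (space_on (cauchy_product X Y) I) (tensor (space_on X S) (space_on Y T))"
  using component_linear[of "decompositions I" "tensor_at X Y" "(S, T)"] assms
  by (simp add: cauchy_product_simps tensor_at_vectorspace)

lemma cauchy_gen_bilinear:
  assumes "(S, T) \<in> decompositions I"
  shows "cauchy_gen X Y S T \<in> bilinear_maps (space_on X S) (space_on Y T) (space_on (cauchy_product X Y) I)"
proof -
  have "summand (decompositions I) (tensor_at X Y) (S, T) \<in>
      Lin (tensor (space_on X S) (space_on Y T)) (space_on (cauchy_product X Y) I)"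
    using summand_linear[of "decompositions I" "tensor_at X Y" "(S, T)"] assms
    by (simp add: cauchy_product_simps tensor_at_vectorspace)
  from bilinear_maps_comp[OF pure_tensor_bilinear Lin_id Lin_id this] show ?thesis
    using decompositionsD(1)[OF assms] by (simp add: cauchy_gen_def[abs_def])
qed

lemma cauchy_gen_closed:
  assumes "(S, T) \<in> decompositions I" "z \<in> elems X S" "w \<in> elems Y T"
  shows "cauchy_gen X Y S T z w \<in> carrier (space_on (cauchy_product X Y) I)"
  by (rule Lin_closed[OF bilinear_mapsD(1)[OF cauchy_gen_bilinear[OF assms(1)] assms(2)] assms(3)])

lemma cauchy_gen_component:
  "(S', T') \<in> decompositions (S \<union> T) \<Longrightarrow> cauchy_gen X Y S T z w (S', T') =
     (if (S', T') = (S, T) then pure_tensor (space_on X S) (space_on Y T) z w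
      else \<zero>\<^bsub>tensor (space_on X S') (space_on Y T')\<^esub>)"
  by (simp add: cauchy_gen_def summand_def)

locale bicomodule_pair = X: E_bicomodule X + Y: E_bicomodule Y
  for X :: "('k::field, 'a) bicomodule_data" and Y :: "('k, 'b) bicomodule_data"
begin

abbreviation "XY \<equiv> cauchy_product X Y"
abbreviation "KX \<equiv> koszul_space X"
abbreviation "KY \<equiv> koszul_space Y"
abbreviation "KXY \<equiv> koszul_space XY"
abbreviation "gen \<equiv> cauchy_gen X Y"
abbreviation "pairing \<equiv> shuffle_pairing X Y"

text \<open>A functional on \<open>(X \<cdot> Y)[I]\<close> is determined by its values on the elements \<open>z \<otimes> w\<close>. All identities between
cochains of the Cauchy product are checked there.\<close>

lemma cauchy_ext:
  assumes I: "finite I" and U: "vectorspace class_ring U"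
    and f: "f \<in> Lin (space_on XY I) U" and g: "g \<in> Lin (space_on XY I) U"
    and eq: "\<And>S T z w. \<lbrakk>(S, T) \<in> decompositions I; z \<in> elems X S; w \<in> elems Y T\<rbrakk>
      \<Longrightarrow> f (gen S T z w) = g (gen S T z w)"
    and y: "y \<in> elems XY I"
  shows "f y = g y"
proof (rule direct_sum_ext[OF tensor_at_vectorspace finite_decompositions[OF I] U
      f[unfolded cauchy_product_simps] g[unfolded cauchy_product_simps] _ y[unfolded cauchy_product_simps]])
  fix j t assume j: "j \<in> decompositions I" and t: "t \<in> carrier (tensor_at X Y j)"
  obtain S T where ST: "j = (S, T)" by force
  let ?s = "summand (decompositions I) (tensor_at X Y) (S, T)"
  note d = decompositionsD[OF j[unfolded ST]]
  have s: "?s \<in> Lin (tensor (space_on X S) (space_on Y T)) (space_on XY I)"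
    using summand_linear[of "decompositions I" "tensor_at X Y" "(S, T)"] j ST
    by (simp add: cauchy_product_simps tensor_at_vectorspace)
  have "f (?s t) = g (?s t)"
  proof (rule tensor_ext[OF X.space[OF d(5)[OF I]] Y.space[OF d(6)[OF I]] U Lin_comp[OF s f] Lin_comp[OF s g]])
    show "t \<in> carrier (tensor (space_on X S) (space_on Y T))" using t ST by simp
    show "f (?s (pure_tensor (space_on X S) (space_on Y T) z w)) = g (?s (pure_tensor (space_on X S) (space_on Y T) z w))"
      if "z \<in> elems X S" "w \<in> elems Y T" for z w
      using eq[OF j[unfolded ST] that] unfolding cauchy_gen_def d(1) .
  qed
  then show "f (summand (decompositions I) (tensor_at X Y) j t) = g (summand (decompositions I) (tensor_at X Y) j t)"
    by (simp only: ST)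
qed

lemma decomposition_preimage:
  assumes "inj_on \<sigma> I" "(S', T') \<in> decompositions (\<sigma> ` I)"
  shows "(I \<inter> \<sigma> -` S', I \<inter> \<sigma> -` T') \<in> decompositions I"
    "\<sigma> ` (I \<inter> \<sigma> -` S') = S'" "\<sigma> ` (I \<inter> \<sigma> -` T') = T'"
proof -
  have "\<sigma> ` (I \<inter> \<sigma> -` A) = \<sigma> ` I \<inter> A" for A by auto
  then show "\<sigma> ` (I \<inter> \<sigma> -` S') = S'" "\<sigma> ` (I \<inter> \<sigma> -` T') = T'"
    using assms(2) by (auto simp: decompositions_def)
  show "(I \<inter> \<sigma> -` S', I \<inter> \<sigma> -` T') \<in> decompositions I"
    using assms by (auto simp: decompositions_def)
qed

lemma cauchy_transport_component_linear:
  assumes I: "finite I" "inj_on \<sigma> I" and ST: "(S, T) \<in> decompositions I"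
  shows "tensor_map (space_on X S) (space_on Y T) (space_on X (\<sigma> ` S)) (space_on Y (\<sigma> ` T))
      (transport X S \<sigma>) (transport Y T \<sigma>) \<in>
    Lin (tensor (space_on X S) (space_on Y T)) (tensor (space_on X (\<sigma> ` S)) (space_on Y (\<sigma> ` T)))"
proof -
  note d = decompositionsD[OF ST]
  show ?thesis
    by (intro tensor_map_linear X.space Y.space X.transport_linear Y.transport_linear
        d(5)[OF I(1)] d(6)[OF I(1)] inj_on_subset[OF I(2) d(3)] inj_on_subset[OF I(2) d(4)])
qed

lemma cauchy_transport_linear:
  assumes I: "finite I" "inj_on \<sigma> I"
  shows "transport XY I \<sigma> \<in> Lin (space_on XY I) (space_on XY (\<sigma> ` I))"
proof -
  have "(\<lambda>x. \<lambda>j\<in>decompositions (\<sigma> ` I). case j of (S', T') \<Rightarrow>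
        tensor_map (space_on X (I \<inter> \<sigma> -` S')) (space_on Y (I \<inter> \<sigma> -` T')) (space_on X S') (space_on Y T')
          (transport X (I \<inter> \<sigma> -` S') \<sigma>) (transport Y (I \<inter> \<sigma> -` T') \<sigma>) (x (I \<inter> \<sigma> -` S', I \<inter> \<sigma> -` T')))
     \<in> Lin (space_on XY I) (direct_sum_family (decompositions (\<sigma> ` I)) (tensor_at X Y))"
  proof (rule tuple_linear[OF tensor_at_vectorspace])
    fix j assume j: "j \<in> decompositions (\<sigma> ` I)"
    obtain S' T' where ST': "j = (S', T')" by force
    note p = decomposition_preimage[OF I(2) j[unfolded ST']]
    show "(\<lambda>x. case j of (S', T') \<Rightarrow>
        tensor_map (space_on X (I \<inter> \<sigma> -` S')) (space_on Y (I \<inter> \<sigma> -` T')) (space_on X S') (space_on Y T')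
          (transport X (I \<inter> \<sigma> -` S') \<sigma>) (transport Y (I \<inter> \<sigma> -` T') \<sigma>) (x (I \<inter> \<sigma> -` S', I \<inter> \<sigma> -` T')))
      \<in> Lin (space_on XY I) (tensor_at X Y j)"
      unfolding ST' prod.case
      using Lin_comp[OF cauchy_component_linear[OF p(1)] cauchy_transport_component_linear[OF I p(1)]]
      unfolding p(2,3) .
  qed
  then show ?thesis
    by (simp add: cauchy_product_def cauchy_product_simps(1)[unfolded cauchy_product_def, simplified] Let_def)
qed

lemma cauchy_transport_gen:
  assumes I: "finite I" "inj_on \<sigma> I" and ST: "(S, T) \<in> decompositions I"
    and z: "z \<in> elems X S" and w: "w \<in> elems Y T"
  shows "transport XY I \<sigma> (gen S T z w) =
    gen (\<sigma> ` S) (\<sigma> ` T) (transport X S \<sigma> z) (transport Y T \<sigma> w)"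
proof (rule extensionalityI[where A = "decompositions (\<sigma> ` I)"])
  note d = decompositionsD[OF ST]
  have im: "\<sigma> ` I = \<sigma> ` S \<union> \<sigma> ` T" using d by auto
  show "transport XY I \<sigma> (gen S T z w) \<in> extensional (decompositions (\<sigma> ` I))"
    by (simp add: cauchy_product_def)
  show "gen (\<sigma> ` S) (\<sigma> ` T) (transport X S \<sigma> z) (transport Y T \<sigma> w) \<in>
      extensional (decompositions (\<sigma> ` I))"
    by (simp add: cauchy_gen_def summand_def im)
  fix j assume j: "j \<in> decompositions (\<sigma> ` I)"
  obtain S' T' where ST': "j = (S', T')" by force
  define S0 T0 where "S0 = I \<inter> \<sigma> -` S'" and "T0 = I \<inter> \<sigma> -` T'"
  note p = decomposition_preimage[OF I(2) j[unfolded ST'], folded S0_def T0_def]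
  have lhs: "transport XY I \<sigma> (gen S T z w) j =
     tensor_map (space_on X S0) (space_on Y T0) (space_on X (\<sigma> ` S0)) (space_on Y (\<sigma> ` T0))
       (transport X S0 \<sigma>) (transport Y T0 \<sigma>) (gen S T z w (S0, T0))"
    using j by (simp add: cauchy_product_def ST' S0_def[symmetric] T0_def[symmetric] p)
  have rhs: "gen (\<sigma> ` S) (\<sigma> ` T) (transport X S \<sigma> z) (transport Y T \<sigma> w) j =
     (if (S', T') = (\<sigma> ` S, \<sigma> ` T) then pure_tensor (space_on X (\<sigma> ` S)) (space_on Y (\<sigma> ` T)) (transport X S \<sigma> z) (transport Y T \<sigma> w)
      else \<zero>\<^bsub>tensor (space_on X S') (space_on Y T')\<^esub>)"
    unfolding ST' by (rule cauchy_gen_component) (use j ST' im in simp)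
  have comp: "gen S T z w (S0, T0) =
     (if (S0, T0) = (S, T) then pure_tensor (space_on X S) (space_on Y T) z w
      else \<zero>\<^bsub>tensor (space_on X S0) (space_on Y T0)\<^esub>)"
    by (rule cauchy_gen_component) (use p(1) d(1) in simp)
  have eq: "(S', T') = (\<sigma> ` S, \<sigma> ` T) \<longleftrightarrow> (S0, T0) = (S, T)"
    using p d(3,4) I(2) by (metis S0_def T0_def Int_lower1 inj_on_image_eq_iff prod.inject)
  show "transport XY I \<sigma> (gen S T z w) j =
     gen (\<sigma> ` S) (\<sigma> ` T) (transport X S \<sigma> z) (transport Y T \<sigma> w) j"
  proof (cases "(S0, T0) = (S, T)")
    case True
    have fin: "finite S" "finite T" using d(5,6) I by auto
    have "tensor_map (space_on X S) (space_on Y T) (space_on X (\<sigma> ` S)) (space_on Y (\<sigma> ` T))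
       (transport X S \<sigma>) (transport Y T \<sigma>) (pure_tensor (space_on X S) (space_on Y T) z w) =
       pure_tensor (space_on X (\<sigma> ` S)) (space_on Y (\<sigma> ` T)) (transport X S \<sigma> z) (transport Y T \<sigma> w)"
      by (intro tensor_map_pure X.space Y.space X.transport_linear Y.transport_linear fin z w
          inj_on_subset[OF I(2) d(3)] inj_on_subset[OF I(2) d(4)])
    then show ?thesis using True eq unfolding lhs rhs comp by simp
  next
    case False
    have "tensor_map (space_on X S0) (space_on Y T0) (space_on X (\<sigma> ` S0)) (space_on Y (\<sigma> ` T0))
       (transport X S0 \<sigma>) (transport Y T0 \<sigma>) \<zero>\<^bsub>tensor (space_on X S0) (space_on Y T0)\<^esub> =
       \<zero>\<^bsub>tensor (space_on X (\<sigma> ` S0)) (space_on Y (\<sigma> ` T0))\<^esub>"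
      by (rule Lin_zero[OF tensor_vectorspace tensor_vectorspace cauchy_transport_component_linear[OF I p(1)]])
    moreover have "((S0, T0) = (S, T)) = False" "((S', T') = (\<sigma> ` S, \<sigma> ` T)) = False"
      using False eq by blast+
    ultimately show ?thesis unfolding lhs rhs comp by (simp only: if_False p(2,3))
  qed
qed

lemma cauchy_coact_part_linear:
  assumes cX: "\<And>S S'. \<lbrakk>finite S; S' \<subseteq> S\<rbrakk> \<Longrightarrow> cX S S' \<in> Lin (space_on X S) (space_on X S')"
    and cY: "\<And>T T'. \<lbrakk>finite T; T' \<subseteq> T\<rbrakk> \<Longrightarrow> cY T T' \<in> Lin (space_on Y T) (space_on Y T')"
    and I: "finite I" and ST: "(S, T) \<in> decompositions I"
  shows "tensor_map (space_on X S) (space_on Y T) (space_on X (S \<inter> U)) (space_on Y (T \<inter> U))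
      (cX S (S \<inter> U)) (cY T (T \<inter> U)) \<in>
    Lin (tensor (space_on X S) (space_on Y T)) (tensor (space_on X (S \<inter> U)) (space_on Y (T \<inter> U)))"
  by (intro tensor_map_linear X.space Y.space cX cY decompositionsD(5)[OF ST I] decompositionsD(6)[OF ST I] Int_lower1)

lemma cauchy_coact_linear:
  assumes cX: "\<And>S S'. \<lbrakk>finite S; S' \<subseteq> S\<rbrakk> \<Longrightarrow> cX S S' \<in> Lin (space_on X S) (space_on X S')"
    and cY: "\<And>T T'. \<lbrakk>finite T; T' \<subseteq> T\<rbrakk> \<Longrightarrow> cY T T' \<in> Lin (space_on Y T) (space_on Y T')"
    and I: "finite I"
  shows "cauchy_coact X Y cX cY I U \<in> Lin (space_on XY I) (space_on XY U)"
  unfolding cauchy_coact_def[abs_def] cauchy_product_simps(1)[of X Y U]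
proof (rule tuple_linear[OF tensor_at_vectorspace])
  fix j assume "j \<in> decompositions U"
  obtain S' T' where ST': "j = (S', T')" by force
  show "(\<lambda>x. case j of (S', T') \<Rightarrow> finsum (tensor (space_on X S') (space_on Y T'))
          (\<lambda>(S, T). tensor_map (space_on X S) (space_on Y T) (space_on X S') (space_on Y T')
                     (cX S S') (cY T T') (x (S, T)))
          {(S, T) \<in> decompositions I. S \<inter> U = S' \<and> T \<inter> U = T'})
      \<in> Lin (space_on XY I) (tensor_at X Y j)"
    unfolding ST' prod.case
  proof (rule Lin_finsum_map[OF tensor_vectorspace])
    fix k assume k: "k \<in> {(S, T) \<in> decompositions I. S \<inter> U = S' \<and> T \<inter> U = T'}"
    obtain S T where ST: "k = (S, T)" by force
    then have d: "(S, T) \<in> decompositions I" and SU: "S \<inter> U = S'" "T \<inter> U = T'" using k by auto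
    show "(\<lambda>x. case k of (S, T) \<Rightarrow> tensor_map (space_on X S) (space_on Y T) (space_on X S') (space_on Y T')
                     (cX S S') (cY T T') (x (S, T))) \<in> Lin (space_on XY I) (tensor (space_on X S') (space_on Y T'))"
      unfolding ST prod.case
      using Lin_comp[OF cauchy_component_linear[OF d] cauchy_coact_part_linear[OF cX cY I d, of U]]
      unfolding SU by simp
  qed
qed

text \<open>Among the decompositions which restrict to a given one of \<open>U\<close>, at most \<open>(S, T)\<close> carries a nonzero
component of \<open>z \<otimes> w\<close>.\<close>

lemma cauchy_coact_gen:
  assumes cX: "\<And>S S'. \<lbrakk>finite S; S' \<subseteq> S\<rbrakk> \<Longrightarrow> cX S S' \<in> Lin (space_on X S) (space_on X S')"
    and cY: "\<And>T T'. \<lbrakk>finite T; T' \<subseteq> T\<rbrakk> \<Longrightarrow> cY T T' \<in> Lin (space_on Y T) (space_on Y T')"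
    and I: "finite I" "U \<subseteq> I" and ST: "(S, T) \<in> decompositions I"
    and z: "z \<in> elems X S" and w: "w \<in> elems Y T"
  shows "cauchy_coact X Y cX cY I U (gen S T z w) =
    gen (S \<inter> U) (T \<inter> U) (cX S (S \<inter> U) z) (cY T (T \<inter> U) w)"
proof (rule extensionalityI[where A = "decompositions U"])
  note d = decompositionsD[OF ST]
  have im: "U = (S \<inter> U) \<union> (T \<inter> U)" using d(1) I(2) by auto
  let ?g = "gen S T z w"
  let ?h = "gen (S \<inter> U) (T \<inter> U) (cX S (S \<inter> U) z) (cY T (T \<inter> U) w)"
  show "cauchy_coact X Y cX cY I U ?g \<in> extensional (decompositions U)"
    by (simp add: cauchy_coact_def)
  show "?h \<in> extensional (decompositions U)"
    using im by (simp add: cauchy_gen_def summand_def)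
  fix j assume j: "j \<in> decompositions U"
  obtain S' T' where ST': "j = (S', T')" by force
  let ?T = "tensor (space_on X S') (space_on Y T')"
  let ?K = "{(S, T) \<in> decompositions I. S \<inter> U = S' \<and> T \<inter> U = T'}"
  interpret T: vectorspace class_ring ?T by (rule tensor_vectorspace)
  have K: "finite ?K" by (rule finite_subset[OF _ finite_decompositions[OF I(1)]]) auto
  let ?v = "pure_tensor (space_on X S') (space_on Y T') (cX S S' z) (cY T T' w)"
  have part: "tensor_map (space_on X S0) (space_on Y T0) (space_on X S') (space_on Y T')
       (cX S0 S') (cY T0 T') (?g (S0, T0)) = (if (S, T) = (S0, T0) then ?v else \<zero>\<^bsub>?T\<^esub>)"
    if K0: "(S0, T0) \<in> ?K" for S0 T0
  proof -
    have d0: "(S0, T0) \<in> decompositions I" and U0: "S0 \<inter> U = S'" "T0 \<inter> U = T'" using K0 by auto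
    have comp: "?g (S0, T0) = (if (S0, T0) = (S, T) then pure_tensor (space_on X S) (space_on Y T) z w
        else \<zero>\<^bsub>tensor (space_on X S0) (space_on Y T0)\<^esub>)"
      by (rule cauchy_gen_component) (use d0 d(1) in simp)
    show ?thesis
    proof (cases "(S0, T0) = (S, T)")
      case True
      then have "tensor_map (space_on X S) (space_on Y T) (space_on X S') (space_on Y T')
          (cX S S') (cY T T') (pure_tensor (space_on X S) (space_on Y T) z w) = ?v"
        using U0 by (intro tensor_map_pure X.space Y.space cX cY d(5)[OF I(1)] d(6)[OF I(1)] z w) auto
      then show ?thesis unfolding comp using True by simp
    next
      case False
      have "tensor_map (space_on X S0) (space_on Y T0) (space_on X S') (space_on Y T')
          (cX S0 S') (cY T0 T') \<zero>\<^bsub>tensor (space_on X S0) (space_on Y T0)\<^esub> = \<zero>\<^bsub>?T\<^esub>"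
        using Lin_zero[OF tensor_vectorspace tensor_vectorspace cauchy_coact_part_linear[OF cX cY I(1) d0, of U]]
        unfolding U0 by simp
      moreover have "((S0, T0) = (S, T)) = False" "((S, T) = (S0, T0)) = False" using False by blast+
      ultimately show ?thesis unfolding comp by (simp only: if_False)
    qed
  qed
  have "cauchy_coact X Y cX cY I U ?g j = finsum ?T
      (\<lambda>(S0, T0). tensor_map (space_on X S0) (space_on Y T0) (space_on X S') (space_on Y T')
         (cX S0 S') (cY T0 T') (?g (S0, T0))) ?K"
    using j by (simp add: cauchy_coact_def ST')
  also have "\<dots> = finsum ?T (\<lambda>k. if (S, T) = k then ?v else \<zero>\<^bsub>?T\<^esub>) ?K"
  proof (rule T.M.finsum_cong'[OF refl])
    show "(\<lambda>k. if (S, T) = k then ?v else \<zero>\<^bsub>?T\<^esub>) \<in> ?K \<rightarrow> carrier ?T"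
      by (simp add: pure_tensor_closed)
    fix k assume k: "k \<in> ?K"
    obtain S0 T0 where "k = (S0, T0)" by force
    then show "(case k of (S0, T0) \<Rightarrow> tensor_map (space_on X S0) (space_on Y T0) (space_on X S') (space_on Y T')
         (cX S0 S') (cY T0 T') (?g (S0, T0))) = (if (S, T) = k then ?v else \<zero>\<^bsub>?T\<^esub>)"
      using part[of S0 T0] k by (simp only: prod.case)
  qed
  also have "\<dots> = (if (S, T) \<in> ?K then ?v else \<zero>\<^bsub>?T\<^esub>)"
  proof (cases "(S, T) \<in> ?K")
    case True
    then show ?thesis
      using T.M.add.finprod_singleton[OF True K, of "\<lambda>_. ?v"] by (simp add: pure_tensor_closed finsum_def)
  next
    case False
    have "finsum ?T (\<lambda>k. if (S, T) = k then ?v else \<zero>\<^bsub>?T\<^esub>) ?K = finsum ?T (\<lambda>k. \<zero>\<^bsub>?T\<^esub>) ?K"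
    proof (rule T.M.finsum_cong'[OF refl])
      fix k assume "k \<in> ?K"
      then have "(S, T) \<noteq> k" using False by blast
      then show "(if (S, T) = k then ?v else \<zero>\<^bsub>?T\<^esub>) = \<zero>\<^bsub>?T\<^esub>" by (rule if_not_P)
    qed simp
    then show ?thesis unfolding if_not_P[OF False] by (simp only: T.M.finsum_zero)
  qed
  also have "\<dots> = ?h j"
  proof -
    have "?h (S', T') = (if (S', T') = (S \<inter> U, T \<inter> U) then pure_tensor (space_on X (S \<inter> U)) (space_on Y (T \<inter> U))
        (cX S (S \<inter> U) z) (cY T (T \<inter> U) w) else \<zero>\<^bsub>?T\<^esub>)"
      by (rule cauchy_gen_component) (use j ST' im in simp)
    moreover have "(S, T) \<in> ?K \<longleftrightarrow> (S', T') = (S \<inter> U, T \<inter> U)" using ST by auto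
    ultimately show ?thesis unfolding ST' by auto
  qed
  finally show "cauchy_coact X Y cX cY I U ?g j = ?h j" .
qed

lemma bialternating_bilinear:
  assumes b: "bialternating X Y n b" and I: "finite I" "card I = n" and ST: "(S, T) \<in> decompositions I"
  shows "(\<lambda>z w. shuffle_sign S T * b S T z w) \<in> bilinear_maps (space_on X S) (space_on Y T) scalars"
proof -
  have ST': "finite S" "finite T" "card S + card T = n" using decompositionsD[OF ST] I by auto
  show ?thesis
  proof (rule bilinear_mapsI)
    fix z assume "z \<in> elems X S"
    then have "alternating_family Y (card T) (\<lambda>T w. b S T z w)"
      using b ST' unfolding bialternating_def by blast
    from alternating_familyD(1)[OF this ST'(2)] show "(\<lambda>w. shuffle_sign S T * b S T z w) \<in> Lin (space_on Y T) scalars"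
      by (intro Lin_scalars_mult) simp
  next
    fix w assume "w \<in> elems Y T"
    then have "alternating_family X (card S) (\<lambda>S z. b S T z w)"
      using b ST' unfolding bialternating_def by blast
    from alternating_familyD(1)[OF this ST'(1)] show "(\<lambda>z. shuffle_sign S T * b S T z w) \<in> Lin (space_on X S) scalars"
      by (intro Lin_scalars_mult) simp
  qed
qed

lemma shuffle_pairing_linear:
  assumes b: "bialternating X Y n b" and I: "finite I" "card I = n"
  shows "pairing b I \<in> Lin (space_on XY I) scalars"
  unfolding shuffle_pairing_def[abs_def]
proof (rule Lin_scalars_sum)
  fix j assume j: "j \<in> decompositions I"
  obtain S T where ST: "j = (S, T)" by force
  note d = decompositionsD[OF j[unfolded ST]]
  show "(\<lambda>y. case j of (S, T) \<Rightarrow> tensor_lift (space_on X S) (space_on Y T) scalars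
       (\<lambda>z w. shuffle_sign S T * b S T z w) (y (S, T))) \<in> Lin (space_on XY I) scalars"
    unfolding ST prod.case
    by (rule Lin_comp[OF cauchy_component_linear[OF j[unfolded ST]] tensor_lift_linear[OF X.space[OF d(5)[OF I(1)]]
        Y.space[OF d(6)[OF I(1)]] scalars_vectorspace bialternating_bilinear[OF b I j[unfolded ST]]]])
qed

lemma shuffle_pairing_gen:
  assumes b: "bialternating X Y n b" and I: "finite I" "card I = n" and ST: "(S, T) \<in> decompositions I"
    and z: "z \<in> elems X S" and w: "w \<in> elems Y T"
  shows "pairing b I (gen S T z w) = shuffle_sign S T * b S T z w"
proof -
  note d = decompositionsD[OF ST]
  have "(case k of (S0, T0) \<Rightarrow> tensor_lift (space_on X S0) (space_on Y T0) scalars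
       (\<lambda>z w. shuffle_sign S0 T0 * b S0 T0 z w) (gen S T z w (S0, T0))) =
      (if k = (S, T) then shuffle_sign S T * b S T z w else 0)"
    if k: "k \<in> decompositions I" for k
  proof -
    obtain S0 T0 where k0: "k = (S0, T0)" by force
    note d0 = decompositionsD[OF k[unfolded k0]]
    note lift = tensor_lift[OF X.space[OF d0(5)[OF I(1)]] Y.space[OF d0(6)[OF I(1)]] scalars_vectorspace
        bialternating_bilinear[OF b I k[unfolded k0]]]
    have comp: "gen S T z w (S0, T0) =
       (if (S0, T0) = (S, T) then pure_tensor (space_on X S) (space_on Y T) z w
        else \<zero>\<^bsub>tensor (space_on X S0) (space_on Y T0)\<^esub>)"
      by (rule cauchy_gen_component) (use k k0 d(1) in simp)
    show ?thesis
    proof (cases "k = (S, T)")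
      case True
      then show ?thesis using lift(2) z w unfolding k0 prod.case comp by simp
    next
      case False
      then have "((S0, T0) = (S, T)) = False" using k0 by simp
      then show ?thesis
        using Lin_zero[OF tensor_vectorspace scalars_vectorspace lift(1)] unfolding k0 prod.case comp
        by (simp only: if_False scalars_simps)
    qed
  qed
  then have "pairing b I (gen S T z w) =
     (\<Sum>k\<in>decompositions I. if k = (S, T) then shuffle_sign S T * b S T z w else 0)"
    unfolding shuffle_pairing_def by (rule sum.cong[OF refl])
  then show ?thesis using ST finite_decompositions[OF I(1)] by simp
qed

text \<open>On \<open>z \<otimes> w\<close> the two sides differ by the signs of \<open>\<sigma>\<close> on \<open>S\<close>, on \<open>T\<close> and on the mixed pairs, which is
\<open>inversion_sign_Un\<close>.\<close>

lemma shuffle_pairing_alternating: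
  assumes b: "bialternating X Y n b"
  shows "alternating_family XY n (pairing b)"
  unfolding alternating_family_def
proof (intro allI impI ballI conjI; elim conjE)
  fix I :: "nat set" assume I: "finite I" "card I = n"
  show "pairing b I \<in> Lin (space_on XY I) scalars" by (rule shuffle_pairing_linear[OF b I])
  fix \<sigma> :: "nat \<Rightarrow> nat" and y assume \<sigma>: "inj_on \<sigma> I" and y: "y \<in> elems XY I"
  have I': "finite (\<sigma> ` I)" "card (\<sigma> ` I) = n" using I \<sigma> by (simp_all add: card_image)
  show "pairing b (\<sigma> ` I) (transport XY I \<sigma> y) = inversion_sign \<sigma> I * pairing b I y"
  proof (rule cauchy_ext[OF I(1) scalars_vectorspace
        Lin_comp[OF cauchy_transport_linear[OF I(1) \<sigma>] shuffle_pairing_linear[OF b I']]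
        Lin_scalars_mult[OF shuffle_pairing_linear[OF b I]] _ y])
    fix S T z w assume ST: "(S, T) \<in> decompositions I"
      and z: "z \<in> elems X S" and w: "w \<in> elems Y T"
    note d = decompositionsD[OF ST]
    have fin: "finite S" "finite T" and card: "card S + card T = n" using d I by auto
    have \<sigma>S: "inj_on \<sigma> S" and \<sigma>T: "inj_on \<sigma> T" using d(3,4) \<sigma> by (auto intro: inj_on_subset)
    have ST': "(\<sigma> ` S, \<sigma> ` T) \<in> decompositions (\<sigma> ` I)"
      using d \<sigma> by (auto simp: decompositions_def inj_on_def)
    have z': "transport X S \<sigma> z \<in> elems X (\<sigma> ` S)" by (rule X.transport_closed[OF fin(1) \<sigma>S z])
    have w': "transport Y T \<sigma> w \<in> elems Y (\<sigma> ` T)" by (rule Y.transport_closed[OF fin(2) \<sigma>T w])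
    have cT: "card S + card (\<sigma> ` T) = n" using card \<sigma>T by (simp add: card_image)
    have aX: "alternating_family X (card S) (\<lambda>S z. b S (\<sigma> ` T) z (transport Y T \<sigma> w))"
      using b w' cT fin unfolding bialternating_def by blast
    have aY: "alternating_family Y (card T) (\<lambda>T w. b S T z w)"
      using b z card fin unfolding bialternating_def by blast
    have "pairing b (\<sigma> ` I) (transport XY I \<sigma> (gen S T z w)) =
        shuffle_sign (\<sigma> ` S) (\<sigma> ` T) * b (\<sigma> ` S) (\<sigma> ` T) (transport X S \<sigma> z) (transport Y T \<sigma> w)"
      unfolding cauchy_transport_gen[OF I(1) \<sigma> ST z w] by (rule shuffle_pairing_gen[OF b I' ST' z' w'])
    also have "b (\<sigma> ` S) (\<sigma> ` T) (transport X S \<sigma> z) (transport Y T \<sigma> w) =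
        inversion_sign \<sigma> S * (inversion_sign \<sigma> T * b S T z w)"
      unfolding alternating_familyD(2)[OF aX fin(1) refl \<sigma>S z] alternating_familyD(2)[OF aY fin(2) refl \<sigma>T w] ..
    also have "shuffle_sign (\<sigma> ` S) (\<sigma> ` T) * (inversion_sign \<sigma> S * (inversion_sign \<sigma> T * b S T z w)) =
        inversion_sign \<sigma> I * (shuffle_sign S T * b S T z w)"
      using inversion_sign_Un[OF fin d(2), of \<sigma>, where ?'k = 'k] \<sigma> d(1) by (simp only: mult.assoc[symmetric])
    also have "shuffle_sign S T * b S T z w = pairing b I (gen S T z w)"
      by (rule shuffle_pairing_gen[OF b I ST z w, symmetric])
    finally show "pairing b (\<sigma> ` I) (transport XY I \<sigma> (gen S T z w)) =
        inversion_sign \<sigma> I * pairing b I (gen S T z w)" .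
  qed
qed

end

section \<open>The cross product as a pairing\<close>

lemma alternating_family_cong:
  assumes \<phi>: "alternating_family X p \<phi>" and eq: "\<And>S. \<lbrakk>finite S; card S = p\<rbrakk> \<Longrightarrow> \<phi> S = \<psi> S"
  shows "alternating_family X p \<psi>"
  unfolding alternating_family_def
proof (intro allI impI ballI conjI; elim conjE)
  fix S :: "nat set" assume S: "finite S" "card S = p"
  show "\<psi> S \<in> Lin (space_on X S) scalars"
    using alternating_familyD(1)[OF \<phi> S] eq[OF S] by simp
  fix \<sigma> :: "nat \<Rightarrow> nat" and z assume \<sigma>: "inj_on \<sigma> S" and z: "z \<in> elems X S"
  have "\<phi> (\<sigma> ` S) = \<psi> (\<sigma> ` S)" using S \<sigma> by (intro eq) (auto simp: card_image)
  then show "\<psi> (\<sigma> ` S) (transport X S \<sigma> z) = inversion_sign \<sigma> S * \<psi> S z"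
    using alternating_familyD(2)[OF \<phi> S \<sigma> z] eq[OF S] by simp
qed

context linear_species
begin

text \<open>On pure tensors \<open>f \<otimes> g\<close> the function of \<open>z\<close> is a multiple of \<open>f\<close>. Linearity and equivariance in \<open>z\<close> are
identities between functionals of \<open>t\<close>, so they extend to all tensors.\<close>

lemma tensor_eval_koszul_form_left:
  assumes W: "function_space B W" and w: "w \<in> B" and t: "t \<in> carrier (tensor (koszul_space X p) W)"
  shows "koszul_form X p (\<lambda>z. tensor_eval (koszul_space X p) W z w t)"
proof -
  let ?K = "koszul_space X p" and ?V = "space_on X {1..p}"
  note fs = koszul_function_space[of p] W
  note vs = koszul_vectorspace[of p] function_spaceD(1)[OF W]
  have V: "vectorspace class_ring ?V" by (rule space) simp
  have lin: "tensor_eval ?K W z w \<in> Lin (tensor ?K W) scalars" if "z \<in> carrier ?V" for z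
    by (rule tensor_eval_linear[OF fs that w])
  have pure: "tensor_eval ?K W z w (pure_tensor ?K W f g) = f z * g w"
    if "z \<in> carrier ?V" "f \<in> carrier ?K" "g \<in> carrier W" for z f g
    by (rule tensor_eval_pure[OF fs that(1) w that(2,3)])
  have form: "f \<in> Lin ?V scalars" if "f \<in> carrier ?K" for f
    using that by (simp add: koszul_space_carrier koszul_form_def)
  show ?thesis
    unfolding koszul_form_def
  proof (intro conjI allI impI ballI)
    show "(\<lambda>z. tensor_eval ?K W z w t) \<in> Lin ?V scalars"
    proof (rule LinI)
      fix u v assume uv: "u \<in> carrier ?V" "v \<in> carrier ?V"
      have uv': "u \<oplus>\<^bsub>?V\<^esub> v \<in> carrier ?V" by (rule vectorspace_closed(2)[OF V uv])
      show "tensor_eval ?K W (u \<oplus>\<^bsub>?V\<^esub> v) w t = tensor_eval ?K W u w t \<oplus>\<^bsub>scalars\<^esub> tensor_eval ?K W v w t"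
      proof (rule tensor_ext[OF vs scalars_vectorspace lin[OF uv'] Lin_add_map[OF scalars_vectorspace lin[OF uv(1)] lin[OF uv(2)]] _ t])
        fix f g assume f: "f \<in> carrier ?K" and g: "g \<in> carrier W"
        then show "tensor_eval ?K W (u \<oplus>\<^bsub>?V\<^esub> v) w (pure_tensor ?K W f g) =
            tensor_eval ?K W u w (pure_tensor ?K W f g) \<oplus>\<^bsub>scalars\<^esub> tensor_eval ?K W v w (pure_tensor ?K W f g)"
          using Lin_add[OF form[OF f] uv] by (simp add: pure uv uv' distrib_right)
      qed
    next
      fix c v assume v: "v \<in> carrier ?V"
      have v': "c \<odot>\<^bsub>?V\<^esub> v \<in> carrier ?V" by (rule vectorspace_closed(3)[OF V v])
      show "tensor_eval ?K W (c \<odot>\<^bsub>?V\<^esub> v) w t = c \<odot>\<^bsub>scalars\<^esub> tensor_eval ?K W v w t"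
      proof (rule tensor_ext[OF vs scalars_vectorspace lin[OF v'] Lin_smult_map[OF scalars_vectorspace lin[OF v]] _ t])
        fix f g assume f: "f \<in> carrier ?K" and g: "g \<in> carrier W"
        then show "tensor_eval ?K W (c \<odot>\<^bsub>?V\<^esub> v) w (pure_tensor ?K W f g) =
            c \<odot>\<^bsub>scalars\<^esub> tensor_eval ?K W v w (pure_tensor ?K W f g)"
          using Lin_smult[OF form[OF f] v] by (simp add: pure v v')
      qed
    qed simp
  next
    fix \<sigma> z assume \<sigma>: "\<sigma> permutes {1..p}" and z: "z \<in> carrier ?V"
    have z': "transport X {1..p} \<sigma> z \<in> carrier ?V"
      by (rule Lin_closed[OF transport_permutation_linear[OF \<sigma>] z])
    show "tensor_eval ?K W (transport X {1..p} \<sigma> z) w t = of_int (sign \<sigma>) * tensor_eval ?K W z w t"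
    proof (rule tensor_ext[OF vs scalars_vectorspace lin[OF z'] Lin_scalars_mult[OF lin[OF z]] _ t])
      fix f g assume f: "f \<in> carrier ?K" and g: "g \<in> carrier W"
      have "f (transport X {1..p} \<sigma> z) = of_int (sign \<sigma>) * f z"
        using f \<sigma> z unfolding koszul_space_carrier koszul_form_def by blast
      then show "tensor_eval ?K W (transport X {1..p} \<sigma> z) w (pure_tensor ?K W f g) =
          of_int (sign \<sigma>) * tensor_eval ?K W z w (pure_tensor ?K W f g)"
        using f g by (simp add: pure z z')
    qed
  qed
qed

lemma tensor_eval_koszul_form_right:
  assumes V: "function_space A V" and z: "z \<in> A" and t: "t \<in> carrier (tensor V (koszul_space X q))"
  shows "koszul_form X q (\<lambda>w. tensor_eval V (koszul_space X q) z w t)"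
proof -
  let ?K = "koszul_space X q"
  note vs = function_spaceD(1)[OF V] koszul_vectorspace[of q]
  have "koszul_form X q (\<lambda>w. tensor_eval ?K V w z (tensor_swap V ?K t))"
    by (rule tensor_eval_koszul_form_left[OF V z Lin_closed[OF tensor_swap_linear[OF vs] t]])
  then show ?thesis
    by (subst koszul_form_cong[OF space transport_permutation_linear
          tensor_eval_swap[OF V koszul_function_space z _ t, symmetric]]) simp_all
qed

end

text \<open>The bilinear forms which belong to an element \<open>x\<close> of \<open>K(X) \<otimes> K(Y)\<close>.\<close>

definition eval_family ::
  "('k::field, 'a) bicomodule_data \<Rightarrow> ('k, 'b) bicomodule_data \<Rightarrow>
    (nat \<times> nat \<Rightarrow> (('a \<Rightarrow> 'k) \<times> ('b \<Rightarrow> 'k) \<Rightarrow> 'k) set) \<Rightarrow>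
    nat set \<Rightarrow> nat set \<Rightarrow> 'a \<Rightarrow> 'b \<Rightarrow> 'k" where
  "eval_family X Y x S T z w = tensor_eval (koszul_space X (card S)) (koszul_space Y (card T))
     (standardize X S z) (standardize Y T w) (x (card S, card T))"

abbreviation koszul_tensor ::
  "('k::field, 'a) bicomodule_data \<Rightarrow> ('k, 'b) bicomodule_data \<Rightarrow> nat \<times> nat \<Rightarrow>
    ('k, (('a \<Rightarrow> 'k) \<times> ('b \<Rightarrow> 'k) \<Rightarrow> 'k) set) module" where
  "koszul_tensor X Y \<equiv> \<lambda>(p, q). tensor (koszul_space X p) (koszul_space Y q)"

context bicomodule_pair
begin

lemma bialternating_standardize:
  assumes cX: "\<And>p q w. \<lbrakk>p + q = n; w \<in> elems Y {1..q}\<rbrakk> \<Longrightarrow> koszul_form X p (\<lambda>z. c p q z w)"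
    and cY: "\<And>p q z. \<lbrakk>p + q = n; z \<in> elems X {1..p}\<rbrakk> \<Longrightarrow> koszul_form Y q (\<lambda>w. c p q z w)"
  shows "bialternating X Y n (\<lambda>S T z w. c (card S) (card T) (standardize X S z) (standardize Y T w))"
  unfolding bialternating_def
proof (intro conjI allI impI; elim conjE)
  fix p T w assume T: "finite T" "p + card T = n" and w: "w \<in> elems Y T"
  have "koszul_form X p (\<lambda>z. c p (card T) z (standardize Y T w))"
    by (rule cX[OF T(2) Lin_closed[OF Y.standardize_linear[OF T(1) refl] w]])
  from X.koszul_form_alternating[OF this]
  show "alternating_family X p (\<lambda>S z. c (card S) (card T) (standardize X S z) (standardize Y T w))"
    by (rule alternating_family_cong) simp
next
  fix q S z assume S: "finite S" "card S + q = n" and z: "z \<in> elems X S"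
  have "koszul_form Y q (\<lambda>w. c (card S) q (standardize X S z) w)"
    by (rule cY[OF S(2) Lin_closed[OF X.standardize_linear[OF S(1) refl] z]])
  from Y.koszul_form_alternating[OF this]
  show "alternating_family Y q (\<lambda>T w. c (card S) (card T) (standardize X S z) (standardize Y T w))"
    by (rule alternating_family_cong) simp
qed

lemma koszul_tensor_component:
  assumes "x \<in> carrier (direct_sum_family {(p, q). p + q = n} (koszul_tensor X Y))" "p + q = n"
  shows "x (p, q) \<in> carrier (tensor (KX p) (KY q))"
  using assms by (auto simp: direct_sum_simps PiE_iff)

lemma eval_family_bialternating:
  assumes x: "x \<in> carrier (direct_sum_family {(p, q). p + q = n} (koszul_tensor X Y))"
  shows "bialternating X Y n (eval_family X Y x)"
  unfolding eval_family_def[abs_def]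
  by (rule bialternating_standardize[where c = "\<lambda>p q z w. tensor_eval (KX p) (KY q) z w (x (p, q))"])
    (rule X.tensor_eval_koszul_form_left[OF Y.koszul_function_space _ koszul_tensor_component[OF x]]
      Y.tensor_eval_koszul_form_right[OF X.koszul_function_space _ koszul_tensor_component[OF x]]; assumption)+

lemma cauchy_permutation_linear:
  "\<sigma> permutes {1..n} \<Longrightarrow> transport XY {1..n} \<sigma> \<in> Lin (space_on XY {1..n}) (space_on XY {1..n})"
  using cauchy_transport_linear[of "{1..n}" \<sigma>] by (simp add: permutes_image permutes_inj_on)

lemma koszul_cauchy_vectorspace: "vectorspace class_ring (KXY n)"
  by (rule koszul_space_vectorspace[OF cauchy_vectorspace cauchy_permutation_linear])

lemma koszul_cauchy_eval:
  "y \<in> elems XY {1..n} \<Longrightarrow> (\<lambda>h. h y) \<in> Lin (KXY n) scalars"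
  by (rule LinI) (simp_all add: koszul_space_simps)

text \<open>Cochains of \<open>X \<cdot> Y\<close> are compared on the elements \<open>z \<otimes> w\<close>;
\<open>koszul_cauchy_LinI\<close> checks linearity of a map into the space of these cochains in the same way.\<close>

lemma koszul_cauchy_ext:
  assumes h: "h \<in> carrier (KXY n)" and h': "h' \<in> carrier (KXY n)"
    and eq: "\<And>S T z w. \<lbrakk>(S, T) \<in> decompositions {1..n}; z \<in> elems X S; w \<in> elems Y T\<rbrakk>
      \<Longrightarrow> h (gen S T z w) = h' (gen S T z w)"
  shows "h = h'"
proof (rule extensionalityI)
  show "h \<in> extensional (elems XY {1..n})" "h' \<in> extensional (elems XY {1..n})"
    using h h' by (simp_all add: koszul_space_carrier)
  have lin: "h \<in> Lin (space_on XY {1..n}) scalars" "h' \<in> Lin (space_on XY {1..n}) scalars"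
    using h h' by (simp_all add: koszul_space_carrier koszul_form_def)
  show "h y = h' y" if "y \<in> elems XY {1..n}" for y
    by (rule cauchy_ext[OF finite_atLeastAtMost scalars_vectorspace lin eq that])
qed

lemma shuffle_pairing_closed:
  assumes b: "bialternating X Y n b"
  shows "restrict (pairing b {1..n}) (elems XY {1..n}) \<in> carrier (KXY n)"
  unfolding koszul_space_carrier
proof
  have "koszul_form XY n (pairing b {1..n})"
    by (rule alternating_koszul_form[OF shuffle_pairing_alternating[OF b]])
  then show "koszul_form XY n (restrict (pairing b {1..n}) (elems XY {1..n}))"
    by (subst koszul_form_cong[OF cauchy_vectorspace cauchy_permutation_linear restrict_apply']) simp_all
qed simp

text \<open>The sum in the definition of the cross product runs over the decompositions of type \<open>(p, q)\<close>. Extending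
the family by zero to the other decompositions makes it a bialternating family.\<close>

lemma cross_pairing:
  assumes f: "f \<in> carrier (KX p)" and g: "g \<in> carrier (KY q)"
  shows cross_closed: "cross X Y p q f g \<in> carrier (KXY (p + q))"
    and cross_gen: "\<lbrakk>(S, T) \<in> decompositions {1..p + q}; z \<in> elems X S; w \<in> elems Y T\<rbrakk> \<Longrightarrow>
      cross X Y p q f g (gen S T z w) = shuffle_sign S T *
        (if card S = p \<and> card T = q then f (standardize X S z) * g (standardize Y T w) else 0)"
proof -
  define c where "c p' q' z w = (if p' = p \<and> q' = q then f z * g w else 0)" for p' q' z w
  define b where "b S T z w = c (card S) (card T) (standardize X S z) (standardize Y T w)" for S T z w
  have fg: "koszul_form X p f" "koszul_form Y q g" using f g by (simp_all add: koszul_space_carrier)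
  have b: "bialternating X Y (p + q) b"
    unfolding b_def
  proof (rule bialternating_standardize)
    fix p' q' w
    have "koszul_form X p' (\<lambda>z. 0)" by (auto simp: koszul_form_def intro!: LinI)
    moreover have "koszul_form X p (\<lambda>z. f z * g w)"
      using fg(1) by (auto simp: koszul_form_def LinD algebra_simps intro!: LinI)
    moreover have "(\<lambda>z. c p' q' z w) = (if p' = p \<and> q' = q then \<lambda>z. f z * g w else (\<lambda>z. 0))"
      by (auto simp: c_def fun_eq_iff)
    ultimately show "koszul_form X p' (\<lambda>z. c p' q' z w)" by simp
  next
    fix p' q' z
    have "koszul_form Y q' (\<lambda>z. 0)" by (auto simp: koszul_form_def intro!: LinI)
    moreover have "koszul_form Y q (\<lambda>w. f z * g w)"
      using fg(2) by (auto simp: koszul_form_def LinD algebra_simps intro!: LinI)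
    moreover have "(\<lambda>w. c p' q' z w) = (if p' = p \<and> q' = q then \<lambda>w. f z * g w else (\<lambda>w. 0))"
      by (auto simp: c_def fun_eq_iff)
    ultimately show "koszul_form Y q' (\<lambda>w. c p' q' z w)" by simp
  qed
  let ?n = "p + q" and ?C = "elems XY {1..p + q}"
  let ?D = "{(S, T) \<in> decompositions {1..p + q}. card S = p \<and> card T = q}"
  have "cross X Y p q f g = restrict (pairing b {1..?n}) ?C"
    unfolding cross_def
  proof (rule restrict_ext)
    fix y assume y: "y \<in> ?C"
    let ?l = "\<lambda>(S, T). tensor_lift (space_on X S) (space_on Y T) scalars
       (\<lambda>z w. shuffle_sign S T * b S T z w) (y (S, T))"
    have "(\<Sum>(S, T)\<in>?D. tensor_lift (space_on X S) (space_on Y T) scalars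
         (\<lambda>z w. (- 1) ^ sch S T * f (standardize X S z) * g (standardize Y T w)) (y (S, T))) = sum ?l ?D"
    proof (rule sum.cong[OF refl])
      fix k assume k: "k \<in> ?D"
      obtain S T where ST: "k = (S, T)" by force
      then have d: "(S, T) \<in> decompositions {1..p + q}" and card: "card S = p" "card T = q" using k by auto
      have fin: "finite S" "finite T" using decompositionsD(5,6)[OF d] by simp_all
      have "(\<lambda>z w. (- 1) ^ sch S T * f (standardize X S z) * g (standardize Y T w)) =
          (\<lambda>z w. shuffle_sign S T * b S T z w)"
        by (simp add: b_def c_def card shuffle_sign_sch[OF fin] mult.assoc)
      then show "(case k of (S, T) \<Rightarrow> tensor_lift (space_on X S) (space_on Y T) scalars
         (\<lambda>z w. (- 1) ^ sch S T * f (standardize X S z) * g (standardize Y T w)) (y (S, T))) = ?l k"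
        unfolding ST prod.case by simp
    qed
    also have "sum ?l ?D = sum ?l (decompositions {1..?n})"
    proof (rule sum.mono_neutral_left[OF finite_decompositions[OF finite_atLeastAtMost]])
      show "\<forall>k\<in>decompositions {1..?n} - ?D. ?l k = 0"
      proof
        fix k assume k: "k \<in> decompositions {1..?n} - ?D"
        obtain S T where ST: "k = (S, T)" by force
        then have d: "(S, T) \<in> decompositions {1..p + q}" and card: "\<not> (card S = p \<and> card T = q)" using k by auto
        have fin: "finite S" "finite T" using decompositionsD(5,6)[OF d] by simp_all
        have b0: "b S T z w = 0" for z w unfolding b_def c_def by (rule if_not_P[OF card])
        have "y (S, T) \<in> carrier (tensor (space_on X S) (space_on Y T))"
          by (rule Lin_closed[OF cauchy_component_linear[OF d] y])
        from tensor_ext[OF X.space[OF fin(1)] Y.space[OF fin(2)] scalars_vectorspace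
            tensor_lift_linear[OF X.space[OF fin(1)] Y.space[OF fin(2)] scalars_vectorspace
              bialternating_bilinear[OF b finite_atLeastAtMost _ d]] Lin_zero_map[OF scalars_vectorspace] _ this]
        show "?l k = 0"
          using tensor_lift_pure[OF X.space[OF fin(1)] Y.space[OF fin(2)] scalars_vectorspace
              bialternating_bilinear[OF b finite_atLeastAtMost _ d]]
          unfolding ST prod.case by (simp add: b0)
      qed
    qed auto
    finally show "(\<Sum>(S, T)\<in>?D. tensor_lift (space_on X S) (space_on Y T) scalars
         (\<lambda>z w. (- 1) ^ sch S T * f (standardize X S z) * g (standardize Y T w)) (y (S, T))) =
        pairing b {1..?n} y"
      by (simp only: shuffle_pairing_def)
  qed
  note eq = this
  show "cross X Y p q f g \<in> carrier (KXY (p + q))"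
    unfolding eq by (rule shuffle_pairing_closed[OF b])
  show "cross X Y p q f g (gen S T z w) = shuffle_sign S T *
        (if card S = p \<and> card T = q then f (standardize X S z) * g (standardize Y T w) else 0)"
    if ST: "(S, T) \<in> decompositions {1..p + q}" and z: "z \<in> elems X S" and w: "w \<in> elems Y T"
    unfolding eq restrict_apply'[OF cauchy_gen_closed[OF ST z w]]
      shuffle_pairing_gen[OF b finite_atLeastAtMost _ ST z w, simplified]
    by (simp add: b_def c_def)
qed

end

section \<open>The Kuenneth map\<close>

context bicomodule_pair
begin

abbreviation "source_space n \<equiv> direct_sum_family {(p, q). p + q = n} (koszul_tensor X Y)"

lemma koszul_cauchy_LinI:
  assumes V: "vectorspace class_ring V"
    and F: "\<And>v. v \<in> carrier V \<Longrightarrow> F v \<in> carrier (KXY n)"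
    and gen: "\<And>S T z w. \<lbrakk>(S, T) \<in> decompositions {1..n}; z \<in> elems X S; w \<in> elems Y T\<rbrakk>
      \<Longrightarrow> (\<lambda>v. F v (gen S T z w)) \<in> Lin V scalars"
  shows "F \<in> Lin V (KXY n)"
proof (rule LinI)
  note clV = vectorspace_closed[OF V] and clK = vectorspace_closed[OF koszul_cauchy_vectorspace]
  note evl = LinD[OF koszul_cauchy_eval[OF cauchy_gen_closed]]
  fix u v c assume u: "u \<in> carrier V"
  show "F u \<in> carrier (KXY n)" by (rule F[OF u])
  show "F (c \<odot>\<^bsub>V\<^esub> u) = c \<odot>\<^bsub>KXY n\<^esub> F u"
  proof (rule koszul_cauchy_ext[OF F[OF clV(3)[OF u]] clK(3)[OF F[OF u]]])
    fix S T z w assume *: "(S, T) \<in> decompositions {1..n}" "z \<in> elems X S" "w \<in> elems Y T"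
    show "F (c \<odot>\<^bsub>V\<^esub> u) (gen S T z w) = (c \<odot>\<^bsub>KXY n\<^esub> F u) (gen S T z w)"
      unfolding evl(3)[OF * F[OF u]] Lin_smult[OF gen[OF *] u] ..
  qed
  assume v: "v \<in> carrier V"
  show "F (u \<oplus>\<^bsub>V\<^esub> v) = F u \<oplus>\<^bsub>KXY n\<^esub> F v"
  proof (rule koszul_cauchy_ext[OF F[OF clV(2)[OF u v]] clK(2)[OF F[OF u] F[OF v]]])
    fix S T z w assume *: "(S, T) \<in> decompositions {1..n}" "z \<in> elems X S" "w \<in> elems Y T"
    show "F (u \<oplus>\<^bsub>V\<^esub> v) (gen S T z w) = (F u \<oplus>\<^bsub>KXY n\<^esub> F v) (gen S T z w)"
      unfolding evl(2)[OF * F[OF u] F[OF v]] Lin_add[OF gen[OF *] u v] ..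
  qed
qed

lemma standardize_closed:
  assumes "(S, T) \<in> decompositions {1..n}"
  shows "z \<in> elems X S \<Longrightarrow> standardize X S z \<in> elems X {1..card S}"
    and "w \<in> elems Y T \<Longrightarrow> standardize Y T w \<in> elems Y {1..card T}"
  using decompositionsD(5,6)[OF assms]
  by (auto intro: Lin_closed[OF X.standardize_linear] Lin_closed[OF Y.standardize_linear])

lemma cross_bilinear:
  assumes pq: "p + q = n"
  shows "cross X Y p q \<in> bilinear_maps (KX p) (KY q) (KXY n)"
proof (rule bilinear_mapsI; rule koszul_cauchy_LinI[OF Y.koszul_vectorspace] koszul_cauchy_LinI[OF X.koszul_vectorspace])
  note closed = cross_closed[of _ p _ q, unfolded pq] and val = cross_gen[of _ p _ q, unfolded pq]
  fix f g S T z w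
  show "f \<in> carrier (KX p) \<Longrightarrow> g \<in> carrier (KY q) \<Longrightarrow> cross X Y p q f g \<in> carrier (KXY n)"
    and "g \<in> carrier (KY q) \<Longrightarrow> f \<in> carrier (KX p) \<Longrightarrow> cross X Y p q f g \<in> carrier (KXY n)"
    by (rule closed; assumption)+
  assume *: "(S, T) \<in> decompositions {1..n}" "z \<in> elems X S" "w \<in> elems Y T"
  let ?P = "card S = p \<and> card T = q"
  note st = standardize_closed[OF *(1)]
  show "(\<lambda>g. cross X Y p q f g (gen S T z w)) \<in> Lin (KY q) scalars" if f: "f \<in> carrier (KX p)"
  proof (subst Lin_cong[OF Y.koszul_vectorspace val[OF f _ *]])
    show "(\<lambda>g. shuffle_sign S T * (if ?P then f (standardize X S z) * g (standardize Y T w) else 0)) \<in> Lin (KY q) scalars"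
      using st(2)[OF *(3)] by (cases ?P) (auto intro!: Lin_scalars_mult LinI simp: koszul_space_simps)
  qed
  show "(\<lambda>f. cross X Y p q f g (gen S T z w)) \<in> Lin (KX p) scalars" if g: "g \<in> carrier (KY q)"
  proof (subst Lin_cong[OF X.koszul_vectorspace val[OF _ g *]])
    show "(\<lambda>f. shuffle_sign S T * (if ?P then f (standardize X S z) * g (standardize Y T w) else 0)) \<in> Lin (KX p) scalars"
      using st(1)[OF *(2)] by (cases ?P) (auto intro!: Lin_scalars_mult LinI simp: koszul_space_simps algebra_simps)
  qed
qed

lemma finite_degrees: "finite {(p, q). p + q = (n::nat)}"
  by (rule finite_subset[of _ "{..n} \<times> {..n}"]) auto

lemma cross_lift:
  assumes pq: "p + q = n"
  shows cross_lift_linear: "tensor_lift (KX p) (KY q) (KXY n) (cross X Y p q) \<in>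
      Lin (tensor (KX p) (KY q)) (KXY n)"
    and cross_lift_gen: "\<lbrakk>t \<in> carrier (tensor (KX p) (KY q));
      (S, T) \<in> decompositions {1..n}; z \<in> elems X S; w \<in> elems Y T\<rbrakk> \<Longrightarrow>
      tensor_lift (KX p) (KY q) (KXY n) (cross X Y p q) t (gen S T z w) =
      (if card S = p \<and> card T = q then shuffle_sign S T *
         tensor_eval (KX p) (KY q) (standardize X S z) (standardize Y T w) t else 0)"
proof -
  let ?L = "tensor_lift (KX p) (KY q) (KXY n) (cross X Y p q)"
  note vs = X.koszul_vectorspace[of p] Y.koszul_vectorspace[of q]
  note L = tensor_lift[OF vs koszul_cauchy_vectorspace cross_bilinear[OF pq]]
  show "?L \<in> Lin (tensor (KX p) (KY q)) (KXY n)" by (rule L)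
  fix t S T z w assume t: "t \<in> carrier (tensor (KX p) (KY q))"
    and *: "(S, T) \<in> decompositions {1..n}" "z \<in> elems X S" "w \<in> elems Y T"
  have fin: "finite S" "finite T" using decompositionsD(5,6)[OF *(1)] by simp_all
  have st: "standardize X S z \<in> elems X {1..card S}" "standardize Y T w \<in> elems Y {1..card T}"
    by (rule Lin_closed[OF X.standardize_linear[OF fin(1) refl] *(2)]
        Lin_closed[OF Y.standardize_linear[OF fin(2) refl] *(3)])+
  note evL = Lin_comp[OF L(1) koszul_cauchy_eval[OF cauchy_gen_closed[OF *]]]
  show "?L t (gen S T z w) = (if card S = p \<and> card T = q then shuffle_sign S T *
         tensor_eval (KX p) (KY q) (standardize X S z) (standardize Y T w) t else 0)"
  proof (cases "card S = p \<and> card T = q")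
    case True
    then have st': "standardize X S z \<in> elems X {1..p}" "standardize Y T w \<in> elems Y {1..q}"
      using st by simp_all
    note ev = tensor_eval[OF X.koszul_function_space Y.koszul_function_space st']
    have "?L t (gen S T z w) = shuffle_sign S T *
         tensor_eval (KX p) (KY q) (standardize X S z) (standardize Y T w) t"
      by (rule tensor_ext[OF vs scalars_vectorspace evL Lin_scalars_mult[OF ev(1)] _ t])
        (simp add: L(2) ev(2) cross_gen[of _ p _ q, unfolded pq] * True)
    then show ?thesis using True by simp
  next
    case False
    have "?L t (gen S T z w) = \<zero>\<^bsub>scalars\<^esub>"
    proof (rule tensor_ext[OF vs scalars_vectorspace evL Lin_zero_map[OF scalars_vectorspace] _ t])
      fix f g assume fg: "f \<in> carrier (KX p)" "g \<in> carrier (KY q)"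
      show "?L (pure_tensor (KX p) (KY q) f g) (gen S T z w) = \<zero>\<^bsub>scalars\<^esub>"
        unfolding L(2)[OF fg] cross_gen[OF fg, unfolded pq, OF *] if_not_P[OF False] by simp
    qed
    then show ?thesis unfolding if_not_P[OF False] by simp
  qed
qed

lemma kuenneth_map_linear: "kuenneth_map X Y n \<in> Lin (source_space n) (KXY n)"
  unfolding kuenneth_map_def[abs_def]
proof (rule Lin_finsum_map[OF koszul_cauchy_vectorspace])
  fix k assume k: "k \<in> {(p, q). p + q = n}"
  obtain p q where pq: "k = (p, q)" by force
  have comp: "(\<lambda>x. x (p, q)) \<in> Lin (source_space n) (tensor (KX p) (KY q))"
    using component_linear[of "{(p, q). p + q = n}" "koszul_tensor X Y" "(p, q)"] k pq
    by (simp add: tensor_vectorspace split_def)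
  show "(\<lambda>x. case k of (p, q) \<Rightarrow> tensor_lift (KX p) (KY q) (KXY n)
      (cross X Y p q) (x (p, q))) \<in> Lin (source_space n) (KXY n)"
    unfolding pq prod.case by (rule Lin_comp[OF comp cross_lift_linear]) (use k pq in simp)
qed

text \<open>Of all bidegrees, only \<open>(card S, card T)\<close> contributes on the summand \<open>(S, T)\<close>.\<close>

lemma kuenneth_map_gen:
  assumes x: "x \<in> carrier (source_space n)"
    and *: "(S, T) \<in> decompositions {1..n}" "z \<in> elems X S" "w \<in> elems Y T"
  shows "kuenneth_map X Y n x (gen S T z w) = shuffle_sign S T * eval_family X Y x S T z w"
proof -
  let ?g = "gen S T z w" and ?J = "{(p, q). p + q = n}"
  let ?L = "\<lambda>(p, q). tensor_lift (KX p) (KY q) (KXY n) (cross X Y p q) (x (p, q))"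
  have card: "card S + card T = n" using decompositionsD(7)[OF *(1)] by simp
  have cl: "?L k \<in> carrier (KXY n)" if "k \<in> ?J" for k
  proof -
    obtain p q where k: "k = (p, q)" by force
    then have pq: "p + q = n" using that by simp
    show ?thesis unfolding k prod.case
      by (rule Lin_closed[OF cross_lift_linear[OF pq] koszul_tensor_component[OF x pq]])
  qed
  have "kuenneth_map X Y n x ?g = finsum scalars (\<lambda>k. ?L k ?g) ?J"
    unfolding kuenneth_map_def
    by (rule Lin_finsum[OF koszul_cauchy_vectorspace scalars_vectorspace
          koszul_cauchy_eval[OF cauchy_gen_closed[OF *]] cl finite_degrees])
  also have "\<dots> = (\<Sum>k\<in>?J. ?L k ?g)" by (rule finsum_scalars[OF finite_degrees])
  also have "\<dots> = (\<Sum>k\<in>?J. if k = (card S, card T) then shuffle_sign S T * eval_family X Y x S T z w else 0)"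
  proof (rule sum.cong[OF refl])
    fix k assume "k \<in> ?J"
    moreover obtain p q where k: "k = (p, q)" by force
    ultimately have pq: "p + q = n" by simp
    show "?L k ?g = (if k = (card S, card T) then shuffle_sign S T * eval_family X Y x S T z w else 0)"
      unfolding k prod.case cross_lift_gen[OF pq koszul_tensor_component[OF x pq] *]
      by (auto simp: eval_family_def)
  qed
  also have "\<dots> = shuffle_sign S T * eval_family X Y x S T z w"
    using card by (simp add: finite_degrees)
  finally show ?thesis .
qed

lemma kuenneth_map_pairing:
  assumes x: "x \<in> carrier (source_space n)" and y: "y \<in> elems XY {1..n}"
  shows "kuenneth_map X Y n x y = pairing (eval_family X Y x) {1..n} y"
proof -
  note b = eval_family_bialternating[OF x]
  have "kuenneth_map X Y n x \<in> Lin (space_on XY {1..n}) scalars"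
    using Lin_closed[OF kuenneth_map_linear x] by (simp add: koszul_space_carrier koszul_form_def)
  from cauchy_ext[OF finite_atLeastAtMost scalars_vectorspace this shuffle_pairing_linear[OF b finite_atLeastAtMost] _ y]
  show ?thesis
    by (simp add: kuenneth_map_gen[OF x] shuffle_pairing_gen[OF b])
qed

section \<open>Bijectivity\<close>

text \<open>Transports \<open>Y[q]\<close> to the second block \<open>{p + 1..p + q}\<close> of \<open>{1..p + q}\<close>. On the summand of the two blocks
all signs are trivial.\<close>

abbreviation shift_up :: "nat \<Rightarrow> nat \<Rightarrow> 'b \<Rightarrow> 'b" where
  "shift_up p q \<equiv> transport Y {1..q} (\<lambda>i. p + i)"

lemma shift_image: "(\<lambda>i. p + i) ` {1..q} = {p + 1..p + (q::nat)}"
  by (auto simp: image_add_atLeastAtMost)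

lemma block_decomposition: "({1..p}, {p + 1..p + q}) \<in> decompositions {1..p + q}"
  by (auto simp: decompositions_def)

lemma shift_up_linear: "shift_up p q \<in> Lin (space_on Y {1..q}) (space_on Y {p + 1..p + q})"
  using Y.transport_linear[of "{1..q}" "\<lambda>i. p + i"] unfolding shift_image by simp

lemma standardize_shift_up:
  assumes w: "w \<in> elems Y {1..q}"
  shows "standardize Y {p + 1..p + q} (shift_up p q w) = w"
proof -
  have inj: "inj_on (\<lambda>i. p + i) {1..q}" by simp
  have rk: "rank_in {p + 1..p + q} (p + i) = i" if "i \<in> {1..q}" for i
  proof -
    have "{y \<in> {p + 1..p + q}. y \<le> p + i} = {p + 1..p + i}" using that by auto
    then show ?thesis by (simp add: rank_in_def)
  qed
  have "standardize Y {p + 1..p + q} (shift_up p q w) = transport Y {1..q} (rank_in {p + 1..p + q} \<circ> (\<lambda>i. p + i)) w"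
    using Y.transport_comp[OF finite_atLeastAtMost inj _ w, of "rank_in {p + 1..p + q}"]
    unfolding shift_image by (simp add: rank_in_inj)
  also have "\<dots> = transport Y {1..q} id w"
    by (rule Y.transport_cong[OF finite_atLeastAtMost _ _ w]) (auto simp: inj_on_def rk)
  finally show ?thesis using Y.transport_id[OF finite_atLeastAtMost w] by simp
qed

text \<open>The values of \<open>x\<close> in bidegree \<open>(p, q)\<close> can be read off from its image on the two-block summand. This
yields injectivity.\<close>

lemma kuenneth_map_block:
  assumes x: "x \<in> carrier (source_space n)" and pq: "p + q = n"
    and z: "z \<in> elems X {1..p}" and w: "w \<in> elems Y {1..q}"
  shows "kuenneth_map X Y n x (gen {1..p} {p + 1..p + q} z (shift_up p q w)) =
    tensor_eval (KX p) (KY q) z w (x (p, q))"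
proof -
  have bd: "({1..p}, {p + 1..p + q}) \<in> decompositions {1..n}"
    using block_decomposition[of p q] pq by simp
  have "shuffle_sign {1..p} {p + 1..p + q} = (1 :: 'k)"
    by (rule shuffle_sign_sorted) auto
  moreover have "eval_family X Y x {1..p} {p + 1..p + q} z (shift_up p q w) =
      tensor_eval (KX p) (KY q) z w (x (p, q))"
    by (simp add: eval_family_def X.standardize_upto[OF z] standardize_shift_up[OF w, of p, simplified])
  ultimately show ?thesis
    using kuenneth_map_gen[OF x bd z Lin_closed[OF shift_up_linear w]] by (simp only: mult_1)
qed

lemma kuenneth_map_inj:
  assumes fin: "locally_finite X \<or> locally_finite Y"
  shows "inj_on (kuenneth_map X Y n) (carrier (source_space n))"
proof (rule inj_onI)
  fix x x' assume x: "x \<in> carrier (source_space n)" and x': "x' \<in> carrier (source_space n)"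
    and eq: "kuenneth_map X Y n x = kuenneth_map X Y n x'"
  have ext: "x \<in> extensional {(p, q). p + q = n}" "x' \<in> extensional {(p, q). p + q = n}"
    using x x' by (auto simp: direct_sum_simps PiE_iff)
  show "x = x'"
  proof (rule extensionalityI[OF ext])
    fix k :: "nat \<times> nat" assume "k \<in> {(p, q). p + q = n}"
    moreover obtain p q where k: "k = (p, q)" by force
    ultimately have pq: "p + q = n" by simp
    have dual: "(\<exists>Z b. dual_system (elems X {1..p}) (KX p) Z b) \<or>
        (\<exists>Z b. dual_system (elems Y {1..q}) (KY q) Z b)"
      using fin X.locally_finite_dual_system Y.locally_finite_dual_system by blast
    show "x k = x' k"
      unfolding k
    proof (rule tensor_eval_inj[OF X.koszul_function_space Y.koszul_function_space dual
          koszul_tensor_component[OF x pq] koszul_tensor_component[OF x' pq]])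
      fix z w assume zw: "z \<in> elems X {1..p}" "w \<in> elems Y {1..q}"
      show "tensor_eval (KX p) (KY q) z w (x (p, q)) =
          tensor_eval (KX p) (KY q) z w (x' (p, q))"
        unfolding kuenneth_map_block[OF x pq zw, symmetric] kuenneth_map_block[OF x' pq zw, symmetric] eq ..
    qed
  qed
qed

end

context bicomodule_pair
begin

text \<open>A permutation of the first block acts on \<open>{1..p + q}\<close> with the same sign and leaves the second factor
alone.\<close>

lemma block_form_left:
  assumes h: "h \<in> carrier (KXY (p + q))" and w: "w \<in> elems Y {p + 1..p + q}"
  shows "koszul_form X p (\<lambda>z. h (gen {1..p} {p + 1..p + q} z w))"
  unfolding koszul_form_def
proof (intro conjI allI impI ballI)
  let ?T = "{p + 1..p + q}"
  have hform: "h \<in> Lin (space_on XY {1..p + q}) scalars"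
    using h by (simp add: koszul_space_carrier koszul_form_def)
  show "(\<lambda>z. h (gen {1..p} ?T z w)) \<in> Lin (space_on X {1..p}) scalars"
    by (rule Lin_comp[OF bilinear_mapsD(2)[OF cauchy_gen_bilinear[OF block_decomposition] w] hform])
  fix \<sigma> z assume \<sigma>: "\<sigma> permutes {1..p}" and z: "z \<in> elems X {1..p}"
  have \<sigma>': "\<sigma> permutes {1..p + q}" by (rule permutes_subset[OF \<sigma>]) auto
  have fix_T: "\<sigma> i = i" if "i \<in> ?T" for i using permutes_not_in[OF \<sigma>, of i] that by auto
  have im: "\<sigma> ` {1..p} = {1..p}" "\<sigma> ` ?T = ?T"
    using permutes_image[OF \<sigma>] fix_T by (auto simp: image_iff)
  have inj: "inj_on \<sigma> A" for A using permutes_inj_on[OF \<sigma>] .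
  have "transport Y ?T \<sigma> w = transport Y ?T id w"
    by (rule Y.transport_cong[OF finite_atLeastAtMost inj _ w]) (simp add: fix_T)
  then have w': "transport Y ?T \<sigma> w = w" using Y.transport_id[OF finite_atLeastAtMost w] by simp
  have "h (transport XY {1..p + q} \<sigma> (gen {1..p} ?T z w)) =
      of_int (sign \<sigma>) * h (gen {1..p} ?T z w)"
    using h \<sigma>' cauchy_gen_closed[OF block_decomposition z w] unfolding koszul_space_carrier koszul_form_def by blast
  then show "h (gen {1..p} ?T (transport X {1..p} \<sigma> z) w) =
      of_int (sign \<sigma>) * h (gen {1..p} ?T z w)"
    unfolding cauchy_transport_gen[OF finite_atLeastAtMost inj block_decomposition z w] im w' .
qed

text \<open>A permutation of \<open>{1..q}\<close> is conjugated by the shift to a permutation of the second block, which has the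
same sign and leaves the first factor alone.\<close>

lemma block_form_right:
  assumes h: "h \<in> carrier (KXY (p + q))" and z: "z \<in> elems X {1..p}"
  shows "koszul_form Y q (\<lambda>w. h (gen {1..p} {p + 1..p + q} z (shift_up p q w)))"
  unfolding koszul_form_def
proof (intro conjI allI impI ballI)
  let ?T = "{p + 1..p + q}" and ?s = "\<lambda>i. p + i"
  have hform: "h \<in> Lin (space_on XY {1..p + q}) scalars"
    using h by (simp add: koszul_space_carrier koszul_form_def)
  show "(\<lambda>w. h (gen {1..p} ?T z (shift_up p q w))) \<in> Lin (space_on Y {1..q}) scalars"
    by (rule Lin_comp[OF shift_up_linear Lin_comp[OF bilinear_mapsD(1)[OF cauchy_gen_bilinear[OF block_decomposition] z] hform]])
  fix \<tau> w assume \<tau>: "\<tau> permutes {1..q}" and w: "w \<in> elems Y {1..q}"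
  define \<sigma> where "\<sigma> = map_permutation {1..q} ?s \<tau>"
  have s: "inj_on ?s A" for A by simp
  have "bij_betw ?s {1..q} ?T" unfolding bij_betw_def using shift_image by auto
  then have \<sigma>: "\<sigma> permutes ?T" unfolding \<sigma>_def by (rule map_permutation_permutes[OF _ \<tau>])
  have sgn: "sign \<sigma> = sign \<tau>" unfolding \<sigma>_def by (rule sign_map_permutation[OF s \<tau> finite_atLeastAtMost])
  have \<sigma>': "\<sigma> permutes {1..p + q}" by (rule permutes_subset[OF \<sigma>]) auto
  have \<sigma>_s: "\<sigma> (p + i) = p + \<tau> i" if "i \<in> {1..q}" for i
    unfolding \<sigma>_def by (rule map_permutation_apply[OF s that])
  have fix_S: "\<sigma> i = i" if "i \<in> {1..p}" for i using permutes_not_in[OF \<sigma>, of i] that by auto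
  have im: "\<sigma> ` {1..p} = {1..p}" "\<sigma> ` ?T = ?T"
    using permutes_image[OF \<sigma>] fix_S by (auto simp: image_iff)
  have inj: "inj_on \<sigma> A" for A using permutes_inj_on[OF \<sigma>] .
  have \<tau>inj: "inj_on \<tau> A" for A using permutes_inj_on[OF \<tau>] .
  have "transport X {1..p} \<sigma> z = transport X {1..p} id z"
    by (rule X.transport_cong[OF finite_atLeastAtMost inj _ z]) (simp add: fix_S)
  then have z': "transport X {1..p} \<sigma> z = z" using X.transport_id[OF finite_atLeastAtMost z] by simp
  have "transport Y ?T \<sigma> (shift_up p q w) = transport Y {1..q} (\<sigma> \<circ> ?s) w"
    using Y.transport_comp[OF finite_atLeastAtMost s inj w] unfolding shift_image by simp
  also have "\<dots> = transport Y {1..q} (?s \<circ> \<tau>) w"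
    by (rule Y.transport_cong[OF finite_atLeastAtMost comp_inj_on[OF s inj] _ w]) (simp add: \<sigma>_s)
  also have "\<dots> = shift_up p q (transport Y {1..q} \<tau> w)"
    using Y.transport_comp[OF finite_atLeastAtMost \<tau>inj s w] unfolding permutes_image[OF \<tau>] by simp
  finally have w': "transport Y ?T \<sigma> (shift_up p q w) = shift_up p q (transport Y {1..q} \<tau> w)" .
  note sw = Lin_closed[OF shift_up_linear w]
  have "h (transport XY {1..p + q} \<sigma> (gen {1..p} ?T z (shift_up p q w))) =
      of_int (sign \<sigma>) * h (gen {1..p} ?T z (shift_up p q w))"
    using h \<sigma>' cauchy_gen_closed[OF block_decomposition z sw] unfolding koszul_space_carrier koszul_form_def by blast
  then show "h (gen {1..p} ?T z (shift_up p q (transport Y {1..q} \<tau> w))) =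
      of_int (sign \<tau>) * h (gen {1..p} ?T z (shift_up p q w))"
    unfolding cauchy_transport_gen[OF finite_atLeastAtMost inj block_decomposition z sw] im w' z' sgn .
qed

text \<open>Apply equivariance to the permutation \<open>\<sigma>\<close> that maps \<open>S\<close> to the first and \<open>T\<close> to the second block and
is increasing on both. By \<open>inversion_sign_Un\<close> its sign is the shuffle sign of \<open>(S, T)\<close>, all other factors
being \<open>1\<close>.\<close>

lemma koszul_cauchy_shuffle:
  assumes h: "h \<in> carrier (KXY n)" and ST: "(S, T) \<in> decompositions {1..n}"
    and pq: "card S = p" "card T = q"
    and z: "z \<in> elems X S" and w: "w \<in> elems Y T"
  shows "h (gen S T z w) = shuffle_sign S T *
    h (gen {1..p} {p + 1..p + q} (standardize X S z) (shift_up p q (standardize Y T w)))"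
proof -
  note d = decompositionsD[OF ST]
  have fin: "finite S" "finite T" and n: "p + q = n" using d(5-7) pq by auto
  define \<sigma> where "\<sigma> i = (if i \<in> S then rank_in S i else if i \<in> T then p + rank_in T i else i)" for i
  have \<sigma>S: "\<sigma> i = rank_in S i" if "i \<in> S" for i using that by (simp add: \<sigma>_def)
  have \<sigma>T: "\<sigma> i = p + rank_in T i" if "i \<in> T" for i using that d(2) by (auto simp: \<sigma>_def)
  have imS: "\<sigma> ` S = {1..p}"
    using finite_card_rank_image[OF fin(1)] pq \<sigma>S by (simp cong: image_cong)
  have "\<sigma> ` T = (\<lambda>i. p + i) ` rank_in T ` T" using \<sigma>T by (auto simp: image_iff)
  then have imT: "\<sigma> ` T = {p + 1..p + q}"
    unfolding finite_card_rank_image[OF fin(2)] pq shift_image .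
  have mono: "strict_mono_on S \<sigma>" "strict_mono_on T \<sigma>"
    using rank_in_strict_mono[OF fin(1)] rank_in_strict_mono[OF fin(2)] \<sigma>S \<sigma>T
    by (auto simp: strict_mono_on_def)
  have bij: "bij_betw \<sigma> (S \<union> T) ({1..p} \<union> {p + 1..p + q})"
  proof (rule bij_betw_combine)
    show "bij_betw \<sigma> S {1..p}" "bij_betw \<sigma> T {p + 1..p + q}"
      using imS imT mono[THEN strict_mono_on_imp_inj_on] by (auto simp: bij_betw_def)
  qed auto
  have un: "{1..p} \<union> {p + 1..p + q} = {1..n}" using n by auto
  have \<sigma>: "\<sigma> permutes {1..n}"
    using bij d(1) unfolding un by (intro bij_imp_permutes) (auto simp: \<sigma>_def)
  have inj: "inj_on \<sigma> A" for A using permutes_inj_on[OF \<sigma>] .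
  have z': "transport X S \<sigma> z = standardize X S z"
    by (rule X.transport_cong[OF fin(1) inj \<sigma>S z])
  have "transport Y T \<sigma> w = transport Y T ((\<lambda>i. p + i) \<circ> rank_in T) w"
    by (rule Y.transport_cong[OF fin(2) inj _ w]) (simp add: \<sigma>T)
  also have "\<dots> = shift_up p q (standardize Y T w)"
    using Y.transport_comp[OF fin(2) rank_in_inj[OF fin(2)] _ w, of "\<lambda>i. p + i"]
    unfolding finite_card_rank_image[OF fin(2)] pq by simp
  finally have w': "transport Y T \<sigma> w = shift_up p q (standardize Y T w)" .
  have "shuffle_sign {1..p} {p + 1..p + q} = (1 :: 'k)"
    by (rule shuffle_sign_sorted) auto
  then have "inversion_sign \<sigma> {1..n} * shuffle_sign S T = (1 :: 'k)"
    using inversion_sign_Un[OF fin d(2) inj, where ?'k = 'k]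
    unfolding imS imT d(1)[symmetric] inversion_sign_strict_mono[OF mono(1)] inversion_sign_strict_mono[OF mono(2)]
    by simp
  then have sgn: "shuffle_sign S T * (inversion_sign \<sigma> {1..n} :: 'k) = 1" by (simp only: mult.commute)
  have "h (transport XY {1..n} \<sigma> (gen S T z w)) = of_int (sign \<sigma>) * h (gen S T z w)"
    using h \<sigma> cauchy_gen_closed[OF ST z w] unfolding koszul_space_carrier koszul_form_def by blast
  then have "h (gen {1..p} {p + 1..p + q} (standardize X S z) (shift_up p q (standardize Y T w))) =
      inversion_sign \<sigma> {1..n} * h (gen S T z w)"
    unfolding cauchy_transport_gen[OF finite_atLeastAtMost inj ST z w] imS imT z' w'
      sign_eq_inversion_sign[OF \<sigma> finite_atLeastAtMost] .
  then show ?thesis by (simp only: mult.assoc[symmetric] sgn mult_1)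
qed

text \<open>The restriction of \<open>h\<close> to the two-block summands is a bilinear form for each \<open>(p, q)\<close>, hence the evaluation
of a tensor. These tensors form a preimage, since \<open>h\<close> is determined by these restrictions.\<close>

lemma kuenneth_map_surj:
  assumes fin: "locally_finite X \<or> locally_finite Y" and h: "h \<in> carrier (KXY n)"
  shows "\<exists>x\<in>carrier (source_space n). kuenneth_map X Y n x = h"
proof -
  define c where "c p q z w = h (gen {1..p} {p + 1..p + q} z (shift_up p q w))" for p q z w
  let ?J = "{(p, q). p + q = n}"
  have ex: "\<exists>t\<in>carrier (tensor (KX p) (KY q)).
      \<forall>z\<in>elems X {1..p}. \<forall>w\<in>elems Y {1..q}.
        tensor_eval (KX p) (KY q) z w t = c p q z w" if pq: "p + q = n" for p q
  proof (rule tensor_eval_surj[OF X.koszul_function_space Y.koszul_function_space])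
    show "(\<exists>Z b. dual_system (elems X {1..p}) (KX p) Z b) \<or>
        (\<exists>Z b. dual_system (elems Y {1..q}) (KY q) Z b)"
      using fin X.locally_finite_dual_system Y.locally_finite_dual_system by blast
    note h' = h[folded pq]
    show "restrict (c p q z) (elems Y {1..q}) \<in> carrier (KY q)"
      if "z \<in> elems X {1..p}" for z
      unfolding koszul_space_carrier Y.koszul_form_restrict c_def
      using block_form_right[OF h' that] by simp
    show "(\<lambda>z\<in>elems X {1..p}. c p q z w) \<in> carrier (KX p)"
      if "w \<in> elems Y {1..q}" for w
      unfolding koszul_space_carrier X.koszul_form_restrict c_def
      using block_form_left[OF h' Lin_closed[OF shift_up_linear that]] by simp
  qed
  have "\<forall>k\<in>?J. \<exists>t. t \<in> carrier (koszul_tensor X Y k) \<and>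
      (\<forall>z\<in>elems X {1..fst k}. \<forall>w\<in>elems Y {1..snd k}.
        tensor_eval (KX (fst k)) (KY (snd k)) z w t = c (fst k) (snd k) z w)"
  proof clarify
    fix p q show "\<exists>t. t \<in> carrier (tensor (KX p) (KY q)) \<and>
      (\<forall>z\<in>elems X {1..fst (p, q)}. \<forall>w\<in>elems Y {1..snd (p, q)}.
        tensor_eval (KX (fst (p, q))) (KY (snd (p, q))) z w t = c (fst (p, q)) (snd (p, q)) z w)"
      if "n = p + q"
      using ex[OF that[symmetric]] by (simp add: Bex_def)
  qed
  from bchoice[OF this] obtain u where U: "\<forall>k\<in>?J. u k \<in> carrier (koszul_tensor X Y k) \<and>
      (\<forall>z\<in>elems X {1..fst k}. \<forall>w\<in>elems Y {1..snd k}.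
        tensor_eval (KX (fst k)) (KY (snd k)) z w (u k) = c (fst k) (snd k) z w)"
    by blast
  have u: "u (p, q) \<in> carrier (tensor (KX p) (KY q))"
    and eval: "\<lbrakk>z \<in> elems X {1..p}; w \<in> elems Y {1..q}\<rbrakk> \<Longrightarrow>
        tensor_eval (KX p) (KY q) z w (u (p, q)) = c p q z w"
    if "p + q = n" for p q z w
    using bspec[OF U, of "(p, q)"] that by simp_all
  have x: "restrict u ?J \<in> carrier (source_space n)"
    unfolding direct_sum_simps using u by auto
  have "kuenneth_map X Y n (restrict u ?J) = h"
  proof (rule koszul_cauchy_ext[OF Lin_closed[OF kuenneth_map_linear x] h])
    fix S T z w assume ST: "(S, T) \<in> decompositions {1..n}"
      and z: "z \<in> elems X S" and w: "w \<in> elems Y T"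
    note d = decompositionsD[OF ST]
    have fin: "finite S" "finite T" and card: "card S + card T = n" using d(5-7) by auto
    have "eval_family X Y (restrict u ?J) S T z w = c (card S) (card T) (standardize X S z) (standardize Y T w)"
      unfolding eval_family_def
      using eval[OF card Lin_closed[OF X.standardize_linear[OF fin(1) refl] z] Lin_closed[OF Y.standardize_linear[OF fin(2) refl] w]] card
      by simp
    then show "kuenneth_map X Y n (restrict u ?J) (gen S T z w) = h (gen S T z w)"
      unfolding kuenneth_map_gen[OF x ST z w] koszul_cauchy_shuffle[OF h ST refl refl z w] c_def by (rule arg_cong)
  qed
  with x show ?thesis by blast
qed

end

section \<open>Compatibility with the differentials\<close>

lemma (in E_bicomodule) koszul_differential_linear:
  "koszul_differential X p \<in> Lin (koszul_space X p) (koszul_space X (Suc p))"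
  using cochain_complex.differential_linear[OF koszul_complex_cochain, of p] by (simp add: koszul_complex_def)

text \<open>Both sides are linear in \<open>t\<close>, and for \<open>t = f \<otimes> g\<close> they equal \<open>(df)\<^sub>S(z) g(w)\<close>.\<close>

lemma (in E_bicomodule) tensor_eval_differential_left:
  assumes W: "function_space B W" and w: "w \<in> B" and S: "finite S" "card S = Suc p"
    and z: "z \<in> elems X S" and t: "t \<in> carrier (tensor (koszul_space X p) W)"
  shows "tensor_eval (koszul_space X (Suc p)) W (standardize X S z) w
      (tensor_map (koszul_space X p) W (koszul_space X (Suc p)) W (koszul_differential X p) (\<lambda>g. g) t) =
    coboundary X (\<lambda>S z. tensor_eval (koszul_space X p) W (standardize X S z) w t) S z"
proof -
  note vs = koszul_vectorspace[of p] function_spaceD(1)[OF W]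
  note tm = tensor_map[OF vs koszul_differential_linear Lin_id]
  note sz = Lin_closed[OF standardize_linear[OF S] z]
  have J: "finite (S - {i})" "card (S - {i}) = p" if "i \<in> S" for i using S that by simp_all
  have r: "standardize X (S - {i}) (rcoact X S (S - {i}) z) \<in> elems X {1..p}" if "i \<in> S" for i
    by (rule Lin_closed[OF standardize_linear[OF J[OF that]] Lin_closed[OF rcoact_linear[OF S(1)] z]]) auto
  have l: "standardize X (S - {i}) (lcoact X S (S - {i}) z) \<in> elems X {1..p}" if "i \<in> S" for i
    by (rule Lin_closed[OF standardize_linear[OF J[OF that]] Lin_closed[OF lcoact_linear[OF S(1)] z]]) auto
  note ev = tensor_eval[OF koszul_function_space W _ w]
  have "(\<lambda>t. coboundary X (\<lambda>S z. tensor_eval (koszul_space X p) W (standardize X S z) w t) S z) \<in>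
      Lin (tensor (koszul_space X p) W) scalars"
    unfolding coboundary_def
    by (intro Lin_scalars_sum Lin_scalars_mult Lin_scalars_diff ev(1) r l)
  from tensor_ext[OF vs scalars_vectorspace Lin_comp[OF tm(1) ev(1)[OF sz]] this _ t]
  show ?thesis
  proof this
    fix f g assume f: "f \<in> carrier (koszul_space X p)" and g: "g \<in> carrier W"
    have "koszul_form X p f" using f by (simp add: koszul_space_carrier)
    from koszul_differential_standardize[OF this S z]
    have "tensor_eval (koszul_space X (Suc p)) W (standardize X S z) w
       (tensor_map (koszul_space X p) W (koszul_space X (Suc p)) W (koszul_differential X p) (\<lambda>g. g) (pure_tensor (koszul_space X p) W f g))
       = coboundary X (\<lambda>S z. f (standardize X S z)) S z * g w"
      unfolding tm(2)[OF f g] ev(2)[OF sz Lin_closed[OF koszul_differential_linear f] g] by simp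
    also have "\<dots> = coboundary X (\<lambda>S z. tensor_eval (koszul_space X p) W (standardize X S z) w (pure_tensor (koszul_space X p) W f g)) S z"
      unfolding coboundary_def sum_distrib_right
      by (rule sum.cong[OF refl]) (simp add: ev(2)[OF r f g] ev(2)[OF l f g] left_diff_distrib right_diff_distrib mult.assoc)
    finally show "tensor_eval (koszul_space X (Suc p)) W (standardize X S z) w
       (tensor_map (koszul_space X p) W (koszul_space X (Suc p)) W (koszul_differential X p) (\<lambda>g. g) (pure_tensor (koszul_space X p) W f g))
       = coboundary X (\<lambda>S z. tensor_eval (koszul_space X p) W (standardize X S z) w (pure_tensor (koszul_space X p) W f g)) S z" .
  qed
qed

lemma (in E_bicomodule) tensor_eval_differential_right:
  assumes V: "function_space A V" and v: "v \<in> A" and S: "finite S" "card S = Suc p"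
    and z: "z \<in> elems X S" and t: "t \<in> carrier (tensor V (koszul_space X p))"
  shows "tensor_eval V (koszul_space X (Suc p)) v (standardize X S z)
      (tensor_map V (koszul_space X p) V (koszul_space X (Suc p)) (\<lambda>f. f) (koszul_differential X p) t) =
    coboundary X (\<lambda>S z. tensor_eval V (koszul_space X p) v (standardize X S z) t) S z"
proof -
  let ?K = "koszul_space X p" and ?K' = "koszul_space X (Suc p)" and ?d = "koszul_differential X p"
  let ?r = "tensor_map V ?K V ?K' (\<lambda>f. f) ?d" and ?e = "tensor_eval V ?K' v (standardize X S z)"
  note V' = function_spaceD(1)[OF V]
  note r = tensor_map[OF V' koszul_vectorspace Lin_id koszul_differential_linear]
  note l = tensor_map[OF koszul_vectorspace V' koszul_differential_linear Lin_id]
  note sw = tensor_swap[OF V' koszul_vectorspace]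
  have J: "finite (S - {i})" "card (S - {i}) = p" if "i \<in> S" for i using S that by simp_all
  have swap: "tensor_eval ?K V (standardize X (S - {i}) y) v (tensor_swap V ?K t) =
      tensor_eval V ?K v (standardize X (S - {i}) y) t"
    if "i \<in> S" "y \<in> elems X (S - {i})" for i y
    by (rule tensor_eval_swap[OF V koszul_function_space v Lin_closed[OF standardize_linear[OF J[OF that(1)]] that(2)] t])
  have "tensor_swap V ?K' (?r t) = tensor_map ?K V ?K' V ?d (\<lambda>g. g) (tensor_swap V ?K t)"
    by (rule tensor_ext[OF V' koszul_vectorspace tensor_vectorspace Lin_comp[OF r(1) sw(1)] Lin_comp[OF sw(1) l(1)] _ t])
      (simp add: r(2) l(2) sw(2) Lin_closed[OF koszul_differential_linear])
  then have "?e (?r t) = tensor_eval ?K' V (standardize X S z) v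
      (tensor_map ?K V ?K' V ?d (\<lambda>g. g) (tensor_swap V ?K t))"
    using tensor_eval_swap[OF V koszul_function_space v Lin_closed[OF standardize_linear[OF S] z] Lin_closed[OF r(1) t]]
    by simp
  also have "\<dots> = coboundary X (\<lambda>S z. tensor_eval ?K V (standardize X S z) v (tensor_swap V ?K t)) S z"
    by (rule tensor_eval_differential_left[OF V v S z Lin_closed[OF sw(1) t]])
  also have "\<dots> = coboundary X (\<lambda>S z. tensor_eval V ?K v (standardize X S z) t) S z"
    unfolding coboundary_def
    by (intro sum.cong refl arg_cong2[of _ _ _ _ "(*)"] arg_cong2[of _ _ _ _ "(-)"] swap
        Lin_closed[OF rcoact_linear[OF S(1)] z] Lin_closed[OF lcoact_linear[OF S(1)] z]) auto
  finally show ?thesis .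
qed

lemma coboundary_cong:
  assumes "\<And>J z. \<lbrakk>finite J; Suc (card J) = card I\<rbrakk> \<Longrightarrow> \<phi> J = \<psi> J" and "finite I"
  shows "coboundary X \<phi> I z = coboundary X \<psi> I z"
proof -
  have "\<phi> (I - {i}) = \<psi> (I - {i})" if "i \<in> I" for i
    using assms(2) that card_Suc_Diff1[of I i] by (intro assms(1)) auto
  then show ?thesis unfolding coboundary_def by (intro sum.cong) simp_all
qed

context bicomodule_pair
begin

text \<open>The two components of the differential of the tensor product complex are evaluated separately. In the
boundary cases \<open>card S = 0\<close> and \<open>card T = 0\<close> the coboundary is an empty sum.\<close>

lemma eval_family_differential:
  assumes x: "x \<in> carrier (source_space n)" and fin: "finite S" "finite T" and card: "card S + card T = Suc n"
    and z: "z \<in> elems X S" and w: "w \<in> elems Y T"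
  shows "eval_family X Y (differential (tensor_complex (koszul_complex X) (koszul_complex Y)) n x) S T z w =
    coboundary X (\<lambda>S z. eval_family X Y x S T z w) S z +
    (- 1) ^ card S * coboundary Y (\<lambda>T w. eval_family X Y x S T z w) T w"
proof -
  define p q where "p = card S" and "q = card T"
  let ?T = "tensor (KX p) (KY q)"
  define A where "A = (if p = 0 then \<zero>\<^bsub>?T\<^esub> else tensor_map (KX (p - 1)) (KY q)
     (KX p) (KY q) (koszul_differential X (p - 1)) (\<lambda>g. g) (x (p - 1, q)))"
  define B where "B = (if q = 0 then \<zero>\<^bsub>?T\<^esub> else tensor_map (KX p) (KY (q - 1))
     (KX p) (KY q) (\<lambda>f. f) (koszul_differential Y (q - 1)) (x (p, q - 1)))"
  interpret T: vectorspace class_ring ?T by (rule tensor_vectorspace)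
  have st: "standardize X S z \<in> elems X {1..p}" "standardize Y T w \<in> elems Y {1..q}"
    using X.standardize_linear[OF fin(1) p_def[symmetric]] Y.standardize_linear[OF fin(2) q_def[symmetric]] z w
    by (auto intro: Lin_closed)
  let ?e = "tensor_eval (KX p) (KY q) (standardize X S z) (standardize Y T w)"
  note e = tensor_eval_linear[OF X.koszul_function_space Y.koszul_function_space st]
  have zero: "\<zero>\<^bsub>?T\<^esub> \<in> carrier ?T" by simp
  have e0: "?e \<zero>\<^bsub>?T\<^esub> = 0"
    using Lin_zero[OF tensor_vectorspace scalars_vectorspace e] by simp
  have dx: "differential (tensor_complex (koszul_complex X) (koszul_complex Y)) n x (p, q) =
      A \<oplus>\<^bsub>?T\<^esub> (if q = 0 then \<zero>\<^bsub>?T\<^esub> else (- 1) ^ p \<odot>\<^bsub>?T\<^esub> B)"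
    using card unfolding tensor_complex_def Let_def koszul_complex_def A_def B_def p_def q_def by simp
  have A: "A \<in> carrier ?T \<and> ?e A = coboundary X (\<lambda>S z. eval_family X Y x S T z w) S z"
  proof (cases p)
    case 0
    then have "S = {}" using fin by (simp add: p_def)
    then show ?thesis using e0 zero by (simp add: A_def 0 coboundary_def)
  next
    case (Suc r)
    have S: "card S = Suc r" and rq: "r + q = n" using Suc card by (simp_all add: p_def q_def)
    note t = koszul_tensor_component[OF x rq]
    have Ar: "A = tensor_map (KX r) (KY q)
       (KX (Suc r)) (KY q) (koszul_differential X r) (\<lambda>g. g) (x (r, q))"
      by (simp add: A_def Suc)
    have "?e A = coboundary X (\<lambda>S z. tensor_eval (KX r) (KY q) (standardize X S z) (standardize Y T w) (x (r, q))) S z"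
      unfolding Ar unfolding Suc by (rule X.tensor_eval_differential_left[OF Y.koszul_function_space st(2) fin(1) S z t])
    also have "\<dots> = coboundary X (\<lambda>S z. eval_family X Y x S T z w) S z"
      by (rule coboundary_cong[OF _ fin(1)]) (simp add: eval_family_def S q_def fun_eq_iff)
    finally show ?thesis
      unfolding Ar using Lin_closed[OF tensor_map_linear[OF X.koszul_vectorspace Y.koszul_vectorspace
            X.koszul_differential_linear Lin_id] t] by (simp add: Suc)
  qed
  have B: "B \<in> carrier ?T \<and> ?e B = coboundary Y (\<lambda>T w. eval_family X Y x S T z w) T w"
  proof (cases q)
    case 0
    then have "T = {}" using fin by (simp add: q_def)
    then show ?thesis using e0 zero by (simp add: B_def 0 coboundary_def)
  next
    case (Suc r)
    have T: "card T = Suc r" and rq: "p + r = n" using Suc card by (simp_all add: p_def q_def)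
    note t = koszul_tensor_component[OF x rq]
    have Br: "B = tensor_map (KX p) (KY r)
       (KX p) (KY (Suc r)) (\<lambda>f. f) (koszul_differential Y r) (x (p, r))"
      by (simp add: B_def Suc)
    have "?e B = coboundary Y (\<lambda>T w. tensor_eval (KX p) (KY r) (standardize X S z) (standardize Y T w) (x (p, r))) T w"
      unfolding Br unfolding Suc by (rule Y.tensor_eval_differential_right[OF X.koszul_function_space st(1) fin(2) T w t])
    also have "\<dots> = coboundary Y (\<lambda>T w. eval_family X Y x S T z w) T w"
      by (rule coboundary_cong[OF _ fin(2)]) (simp add: eval_family_def T p_def fun_eq_iff)
    finally show ?thesis
      unfolding Br using Lin_closed[OF tensor_map_linear[OF X.koszul_vectorspace Y.koszul_vectorspace
            Lin_id Y.koszul_differential_linear] t] by (simp add: Suc)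
  qed
  have B': "(if q = 0 then \<zero>\<^bsub>?T\<^esub> else (- 1) ^ p \<odot>\<^bsub>?T\<^esub> B) = (- 1) ^ p \<odot>\<^bsub>?T\<^esub> B"
  proof -
    have "(- 1) ^ p \<odot>\<^bsub>?T\<^esub> \<zero>\<^bsub>?T\<^esub> = \<zero>\<^bsub>?T\<^esub>" by (simp add: T.smult_r_null)
    then show ?thesis by (cases "q = 0") (simp_all add: B_def)
  qed
  show ?thesis
    unfolding eval_family_def[of X Y _ S T] p_def[symmetric] q_def[symmetric] dx B'
    using A B Lin_add[OF e, of A "(- 1) ^ p \<odot>\<^bsub>?T\<^esub> B"] Lin_smult[OF e, of B "(- 1) ^ p"]
      vectorspace_closed(3)[OF tensor_vectorspace, of B] by simp
qed

lemma cauchy_coact_at_gen: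
  assumes I: "finite I" "J \<subseteq> I" and ST: "(S, T) \<in> decompositions I"
    and z: "z \<in> elems X S" and w: "w \<in> elems Y T"
  shows "rcoact XY I J (gen S T z w) =
      gen (S \<inter> J) (T \<inter> J) (rcoact X S (S \<inter> J) z) (rcoact Y T (T \<inter> J) w)"
    and "lcoact XY I J (gen S T z w) =
      gen (S \<inter> J) (T \<inter> J) (lcoact X S (S \<inter> J) z) (lcoact Y T (T \<inter> J) w)"
  unfolding cauchy_product_simps
  by (rule cauchy_coact_gen[OF X.rcoact_linear Y.rcoact_linear I ST z w]; assumption)
    (rule cauchy_coact_gen[OF X.lcoact_linear Y.lcoact_linear I ST z w]; assumption)

lemma cauchy_coact_closed:
  assumes "finite I" "y \<in> elems XY I"
  shows "rcoact XY I J y \<in> elems XY J" and "lcoact XY I J y \<in> elems XY J"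
  unfolding cauchy_product_simps(2,3)
  by (rule Lin_closed[OF cauchy_coact_linear[OF X.rcoact_linear Y.rcoact_linear assms(1)] assms(2)]; assumption)
    (rule Lin_closed[OF cauchy_coact_linear[OF X.lcoact_linear Y.lcoact_linear assms(1)] assms(2)]; assumption)

lemma coboundary_pairing_linear:
  assumes b: "bialternating X Y n b" and I: "finite I" "card I = Suc n"
  shows "coboundary XY (pairing b) I \<in> Lin (space_on XY I) scalars"
  unfolding coboundary_def[abs_def]
proof (intro Lin_scalars_sum Lin_scalars_mult Lin_scalars_diff)
  fix i assume "i \<in> I"
  then have J: "finite (I - {i})" "card (I - {i}) = n" using I by simp_all
  have r: "rcoact XY I (I - {i}) \<in> Lin (space_on XY I) (space_on XY (I - {i}))"
    unfolding cauchy_product_simps(3) by (rule cauchy_coact_linear[OF X.rcoact_linear Y.rcoact_linear I(1)])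
  have l: "lcoact XY I (I - {i}) \<in> Lin (space_on XY I) (space_on XY (I - {i}))"
    unfolding cauchy_product_simps(2) by (rule cauchy_coact_linear[OF X.lcoact_linear Y.lcoact_linear I(1)])
  show "(\<lambda>y. pairing b (I - {i}) (rcoact XY I (I - {i}) y)) \<in> Lin (space_on XY I) scalars"
    by (rule Lin_comp[OF r shuffle_pairing_linear[OF b J]])
  show "(\<lambda>y. pairing b (I - {i}) (lcoact XY I (I - {i}) y)) \<in> Lin (space_on XY I) scalars"
    by (rule Lin_comp[OF l shuffle_pairing_linear[OF b J]])
qed

text \<open>A label \<open>i\<close> of \<open>S\<close> is removed from \<open>S\<close> only, so that the coaction on \<open>w\<close> is the identity by counitality;
likewise for \<open>T\<close>. For \<open>i \<in> S\<close> the shuffle sign of \<open>i\<close> and \<open>T\<close> combines with that of \<open>S - {i}\<close> and \<open>T\<close> to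
that of \<open>S\<close> and \<open>T\<close>. For \<open>i \<in> T\<close> the element \<open>i\<close> stands on the wrong side of \<open>S\<close>; exchanging it with all
elements of \<open>S\<close> costs \<open>(-1)\<close> to the power \<open>card S\<close>.\<close>

lemma coboundary_pairing_gen:
  assumes b: "bialternating X Y n b" and I: "finite I" "card I = Suc n" and ST: "(S, T) \<in> decompositions I"
    and z: "z \<in> elems X S" and w: "w \<in> elems Y T"
  shows "coboundary XY (pairing b) I (gen S T z w) = shuffle_sign S T *
    (coboundary X (\<lambda>S z. b S T z w) S z + (- 1) ^ card S * coboundary Y (\<lambda>T w. b S T z w) T w)"
proof -
  note d = decompositionsD[OF ST]
  have fin: "finite S" "finite T" using d(5,6) I by auto
  let ?g = "gen S T z w"
  let ?F = "\<lambda>i. shuffle_sign {i} (I - {i}) * (pairing b (I - {i}) (rcoact XY I (I - {i}) ?g) -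
      pairing b (I - {i}) (lcoact XY I (I - {i}) ?g))"
  have left: "?F i = shuffle_sign S T * (shuffle_sign {i} (S - {i}) *
      (b (S - {i}) T (rcoact X S (S - {i}) z) w - b (S - {i}) T (lcoact X S (S - {i}) z) w))" if i: "i \<in> S" for i
  proof -
    have J: "I - {i} \<subseteq> I" "S \<inter> (I - {i}) = S - {i}" "T \<inter> (I - {i}) = T" "I - {i} = (S - {i}) \<union> T"
      using d(1,2) i by auto
    have fJ: "finite (I - {i})" "card (I - {i}) = n" using I i d(3) by (simp_all add: subset_iff)
    have ST': "(S - {i}, T) \<in> decompositions (I - {i})" using d(2) unfolding J(4) by (auto simp: decompositions_def)
    have cl: "rcoact X S (S - {i}) z \<in> elems X (S - {i})" "lcoact X S (S - {i}) z \<in> elems X (S - {i})"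
      by (rule Lin_closed[OF X.rcoact_linear[OF fin(1)] z], blast) (rule Lin_closed[OF X.lcoact_linear[OF fin(1)] z], blast)
    have s1: "shuffle_sign {i} (I - {i}) = shuffle_sign {i} (S - {i}) * (shuffle_sign {i} T :: 'k)"
      unfolding J(4) using fin d(2) by (intro shuffle_sign_Un_right) auto
    have "shuffle_sign ({i} \<union> (S - {i})) T = shuffle_sign {i} T * (shuffle_sign (S - {i}) T :: 'k)"
      using fin by (intro shuffle_sign_Un_left) auto
    moreover have "{i} \<union> (S - {i}) = S" using i by auto
    ultimately have s2: "shuffle_sign S T = shuffle_sign {i} T * (shuffle_sign (S - {i}) T :: 'k)" by simp
    show ?thesis
      unfolding cauchy_coact_at_gen[OF I(1) J(1) ST z w] J(2,3) Y.rcoact_counit[OF fin(2) w] Y.lcoact_counit[OF fin(2) w]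
        shuffle_pairing_gen[OF b fJ ST' cl(1) w] shuffle_pairing_gen[OF b fJ ST' cl(2) w] s1 s2
        right_diff_distrib[symmetric]
      by (simp only: ac_simps)
  qed
  have right: "?F i = shuffle_sign S T * ((- 1) ^ card S * (shuffle_sign {i} (T - {i}) *
      (b S (T - {i}) z (rcoact Y T (T - {i}) w) - b S (T - {i}) z (lcoact Y T (T - {i}) w))))" if i: "i \<in> T" for i
  proof -
    have J: "I - {i} \<subseteq> I" "S \<inter> (I - {i}) = S" "T \<inter> (I - {i}) = T - {i}" "I - {i} = S \<union> (T - {i})"
      using d(1,2) i by auto
    have fJ: "finite (I - {i})" "card (I - {i}) = n" using I i d(4) by (simp_all add: subset_iff)
    have ST': "(S, T - {i}) \<in> decompositions (I - {i})" using d(2) unfolding J(4) by (auto simp: decompositions_def)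
    have cl: "rcoact Y T (T - {i}) w \<in> elems Y (T - {i})" "lcoact Y T (T - {i}) w \<in> elems Y (T - {i})"
      by (rule Lin_closed[OF Y.rcoact_linear[OF fin(2)] w], blast) (rule Lin_closed[OF Y.lcoact_linear[OF fin(2)] w], blast)
    have "i \<notin> S" using i d(2) by auto
    then have s1: "shuffle_sign {i} (I - {i}) = (- 1) ^ card S * shuffle_sign S {i} * (shuffle_sign {i} (T - {i}) :: 'k)"
      unfolding J(4) shuffle_sign_swap[OF fin(1) \<open>i \<notin> S\<close>, symmetric] using fin d(2) by (intro shuffle_sign_Un_right) auto
    have "shuffle_sign S ({i} \<union> (T - {i})) = shuffle_sign S {i} * (shuffle_sign S (T - {i}) :: 'k)"
      using fin by (intro shuffle_sign_Un_right) auto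
    moreover have "{i} \<union> (T - {i}) = T" using i by auto
    ultimately have s2: "shuffle_sign S T = shuffle_sign S {i} * (shuffle_sign S (T - {i}) :: 'k)" by simp
    show ?thesis
      unfolding cauchy_coact_at_gen[OF I(1) J(1) ST z w] J(2,3) X.rcoact_counit[OF fin(1) z] X.lcoact_counit[OF fin(1) z]
        shuffle_pairing_gen[OF b fJ ST' z cl(1)] shuffle_pairing_gen[OF b fJ ST' z cl(2)] s1 s2
        right_diff_distrib[symmetric]
      by (simp only: ac_simps)
  qed
  have "coboundary XY (pairing b) I ?g = sum ?F S + sum ?F T"
    unfolding coboundary_def using sum.union_disjoint[OF fin d(2), of ?F] by (simp only: d(1)[symmetric])
  also have "sum ?F S = shuffle_sign S T * coboundary X (\<lambda>S z. b S T z w) S z"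
    unfolding coboundary_def sum_distrib_left by (rule sum.cong[OF refl left])
  also have "sum ?F T = shuffle_sign S T * ((- 1) ^ card S * coboundary Y (\<lambda>T w. b S T z w) T w)"
    unfolding coboundary_def sum_distrib_left by (rule sum.cong[OF refl right])
  finally show ?thesis by (simp only: distrib_left)
qed

lemma kuenneth_map_differential:
  assumes x: "x \<in> carrier (source_space n)"
    and dx: "differential (tensor_complex (koszul_complex X) (koszul_complex Y)) n x \<in> carrier (source_space (Suc n))"
  shows "koszul_differential XY n (kuenneth_map X Y n x) =
    kuenneth_map X Y (Suc n) (differential (tensor_complex (koszul_complex X) (koszul_complex Y)) n x)"
    (is "?l = ?r")
proof (rule extensionalityI)
  let ?b = "eval_family X Y x" and ?I = "{1..Suc n}"
  note b = eval_family_bialternating[OF x]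
  have r: "?r \<in> carrier (KXY (Suc n))" by (rule Lin_closed[OF kuenneth_map_linear dx])
  show "?l \<in> extensional (elems XY ?I)" by (rule koszul_differential_extensional)
  show "?r \<in> extensional (elems XY ?I)" using r by (simp add: koszul_space_carrier)
  fix y assume y: "y \<in> elems XY ?I"
  have std: "kuenneth_map X Y n x (standardize XY J v) = pairing ?b J v"
    if J: "finite J" "card J = n" and v: "v \<in> elems XY J" for J v
  proof -
    have "standardize XY J v \<in> elems XY (rank_in J ` J)"
      by (rule Lin_closed[OF cauchy_transport_linear[OF J(1) rank_in_inj[OF J(1)]] v])
    then have "standardize XY J v \<in> elems XY {1..n}"
      unfolding finite_card_rank_image[OF J(1)] J(2) .
    then show ?thesis
      using kuenneth_map_pairing[OF x] alternating_standardize[OF shuffle_pairing_alternating[OF b] J v] by simp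
  qed
  have "?l y = coboundary XY (\<lambda>J v. kuenneth_map X Y n x (standardize XY J v)) ?I y"
    by (rule koszul_differential_coboundary[OF y])
  also have "\<dots> = coboundary XY (pairing ?b) ?I y"
    unfolding coboundary_def
  proof (rule sum.cong[OF refl])
    fix i assume "i \<in> ?I"
    then have J: "finite (?I - {i})" "card (?I - {i}) = n" by simp_all
    note c = cauchy_coact_closed[OF finite_atLeastAtMost y, of "?I - {i}"]
    show "shuffle_sign {i} (?I - {i}) * (kuenneth_map X Y n x (standardize XY (?I - {i}) (rcoact XY ?I (?I - {i}) y)) -
        kuenneth_map X Y n x (standardize XY (?I - {i}) (lcoact XY ?I (?I - {i}) y))) =
      shuffle_sign {i} (?I - {i}) * (pairing ?b (?I - {i}) (rcoact XY ?I (?I - {i}) y) -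
        pairing ?b (?I - {i}) (lcoact XY ?I (?I - {i}) y))"
      unfolding std[OF J c(1)] std[OF J c(2)] ..
  qed
  also have "\<dots> = ?r y"
  proof (rule cauchy_ext[OF finite_atLeastAtMost scalars_vectorspace coboundary_pairing_linear[OF b finite_atLeastAtMost] _ _ y])
    show "?r \<in> Lin (space_on XY ?I) scalars" using r by (simp add: koszul_space_carrier koszul_form_def)
    fix S T z w assume ST: "(S, T) \<in> decompositions ?I"
      and z: "z \<in> elems X S" and w: "w \<in> elems Y T"
    have fin: "finite S" "finite T" "card S + card T = Suc n" using decompositionsD(5-7)[OF ST] by simp_all
    show "coboundary XY (pairing ?b) ?I (gen S T z w) = ?r (gen S T z w)"
      unfolding kuenneth_map_gen[OF dx ST z w] eval_family_differential[OF x fin z w]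
      by (rule coboundary_pairing_gen[OF b finite_atLeastAtMost _ ST z w]) simp
  qed simp
  finally show "?l y = ?r y" .
qed

end

text \<open>Every property of the differential of \<open>D\<close> is pulled back along the bijections \<open>\<phi> n\<close> to \<open>C\<close>. For the Cauchy
product this replaces a verification of the bicomodule axioms.\<close>

lemma cochain_isomorphism_transfer:
  assumes C: "cochain_complex C"
    and D: "\<And>n. vectorspace class_ring (degree_space D n)"
    and lin: "\<And>n. \<phi> n \<in> Lin (degree_space C n) (degree_space D n)"
    and bij: "\<And>n. bij_betw (\<phi> n) (carrier (degree_space C n)) (carrier (degree_space D n))"
    and comm: "\<And>n c. c \<in> carrier (degree_space C n) \<Longrightarrow>
      \<phi> (Suc n) (differential C n c) = differential D n (\<phi> n c)"
  shows "cochain_isomorphism C D \<phi>"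
proof -
  interpret C: cochain_complex C by (rule C)
  note dC = C.differential_linear
  have surj: "\<exists>c. c \<in> carrier (degree_space C n) \<and> d = \<phi> n c" if "d \<in> carrier (degree_space D n)" for n d
    using bij[of n] that unfolding bij_betw_def by blast
  have "cochain_complex D"
  proof (rule cochain_complex.intro)
    show "vectorspace class_ring (degree_space D n)" for n by (rule D)
    show "differential D n \<in> Lin (degree_space D n) (degree_space D (Suc n))" for n
    proof (rule LinI)
      fix u assume "u \<in> carrier (degree_space D n)"
      then obtain a where a: "a \<in> carrier (degree_space C n)" "u = \<phi> n a" using surj by blast
      show "differential D n u \<in> carrier (degree_space D (Suc n))"
        unfolding a(2) comm[OF a(1), symmetric] by (rule Lin_closed[OF lin Lin_closed[OF dC a(1)]])
      show "differential D n (c \<odot>\<^bsub>degree_space D n\<^esub> u) = c \<odot>\<^bsub>degree_space D (Suc n)\<^esub> differential D n u" for c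
        unfolding a(2) Lin_smult[OF lin a(1), symmetric] comm[OF a(1), symmetric]
          comm[OF vectorspace_closed(3)[OF C.degree_space a(1)], symmetric]
          Lin_smult[OF dC a(1)] Lin_smult[OF lin Lin_closed[OF dC a(1)]] ..
      fix v assume "v \<in> carrier (degree_space D n)"
      then obtain b where b: "b \<in> carrier (degree_space C n)" "v = \<phi> n b" using surj by blast
      show "differential D n (u \<oplus>\<^bsub>degree_space D n\<^esub> v) =
          differential D n u \<oplus>\<^bsub>degree_space D (Suc n)\<^esub> differential D n v"
        unfolding a(2) b(2) Lin_add[OF lin a(1) b(1), symmetric] comm[OF a(1), symmetric] comm[OF b(1), symmetric]
          comm[OF vectorspace_closed(2)[OF C.degree_space a(1) b(1)], symmetric]
          Lin_add[OF dC a(1) b(1)] Lin_add[OF lin Lin_closed[OF dC a(1)] Lin_closed[OF dC b(1)]] ..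
    qed
    fix n u assume "u \<in> carrier (degree_space D n)"
    then obtain a where a: "a \<in> carrier (degree_space C n)" "u = \<phi> n a" using surj by blast
    show "differential D (Suc n) (differential D n u) = \<zero>\<^bsub>degree_space D (Suc (Suc n))\<^esub>"
      unfolding a(2) comm[OF a(1), symmetric] comm[OF Lin_closed[OF dC a(1)], symmetric]
        C.differential_squared[OF a(1)] by (rule Lin_zero[OF C.degree_space D lin])
  qed
  then show ?thesis
    by (intro cochain_isomorphism.intro cochain_map.intro cochain_map_axioms.intro cochain_isomorphism_axioms.intro
        C lin bij comm)
qed

theorem theorem3p4:
  fixes X :: "('k::field_char_0, 'a) bicomodule_data"
    and Y :: "('k, 'b) bicomodule_data"
  assumes "E_bicomodule X" and "E_bicomodule Y"
    and "locally_finite X \<or> locally_finite Y"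
  shows "cochain_isomorphism
           (tensor_complex (koszul_complex X) (koszul_complex Y))
           (koszul_complex (cauchy_product X Y))
           (kuenneth_map X Y)"
proof -
  interpret X: E_bicomodule X by (rule assms)
  interpret Y: E_bicomodule Y by (rule assms)
  interpret bicomodule_pair X Y by unfold_locales
  let ?C = "tensor_complex (koszul_complex X) (koszul_complex Y)"
  have C: "cochain_complex ?C"
    by (rule tensor_complex_cochain[OF X.koszul_complex_cochain Y.koszul_complex_cochain])
  have source: "degree_space ?C n = source_space n" for n
    unfolding tensor_complex_def Let_def koszul_complex_def by simp
  have target: "degree_space (koszul_complex XY) n = koszul_space XY n"
    "differential (koszul_complex XY) n = koszul_differential XY n" for n
    by (simp_all add: koszul_complex_def)
  show ?thesis
  proof (rule cochain_isomorphism_transfer[OF C]; (unfold source target)?)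
    show "vectorspace class_ring (koszul_space XY n)" for n by (rule koszul_cauchy_vectorspace)
    show "kuenneth_map X Y n \<in> Lin (source_space n) (koszul_space XY n)" for n by (rule kuenneth_map_linear)
    show "bij_betw (kuenneth_map X Y n) (carrier (source_space n)) (carrier (koszul_space XY n))" for n
      unfolding bij_betw_def
      using kuenneth_map_inj[OF assms(3)] kuenneth_map_surj[OF assms(3)] Lin_closed[OF kuenneth_map_linear]
      by blast
    fix n x assume x: "x \<in> carrier (source_space n)"
    have "differential ?C n x \<in> carrier (source_space (Suc n))"
      using Lin_closed[OF cochain_complex.differential_linear[OF C], of x n] x unfolding source by blast
    from kuenneth_map_differential[OF x this]
    show "kuenneth_map X Y (Suc n) (differential ?C n x) = koszul_differential XY n (kuenneth_map X Y n x)" ..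
  qed
qed

end
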